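(* There is an algorithm, running in time polynomial in $m$ and $n$, which, given a matrix $S\in\mathbb{R}^{m\times n}$, correctly determines whether $S$ is a $1$-product and, in case it is, outputs two (non-empty) matrices $S_1,S_2$ such that $S_1\otimes S_2$ is isomorphic to $S$.
   Context: For a matrix $S$, $S^{\ell}$ denotes its $\ell$th column, and $[k]:=\{1,\dots,k\}$. The $1$-product of $S_1\in\mathbb{R}^{m_1\times n_1}$ and $S_2\in\mathbb{R}^{m_2\times n_2}$ is the matrix $S_1\otimes S_2\in\mathbb{R}^{(m_1+m_2)\times(n_1n_2)}$ such that for each $j\in[n_1 n_2]$, $(S_1\otimes S_2)^j=\begin{pmatrix}S_1^k\\ S_2^\ell\end{pmatrix}$, where $k\in[n_1]$, $\ell\in[n_2]$ satisfy $j=(k-1)n_2+\ell$. (This is not the Kronecker product.) Two matrices are isomorphic if one can be obtained from the other by permuting rows and columns. A matrix $S$ is a $1$-product if there exist two non-empty matrices $S_1$ and $S_2$ such that $S$ is isomorphic to $S_1\otimes S_2$. *)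

theory Defs
  imports
    "HOL-Combinatorics.Permutations"
    "HOL-Computational_Algebra.Polynomial"
    "Jordan_Normal_Form.Matrix"
begin

section \<open>The 1-product of matrices\<close>

definition one_prod :: "'a mat \<Rightarrow> 'a mat \<Rightarrow> 'a mat" where
  "one_prod S1 S2 =
     mat (dim_row S1 + dim_row S2) (dim_col S1 * dim_col S2)
       (\<lambda>(i, j). if i < dim_row S1 then S1 $$ (i, j div dim_col S2)
                 else S2 $$ (i - dim_row S1, j mod dim_col S2))"

text \<open>With columns counted from 0, the relation j = (k - 1) n2 + l between 1-based indices
  becomes j = k n2 + l, where k = j div n2 and l = j mod n2.\<close>

lemma col_one_prod:
  assumes "k < dim_col S1" and "l < dim_col S2"
  shows "col (one_prod S1 S2) (k * dim_col S2 + l) = col S1 k @\<^sub>v col S2 l"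
proof -
  have "k * dim_col S2 + l < Suc k * dim_col S2" using assms(2) by simp
  also have "\<dots> \<le> dim_col S1 * dim_col S2" using assms(1) by (intro mult_le_mono1) simp
  finally show ?thesis
    using assms by (intro eq_vecI) (auto simp: one_prod_def)
qed

definition isomorphic_mat :: "'a mat \<Rightarrow> 'a mat \<Rightarrow> bool" where
  "isomorphic_mat S T \<longleftrightarrow>
     dim_row S = dim_row T \<and> dim_col S = dim_col T \<and>
     (\<exists>\<pi> \<sigma>. \<pi> permutes {..<dim_row T} \<and> \<sigma> permutes {..<dim_col T} \<and>
        (\<forall>i < dim_row T. \<forall>j < dim_col T. S $$ (i, j) = T $$ (\<pi> i, \<sigma> j)))"

definition nonempty_mat :: "'a mat \<Rightarrow> bool" where
  "nonempty_mat S \<longleftrightarrow> 0 < dim_row S \<and> 0 < dim_col S"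

definition is_one_product :: "'a mat \<Rightarrow> bool" where
  "is_one_product S \<longleftrightarrow>
     (\<exists>S1 S2. nonempty_mat S1 \<and> nonempty_mat S2 \<and> isomorphic_mat S (one_prod S1 S2))"

section \<open>Algorithms on real inputs: a real RAM\<close>

text \<open>
  The memory consists of unboundedly long arrays of natural numbers and of real numbers; a
  program mentions only finitely many array names, and a scalar variable is cell 0 of an array.
  Real cells hold exact reals with unit-cost field operations and comparisons. Natural number
  cells serve for counting and indirect addressing. In keeping with the usual unit-cost RAM, the
  only arithmetic on them is addition and truncated subtraction (unit-cost multiplication would
  produce doubly exponential numbers), and no operation (such as floor) converts reals to
  natural numbers. Real literals are natural numbers, so a program cannot carry an infinite
  amount of information in a constant.
\<close>

record state =
  nats :: "string \<Rightarrow> nat \<Rightarrow> nat"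
  reals :: "string \<Rightarrow> nat \<Rightarrow> real"

datatype nexp = NConst nat | NRead string nexp | NAdd nexp nexp | NSub nexp nexp

datatype rexp = RConst nat | RRead string nexp
  | RAdd rexp rexp | RSub rexp rexp | RMult rexp rexp | RDiv rexp rexp

datatype bexp = NLess nexp nexp | NEq nexp nexp | RLess rexp rexp | REq rexp rexp
  | BNot bexp | BAnd bexp bexp

datatype com = Skip
  | NAssign string nexp nexp
  | RAssign string nexp rexp
  | Seq com com
  | Cond bexp com com
  | While bexp com

primrec nval :: "nexp \<Rightarrow> state \<Rightarrow> nat" where
  "nval (NConst k) s = k"
| "nval (NRead a e) s = nats s a (nval e s)"
| "nval (NAdd e f) s = nval e s + nval f s"
| "nval (NSub e f) s = nval e s - nval f s"

text \<open>Division by zero yields 0; this adds no power, as a program can test the divisor.\<close>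

primrec rval :: "rexp \<Rightarrow> state \<Rightarrow> real" where
  "rval (RConst k) s = real k"
| "rval (RRead a e) s = reals s a (nval e s)"
| "rval (RAdd e f) s = rval e s + rval f s"
| "rval (RSub e f) s = rval e s - rval f s"
| "rval (RMult e f) s = rval e s * rval f s"
| "rval (RDiv e f) s = rval e s / rval f s"

primrec bval :: "bexp \<Rightarrow> state \<Rightarrow> bool" where
  "bval (NLess e f) s \<longleftrightarrow> nval e s < nval f s"
| "bval (NEq e f) s \<longleftrightarrow> nval e s = nval f s"
| "bval (RLess e f) s \<longleftrightarrow> rval e s < rval f s"
| "bval (REq e f) s \<longleftrightarrow> rval e s = rval f s"
| "bval (BNot b) s \<longleftrightarrow> \<not> bval b s"
| "bval (BAnd b c) s \<longleftrightarrow> bval b s \<and> bval c s"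

text \<open>Evaluating an expression costs one time unit per node of its syntax tree.\<close>

primrec ncost :: "nexp \<Rightarrow> nat" where
  "ncost (NConst k) = 1"
| "ncost (NRead a e) = 1 + ncost e"
| "ncost (NAdd e f) = 1 + ncost e + ncost f"
| "ncost (NSub e f) = 1 + ncost e + ncost f"

primrec rcost :: "rexp \<Rightarrow> nat" where
  "rcost (RConst k) = 1"
| "rcost (RRead a e) = 1 + ncost e"
| "rcost (RAdd e f) = 1 + rcost e + rcost f"
| "rcost (RSub e f) = 1 + rcost e + rcost f"
| "rcost (RMult e f) = 1 + rcost e + rcost f"
| "rcost (RDiv e f) = 1 + rcost e + rcost f"

primrec bcost :: "bexp \<Rightarrow> nat" where
  "bcost (NLess e f) = 1 + ncost e + ncost f"
| "bcost (NEq e f) = 1 + ncost e + ncost f"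
| "bcost (RLess e f) = 1 + rcost e + rcost f"
| "bcost (REq e f) = 1 + rcost e + rcost f"
| "bcost (BNot b) = 1 + bcost b"
| "bcost (BAnd b c) = 1 + bcost b + bcost c"

definition nupdate :: "string \<Rightarrow> nat \<Rightarrow> nat \<Rightarrow> state \<Rightarrow> state" where
  "nupdate a i v s = s\<lparr>nats := (nats s)(a := (nats s a)(i := v))\<rparr>"

definition rupdate :: "string \<Rightarrow> nat \<Rightarrow> real \<Rightarrow> state \<Rightarrow> state" where
  "rupdate a i v s = s\<lparr>reals := (reals s)(a := (reals s a)(i := v))\<rparr>"

text \<open>\<open>exec c s t s'\<close>: started in \<open>s\<close>, the program \<open>c\<close> halts in \<open>s'\<close> after \<open>t\<close> time units.\<close>

inductive exec :: "com \<Rightarrow> state \<Rightarrow> nat \<Rightarrow> state \<Rightarrow> bool" where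
  Skip: "exec Skip s 1 s"
| NAssign: "exec (NAssign a e f) s (1 + ncost e + ncost f) (nupdate a (nval e s) (nval f s) s)"
| RAssign: "exec (RAssign a e f) s (1 + ncost e + rcost f) (rupdate a (nval e s) (rval f s) s)"
| Seq: "exec c s t s' \<Longrightarrow> exec d s' u s'' \<Longrightarrow> exec (Seq c d) s (t + u) s''"
| CondTrue: "bval b s \<Longrightarrow> exec c s t s' \<Longrightarrow> exec (Cond b c d) s (1 + bcost b + t) s'"
| CondFalse: "\<not> bval b s \<Longrightarrow> exec d s t s' \<Longrightarrow> exec (Cond b c d) s (1 + bcost b + t) s'"
| WhileFalse: "\<not> bval b s \<Longrightarrow> exec (While b c) s (1 + bcost b) s"
| WhileTrue: "bval b s \<Longrightarrow> exec c s t s' \<Longrightarrow> exec (While b c) s' u s'' \<Longrightarrow>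
    exec (While b c) s (1 + bcost b + t + u) s''"

inductive_cases exec_elims:
  "exec Skip s t s'"
  "exec (NAssign a e f) s t s'"
  "exec (RAssign a e f) s t s'"
  "exec (Seq c d) s t s'"
  "exec (Cond b c d) s t s'"

inductive_cases exec_While: "exec (While b c) s t s'"

lemma exec_deterministic: "exec c s t s' \<Longrightarrow> exec c s u s'' \<Longrightarrow> u = t \<and> s'' = s'"
proof (induction arbitrary: u s'' rule: exec.induct)
  case Skip
  then show ?case by (auto elim: exec_elims)
next
  case NAssign
  then show ?case by (auto elim: exec_elims)
next
  case RAssign
  then show ?case by (auto elim: exec_elims)
next
  case (Seq c s t s' d v s2)
  from Seq.prems obtain t' s1' v' where *: "u = t' + v'" "exec c s t' s1'" "exec d s1' v' s''"
    by (elim exec_elims) auto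
  from Seq.IH(1)[OF *(2)] have eq: "t' = t" "s1' = s'" by auto
  from *(3) have "exec d s' v' s''" by (simp only: eq)
  from Seq.IH(2)[OF this] *(1) eq show ?case by simp
next
  case (CondTrue b s c t s' d)
  from CondTrue.prems CondTrue.hyps(1) obtain u' where u': "u = 1 + bcost b + u'"
    and "exec c s u' s''" by (elim exec_elims) auto
  from CondTrue.IH[OF this(2)] u' show ?case by simp
next
  case (CondFalse b s d t s' c)
  from CondFalse.prems CondFalse.hyps(1) obtain u' where u': "u = 1 + bcost b + u'"
    and "exec d s u' s''" by (elim exec_elims) auto
  from CondFalse.IH[OF this(2)] u' show ?case by simp
next
  case (WhileFalse b s c)
  show ?case
  proof (rule exec_While[OF WhileFalse.prems])
    assume "u = Suc (bcost b)" "s'' = s"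
    then show ?thesis by simp
  next
    assume "bval b s"
    with WhileFalse.hyps show ?thesis by contradiction
  qed
next
  case (WhileTrue b s c t s1 v s2)
  show ?case
  proof (rule exec_While[OF WhileTrue.prems])
    assume "\<not> bval b s"
    from this WhileTrue.hyps(1) show ?thesis by contradiction
  next
    fix t' s1' v'
    assume u: "u = Suc (bcost b + t' + v')" and body: "exec c s t' s1'"
      and rest: "exec (While b c) s1' v' s''"
    from WhileTrue.IH(1)[OF body] have eq: "t' = t" "s1' = s1" by auto
    from rest have "exec (While b c) s1 v' s''" by (simp only: eq)
    from WhileTrue.IH(2)[OF this] u eq show ?thesis by simp
  qed
qed

section \<open>Encoding of inputs and outputs\<close>

text \<open>Matrices are stored in row-major order; all memory cells not holding input are zero.\<close>

definition input_state :: "real mat \<Rightarrow> state" where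
  "input_state S =
     \<lparr>nats = (\<lambda>_ _. 0)(''m'' := (\<lambda>_. 0)(0 := dim_row S), ''n'' := (\<lambda>_. 0)(0 := dim_col S)),
      reals = (\<lambda>_ _. 0)(''S'' := (\<lambda>k. if k < dim_row S * dim_col S
         then S $$ (k div dim_col S, k mod dim_col S) else 0))\<rparr>"

definition output_answer :: "state \<Rightarrow> nat" where
  "output_answer s = nats s ''answer'' 0"

definition stored_mat :: "state \<Rightarrow> string \<Rightarrow> nat \<Rightarrow> nat \<Rightarrow> real mat" where
  "stored_mat s a r c = mat r c (\<lambda>(i, j). reals s a (i * c + j))"

definition output_fst :: "state \<Rightarrow> real mat" where
  "output_fst s = stored_mat s ''S1'' (nats s ''m1'' 0) (nats s ''n1'' 0)"

definition output_snd :: "state \<Rightarrow> real mat" where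
  "output_snd s = stored_mat s ''S2'' (nats s ''m2'' 0) (nats s ''n2'' 0)"

text \<open>A polynomial in two variables is a polynomial whose coefficients are polynomials.\<close>

definition poly2 :: "nat poly poly \<Rightarrow> nat \<Rightarrow> nat \<Rightarrow> nat" where
  "poly2 p x y = poly (poly p [:x:]) y"

end

theory Submission
  imports Defs
begin

text \<open>
  Let \<open>f(w)\<close> be the number of columns of \<open>S\<close> equal to \<open>w\<close>. A set \<open>X\<close> of rows is one side of a
  1-product iff \<open>f\<close> is a product of a function of \<open>w\<close> on \<open>X\<close> and a function of \<open>w\<close> off \<open>X\<close>, that is, iff
  \<open>f(u) f(v) = f(u\<^sub>X v\<^sub>Y) f(v\<^sub>X u\<^sub>Y)\<close> for all columns \<open>u\<close> and \<open>v\<close>, where \<open>Y\<close> is the complement of \<open>X\<close>. Call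
  two rows linked if some columns \<open>u\<close>, \<open>v\<close> differ in both of them, but no column \<open>z\<close> strictly
  between \<open>u\<close> and \<open>v\<close> satisfies \<open>f(z) f(z') = f(u) f(v)\<close>, where \<open>z'\<close> is the vector opposite to \<open>z\<close>.
  Linked rows lie on the same side of every factorization. Conversely every set of rows closed
  under links is separable, by induction on the number of rows in which \<open>u\<close> and \<open>v\<close> differ. Hence \<open>S\<close>
  is a 1-product iff the graph of links is disconnected, and one of its components can serve as \<open>X\<close>.

  To split \<open>S\<close>, let \<open>d\<close> be the greatest common divisor of the sizes of the classes of columns that
  agree on \<open>X\<close>. Taking every \<open>d\<close>-th column of each of these classes gives \<open>S\<^sub>1\<close>, with \<open>n / d\<close> columns, and
  taking every \<open>(n / d)\<close>-th column of each class of columns that agree off \<open>X\<close> gives \<open>S\<^sub>2\<close>.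

  The program is not written down: a calculus of functions and state transformers that are
  computable in polynomial time is closed under bounded sums, bounded quantifiers and bounded
  loops, and the algorithm is an ordinary function built from these operations.
\<close>

section \<open>Polynomial-time computable functions on states\<close>

text \<open>Testing one given \<open>X\<close> is easy, but there are exponentially many candidates.
  The definition of a link does not mention \<open>X\<close>, and \<open>u\<close>, \<open>v\<close>
  and \<open>z\<close> range over the \<open>n\<close> columns only, so all links can be tested in
  polynomial time; the burden of the proof is that these pairwise constraints are the only ones.
  Multiplicities matter throughout: the criterion compares counts, not just which vectors occur, and
  its proof cancels counts known to be positive.

  The divisor \<open>d\<close> fixes a freedom of scale. If \<open>R\<close> and \<open>C\<close>
  are the sizes of the classes of a column on and off \<open>X\<close>, then
  \<open>R C = n f\<close>, so \<open>f = (R / d) (C / (n / d))\<close> for every \<open>d\<close>,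
  and both factors must be integral. Since mixtures of columns are columns again, \<open>n\<close>
  divides each product of some \<open>R\<close> with some \<open>C\<close>. Hence \<open>n\<close>
  divides \<open>d C\<close> when \<open>d\<close> is the gcd of all \<open>R\<close>, and
  \<open>n / d\<close> divides every \<open>C\<close>.

  On the machine, natural numbers can be neither multiplied nor divided in one step; products,
  divisibility and maxima are therefore rephrased as bounded sums and counts.\<close>

definition runs :: "com \<Rightarrow> state \<Rightarrow> nat \<Rightarrow> (state \<Rightarrow> bool) \<Rightarrow> bool" where
  "runs c s B Q \<longleftrightarrow> (\<exists>t s'. exec c s t s' \<and> t \<le> B \<and> Q s')"

lemma runs_conseq:
  assumes "runs c s B Q" and "B \<le> B'" and "\<And>s'. Q s' \<Longrightarrow> Q' s'"
  shows "runs c s B' Q'"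
  using assms unfolding runs_def by (meson order_trans)

lemma runs_Skip: "Q s \<Longrightarrow> runs Skip s 1 Q"
  unfolding runs_def using exec.Skip by blast

lemma runs_NAssign:
  "Q (nupdate a (nval e s) (nval f s) s) \<Longrightarrow> runs (NAssign a e f) s (1 + ncost e + ncost f) Q"
  unfolding runs_def using exec.NAssign by blast

lemma runs_RAssign:
  "Q (rupdate a (nval e s) (rval f s) s) \<Longrightarrow> runs (RAssign a e f) s (1 + ncost e + rcost f) Q"
  unfolding runs_def using exec.RAssign by blast

lemma runs_Seq:
  assumes "runs c s B Q" and "\<And>s'. Q s' \<Longrightarrow> runs d s' B' Q'"
  shows "runs (Seq c d) s (B + B') Q'"
proof -
  obtain t s' where *: "exec c s t s'" "t \<le> B" "Q s'"
    using assms(1) unfolding runs_def by blast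
  obtain u s'' where **: "exec d s' u s''" "u \<le> B'" "Q' s''"
    using assms(2)[OF *(3)] unfolding runs_def by blast
  show ?thesis
    unfolding runs_def using exec.Seq[OF *(1) **(1)] *(2) **(2,3) by (meson add_mono)
qed

text \<open>The bound charges for both branches, so it does not depend on the outcome of the
  test.\<close>

lemma runs_Cond:
  assumes "bval b s \<Longrightarrow> runs c s B Q" and "\<not> bval b s \<Longrightarrow> runs d s B' Q"
  shows "runs (Cond b c d) s (1 + bcost b + (B + B')) Q"
proof (cases "bval b s")
  case True
  then obtain t s' where *: "exec c s t s'" "t \<le> B" "Q s'"
    using assms(1) unfolding runs_def by blast
  have "1 + bcost b + t \<le> 1 + bcost b + (B + B')" using *(2) by simp
  then show ?thesis unfolding runs_def using exec.CondTrue[OF True *(1)] *(3) by blast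
next
  case False
  then obtain t s' where *: "exec d s t s'" "t \<le> B'" "Q s'"
    using assms(2) unfolding runs_def by blast
  have "1 + bcost b + t \<le> 1 + bcost b + (B + B')" using *(2) by simp
  then show ?thesis unfolding runs_def using exec.CondFalse[OF False *(1)] *(3) by blast
qed

text \<open>The invariant carries the round number, which alone decides the guard; termination and
  time then follow together by induction on the remaining \<open>K - k\<close> rounds.\<close>

lemma runs_While_count:
  assumes step: "\<And>k s. k < K \<Longrightarrow> I k s \<Longrightarrow> runs c s B (I (Suc k))"
    and guard: "\<And>k s. I k s \<Longrightarrow> bval b s \<longleftrightarrow> k < K"
    and "I k s" and "k \<le> K"
  shows "runs (While b c) s ((K - k) * (1 + bcost b + B) + (1 + bcost b)) (I K)"
  using assms(3,4)
proof (induction "K - k" arbitrary: k s)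
  case 0
  then have "k = K" by simp
  moreover have "\<not> bval b s" using 0 guard by fastforce
  ultimately show ?case
    using exec.WhileFalse[of b s c] 0 unfolding runs_def by (intro exI conjI) auto
next
  case (Suc r)
  then have less: "k < K" and r: "r = K - Suc k" by simp_all
  have "bval b s" using guard[OF Suc.prems(1)] less by simp
  moreover obtain t s' where *: "exec c s t s'" "t \<le> B" "I (Suc k) s'"
    using step[OF less Suc.prems(1)] unfolding runs_def by blast
  moreover obtain u s'' where **: "exec (While b c) s' u s''"
    "u \<le> (K - Suc k) * (1 + bcost b + B) + (1 + bcost b)" "I K s''"
    using Suc.hyps(1)[OF r *(3)] less unfolding runs_def by (metis Suc_leI)
  ultimately have "exec (While b c) s (1 + bcost b + t + u) s''"
    using exec.WhileTrue by blast
  moreover have "K - k = Suc (K - Suc k)" using less by simp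
  then have "1 + bcost b + t + u \<le> (K - k) * (1 + bcost b + B) + (1 + bcost b)"
    using *(2) **(2) by simp
  ultimately show ?case using **(3) unfolding runs_def by blast
qed

subsection \<open>Polynomial bounds\<close>

text \<open>The bound function is itself a polynomial, so composite bounds add and multiply without
  monotonicity arguments; slack enters only through \<open>t \<le> B\<close> in
  \<open>runs\<close>.\<close>

definition polybound :: "(nat \<Rightarrow> nat \<Rightarrow> nat) \<Rightarrow> bool" where
  "polybound B \<longleftrightarrow> (\<exists>p. \<forall>x y. B x y = poly2 p x y)"

lemma polybound_const: "polybound (\<lambda>x y. c)"
  unfolding polybound_def by (rule exI[of _ "[:[:c:]:]"]) (simp add: poly2_def)

lemma polybound_fst: "polybound (\<lambda>x y. x)"
  unfolding polybound_def by (rule exI[of _ "[:0, 1:]"]) (simp add: poly2_def)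

lemma polybound_snd: "polybound (\<lambda>x y. y)"
  unfolding polybound_def by (rule exI[of _ "[:[:0, 1:]:]"]) (simp add: poly2_def)

lemma polybound_add:
  assumes "polybound B" and "polybound C" shows "polybound (\<lambda>x y. B x y + C x y)"
proof -
  obtain p q where "\<And>x y. B x y = poly2 p x y" "\<And>x y. C x y = poly2 q x y"
    using assms unfolding polybound_def by blast
  then have "B x y + C x y = poly2 (p + q) x y" for x y by (simp add: poly2_def)
  then show ?thesis unfolding polybound_def by blast
qed

lemma polybound_mult:
  assumes "polybound B" and "polybound C" shows "polybound (\<lambda>x y. B x y * C x y)"
proof -
  obtain p q where "\<And>x y. B x y = poly2 p x y" "\<And>x y. C x y = poly2 q x y"
    using assms unfolding polybound_def by blast
  then have "B x y * C x y = poly2 (p * q) x y" for x y by (simp add: poly2_def)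
  then show ?thesis unfolding polybound_def by blast
qed

lemmas polybound_intros = polybound_add polybound_mult polybound_fst polybound_snd polybound_const

abbreviation nrows :: "state \<Rightarrow> nat" where "nrows s \<equiv> nats s ''m'' 0"
abbreviation ncols :: "state \<Rightarrow> nat" where "ncols s \<equiv> nats s ''n'' 0"

subsection \<open>Computable functions and predicates\<close>

text \<open>The array \<open>v\<close> holds loop variables and the array \<open>t\<close> is a stack of intermediate results.
  Semantic functions see the loop variables as an environment, and the rest of the state with
  both arrays blanked out.\<close>

definition glob :: "state \<Rightarrow> state" where
  "glob s = s\<lparr>nats := (nats s)(''t'' := (\<lambda>_. 0), ''v'' := (\<lambda>_. 0))\<rparr>"

abbreviation loc :: "state \<Rightarrow> nat \<Rightarrow> nat" where "loc s \<equiv> nats s ''v''"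

text \<open>In \<open>comp_fun d f\<close> and \<open>comp_cmd d F\<close> only the loop variables below \<open>d\<close> are in scope. The
  program for \<open>f\<close> must exist for every stack position \<open>k\<close>, and it must not disturb the stack below
  \<open>k\<close>, so that programs for subexpressions can be run one after the other.\<close>

definition pushes :: "com \<Rightarrow> (nat \<Rightarrow> nat \<Rightarrow> nat) \<Rightarrow> nat \<Rightarrow> ((nat \<Rightarrow> nat) \<Rightarrow> state \<Rightarrow> nat) \<Rightarrow> bool" where
  "pushes c B k f \<longleftrightarrow> polybound B \<and> (\<forall>s. runs c s (B (nrows s) (ncols s)) (\<lambda>s'.
     glob s' = glob s \<and> loc s' = loc s \<and>
     (\<forall>i<k. nats s' ''t'' i = nats s ''t'' i) \<and> nats s' ''t'' k = f (loc s) (glob s)))"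

definition comp_fun :: "nat \<Rightarrow> ((nat \<Rightarrow> nat) \<Rightarrow> state \<Rightarrow> nat) \<Rightarrow> bool" where
  "comp_fun d f \<longleftrightarrow>
     (\<forall>\<rho> \<rho>' \<sigma>. (\<forall>x<d. \<rho> x = \<rho>' x) \<longrightarrow> f \<rho> \<sigma> = f \<rho>' \<sigma>) \<and> (\<forall>k. \<exists>c B. pushes c B k f)"

definition comp_pred :: "nat \<Rightarrow> ((nat \<Rightarrow> nat) \<Rightarrow> state \<Rightarrow> bool) \<Rightarrow> bool" where
  "comp_pred d P \<longleftrightarrow> comp_fun d (\<lambda>\<rho> \<sigma>. of_bool (P \<rho> \<sigma>))"

text \<open>In contrast to \<open>pushes\<close>, a command may overwrite the whole stack and all
  loop variables from \<open>d\<close> on: between commands nothing is kept there.\<close>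

definition transforms :: "com \<Rightarrow> (nat \<Rightarrow> nat \<Rightarrow> nat) \<Rightarrow> nat \<Rightarrow> ((nat \<Rightarrow> nat) \<Rightarrow> state \<Rightarrow> state) \<Rightarrow> bool" where
  "transforms c B d F \<longleftrightarrow> polybound B \<and> (\<forall>s. runs c s (B (nrows s) (ncols s)) (\<lambda>s'.
     glob s' = F (loc s) (glob s) \<and> (\<forall>x<d. loc s' x = loc s x)))"

text \<open>Time bounds are evaluated at the dimensions found in the start state of each program.
  Keeping the dimensions fixed makes the bounds of consecutive commands refer to the same two
  numbers.\<close>

definition comp_cmd :: "nat \<Rightarrow> ((nat \<Rightarrow> nat) \<Rightarrow> state \<Rightarrow> state) \<Rightarrow> bool" where
  "comp_cmd d F \<longleftrightarrow>
     (\<forall>\<rho> \<rho>' \<sigma>. (\<forall>x<d. \<rho> x = \<rho>' x) \<longrightarrow> F \<rho> \<sigma> = F \<rho>' \<sigma>) \<and>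
     (\<forall>\<rho> \<sigma>. nrows (F \<rho> \<sigma>) = nrows \<sigma> \<and> ncols (F \<rho> \<sigma>) = ncols \<sigma>) \<and>
     (\<exists>c B. transforms c B d F)"

lemma nats_glob: "a \<noteq> ''t'' \<Longrightarrow> a \<noteq> ''v'' \<Longrightarrow> nats (glob s) a = nats s a"
  by (simp add: glob_def)

lemma reals_glob [simp]: "reals (glob s) = reals s"
  by (simp add: glob_def)

lemma glob_nupdate_scratch [simp]:
  "glob (nupdate ''t'' i x s) = glob s" "glob (nupdate ''v'' i x s) = glob s"
  by (auto simp: glob_def nupdate_def fun_eq_iff intro!: state.equality)

lemma glob_nupdate: "a \<noteq> ''t'' \<Longrightarrow> a \<noteq> ''v'' \<Longrightarrow> glob (nupdate a i x s) = nupdate a i x (glob s)"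
  by (auto simp: glob_def nupdate_def fun_eq_iff intro!: state.equality)

lemma glob_rupdate: "glob (rupdate a i x s) = rupdate a i x (glob s)"
  by (auto simp: glob_def rupdate_def fun_eq_iff intro!: state.equality)

lemma nats_nupdate [simp]:
  "nats (nupdate a i x s) b = (if b = a then (nats s a)(i := x) else nats s b)"
  by (simp add: nupdate_def)

lemma reals_nupdate [simp]: "reals (nupdate a i x s) = reals s"
  by (simp add: nupdate_def)

lemma nats_rupdate [simp]: "nats (rupdate a i x s) = nats s"
  by (simp add: rupdate_def)

lemma reals_rupdate [simp]:
  "reals (rupdate a i x s) b = (if b = a then (reals s a)(i := x) else reals s b)"
  by (simp add: rupdate_def)

lemma glob_eq_nats: "glob s' = glob s \<Longrightarrow> a \<noteq> ''t'' \<Longrightarrow> a \<noteq> ''v'' \<Longrightarrow> nats s' a = nats s a"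
  using nats_glob by metis

lemma glob_eq_dims: "glob s' = glob s \<Longrightarrow> nrows s' = nrows s \<and> ncols s' = ncols s"
  using glob_eq_nats[of s' s] by simp

lemma glob_eq_reals: "glob s' = glob s \<Longrightarrow> reals s' = reals s"
  using reals_glob by metis

lemma comp_fun_dep: "comp_fun d f \<Longrightarrow> (\<And>x. x < d \<Longrightarrow> \<rho> x = \<rho>' x) \<Longrightarrow> f \<rho> \<sigma> = f \<rho>' \<sigma>"
  unfolding comp_fun_def by blast

lemma comp_cmd_dep: "comp_cmd d f \<Longrightarrow> (\<And>x. x < d \<Longrightarrow> \<rho> x = \<rho>' x) \<Longrightarrow> f \<rho> \<sigma> = f \<rho>' \<sigma>"
  unfolding comp_cmd_def by blast

lemma comp_fun_pushes:
  assumes "comp_fun d f" obtains c B where "pushes c B k f"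
  using assms unfolding comp_fun_def by blast

lemma comp_cmd_transforms:
  assumes "comp_cmd d F" obtains c B where "transforms c B d F"
  using assms unfolding comp_cmd_def by blast

lemma pushes_polybound: "pushes c B k f \<Longrightarrow> polybound B"
  by (simp add: pushes_def)

lemma transforms_polybound: "transforms c B d F \<Longrightarrow> polybound B"
  by (simp add: transforms_def)

lemma runs_pushes:
  assumes "pushes c B k f" and "nrows s = m" and "ncols s = n"
  shows "runs c s (B m n) (\<lambda>s'. glob s' = glob s \<and> loc s' = loc s \<and>
     (\<forall>i<k. nats s' ''t'' i = nats s ''t'' i) \<and> nats s' ''t'' k = f (loc s) (glob s))"
  using assms unfolding pushes_def by blast

lemma runs_transforms:
  assumes "transforms c B d F" and "nrows s = m" and "ncols s = n"
  shows "runs c s (B m n) (\<lambda>s'. glob s' = F (loc s) (glob s) \<and> (\<forall>x<d. loc s' x = loc s x))"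
  using assms unfolding transforms_def by blast

lemma comp_funI:
  assumes "\<And>\<rho> \<rho>' \<sigma>. (\<And>x. x < d \<Longrightarrow> \<rho> x = \<rho>' x) \<Longrightarrow> f \<rho> \<sigma> = f \<rho>' \<sigma>"
    and "\<And>k. \<exists>c B. pushes c B k f"
  shows "comp_fun d f"
  unfolding comp_fun_def using assms by blast

lemma comp_fun_mono: "comp_fun d f \<Longrightarrow> d \<le> d' \<Longrightarrow> comp_fun d' f"
  unfolding comp_fun_def by (meson order_less_le_trans)

lemma comp_fun_simple:
  assumes dep: "\<And>\<rho> \<rho>' \<sigma>. (\<And>x. x < d \<Longrightarrow> \<rho> x = \<rho>' x) \<Longrightarrow> f \<rho> \<sigma> = f \<rho>' \<sigma>"
    and e: "\<And>s. nval e s = f (loc s) (glob s)"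
  shows "comp_fun d f"
proof (rule comp_funI[OF dep])
  fix k
  have "runs (NAssign ''t'' (NConst k) e) s (1 + ncost (NConst k) + ncost e) (\<lambda>s'.
        glob s' = glob s \<and> loc s' = loc s \<and>
        (\<forall>i<k. nats s' ''t'' i = nats s ''t'' i) \<and> nats s' ''t'' k = f (loc s) (glob s))" for s
    by (rule runs_NAssign) (simp add: e)
  then have "pushes (NAssign ''t'' (NConst k) e) (\<lambda>_ _. 1 + ncost (NConst k) + ncost e) k f"
    unfolding pushes_def using polybound_const by blast
  then show "\<exists>c B. pushes c B k f" by blast
qed

section \<open>Arithmetic, comparisons, case distinctions and connectives\<close>

lemma comp_fun_const: "comp_fun d (\<lambda>\<rho> \<sigma>. c)"
  by (rule comp_fun_simple[of _ _ "NConst c"]) auto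

lemma comp_fun_var: "x < d \<Longrightarrow> comp_fun d (\<lambda>\<rho> \<sigma>. \<rho> x)"
  by (rule comp_fun_simple[of _ _ "NRead ''v'' (NConst x)"]) auto

text \<open>Evaluate \<open>f\<close> and \<open>g\<close> on top of each other and combine them with a single conditional, which
  covers arithmetic as well as comparisons.\<close>

lemma comp_fun_binop:
  assumes f: "comp_fun d f" and g: "comp_fun d g"
    and b: "\<And>k s. bval (b k) s \<longleftrightarrow> P (nats s ''t'' k) (nats s ''t'' (Suc k)) (glob s)"
    and bc: "\<And>k. bcost (b k) \<le> K"
    and e: "\<And>k s. nval (e k) s = h (nats s ''t'' k) (nats s ''t'' (Suc k)) (glob s)"
    and ec: "\<And>k. ncost (e k) \<le> K"
    and e': "\<And>k s. nval (e' k) s = h' (nats s ''t'' k) (nats s ''t'' (Suc k)) (glob s)"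
    and ec': "\<And>k. ncost (e' k) \<le> K"
  shows "comp_fun d (\<lambda>\<rho> \<sigma>. if P (f \<rho> \<sigma>) (g \<rho> \<sigma>) \<sigma> then h (f \<rho> \<sigma>) (g \<rho> \<sigma>) \<sigma> else h' (f \<rho> \<sigma>) (g \<rho> \<sigma>) \<sigma>)"
proof (rule comp_funI)
  show "(if P (f \<rho> \<sigma>) (g \<rho> \<sigma>) \<sigma> then h (f \<rho> \<sigma>) (g \<rho> \<sigma>) \<sigma> else h' (f \<rho> \<sigma>) (g \<rho> \<sigma>) \<sigma>) =
     (if P (f \<rho>' \<sigma>) (g \<rho>' \<sigma>) \<sigma> then h (f \<rho>' \<sigma>) (g \<rho>' \<sigma>) \<sigma> else h' (f \<rho>' \<sigma>) (g \<rho>' \<sigma>) \<sigma>)"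
    if "\<And>x. x < d \<Longrightarrow> \<rho> x = \<rho>' x" for \<rho> \<rho>' \<sigma>
    using comp_fun_dep[of d f \<rho> \<rho>', OF f that] comp_fun_dep[of d g \<rho> \<rho>', OF g that] by simp
next
  fix k
  let ?f = "\<lambda>\<rho> \<sigma>. if P (f \<rho> \<sigma>) (g \<rho> \<sigma>) \<sigma> then h (f \<rho> \<sigma>) (g \<rho> \<sigma>) \<sigma> else h' (f \<rho> \<sigma>) (g \<rho> \<sigma>) \<sigma>"
  obtain c1 B1 where c1: "pushes c1 B1 k f" using f by (rule comp_fun_pushes)
  obtain c2 B2 where c2: "pushes c2 B2 (Suc k) g" using g by (rule comp_fun_pushes)
  let ?c = "Cond (b k) (NAssign ''t'' (NConst k) (e k)) (NAssign ''t'' (NConst k) (e' k))"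
  have c3: "runs ?c s (1 + bcost (b k) + ((1 + ncost (NConst k) + ncost (e k)) + (1 + ncost (NConst k) + ncost (e' k)))) (\<lambda>s'.
      s' = nupdate ''t'' k (if P (nats s ''t'' k) (nats s ''t'' (Suc k)) (glob s)
        then h (nats s ''t'' k) (nats s ''t'' (Suc k)) (glob s)
        else h' (nats s ''t'' k) (nats s ''t'' (Suc k)) (glob s)) s)" for s
    by (rule runs_Cond; rule runs_NAssign) (simp_all add: b e e')
  have "runs (Seq c1 (Seq c2 ?c)) s (B1 (nrows s) (ncols s) + (B2 (nrows s) (ncols s) + (3 * K + 5))) (\<lambda>s'.
        glob s' = glob s \<and> loc s' = loc s \<and> (\<forall>i<k. nats s' ''t'' i = nats s ''t'' i) \<and>
        nats s' ''t'' k = ?f (loc s) (glob s))" for s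
  proof (rule runs_Seq[OF runs_pushes[OF c1 refl refl]])
    fix s1 assume s1: "glob s1 = glob s \<and> loc s1 = loc s \<and>
        (\<forall>i<k. nats s1 ''t'' i = nats s ''t'' i) \<and> nats s1 ''t'' k = f (loc s) (glob s)"
    then have dims: "nrows s1 = nrows s" "ncols s1 = ncols s"
      using glob_eq_dims[of s1 s] by simp_all
    show "runs (Seq c2 ?c) s1 (B2 (nrows s) (ncols s) + (3 * K + 5)) (\<lambda>s'.
        glob s' = glob s \<and> loc s' = loc s \<and> (\<forall>i<k. nats s' ''t'' i = nats s ''t'' i) \<and>
        nats s' ''t'' k = ?f (loc s) (glob s))"
    proof (rule runs_Seq[OF runs_pushes[OF c2 dims]])
      fix s2 assume s2: "glob s2 = glob s1 \<and> loc s2 = loc s1 \<and>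
        (\<forall>i<Suc k. nats s2 ''t'' i = nats s1 ''t'' i) \<and> nats s2 ''t'' (Suc k) = g (loc s1) (glob s1)"
      show "runs ?c s2 (3 * K + 5) (\<lambda>s'.
        glob s' = glob s \<and> loc s' = loc s \<and> (\<forall>i<k. nats s' ''t'' i = nats s ''t'' i) \<and>
        nats s' ''t'' k = ?f (loc s) (glob s))"
      proof (rule runs_conseq[OF c3])
        show "1 + bcost (b k) + ((1 + ncost (NConst k) + ncost (e k)) + (1 + ncost (NConst k) + ncost (e' k)))
          \<le> 3 * K + 5"
          using bc[of k] ec[of k] ec'[of k] by simp
      qed (use s1 s2 in simp)
    qed
  qed
  then have "pushes (Seq c1 (Seq c2 ?c)) (\<lambda>x y. B1 x y + (B2 x y + (3 * K + 5))) k ?f"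
    unfolding pushes_def
    using pushes_polybound[OF c1] pushes_polybound[OF c2] by (intro conjI polybound_intros) auto
  then show "\<exists>c B. pushes c B k ?f" by blast
qed

text \<open>A test that always succeeds turns the conditional into a plain assignment;
  \<open>K + 3\<close> pays for that test.\<close>

lemma comp_fun_binop':
  assumes "comp_fun d f" and "comp_fun d g"
    and "\<And>k s. nval (e k) s = h (nats s ''t'' k) (nats s ''t'' (Suc k)) (glob s)"
    and "\<And>k. ncost (e k) \<le> K"
  shows "comp_fun d (\<lambda>\<rho> \<sigma>. h (f \<rho> \<sigma>) (g \<rho> \<sigma>) \<sigma>)"
proof -
  have "ncost (e k) \<le> K + 3" for k using assms(4)[of k] by simp
  then show ?thesis
    using comp_fun_binop[OF assms(1,2), of "\<lambda>_. NEq (NConst 0) (NConst 0)" "\<lambda>_ _ _. True" "K + 3"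
      e h "\<lambda>_. NConst 0" "\<lambda>_ _ _. 0"] assms(3) by simp
qed

lemma comp_fun_read:
  assumes "a \<noteq> ''t''" and "a \<noteq> ''v''" and f: "comp_fun d f"
  shows "comp_fun d (\<lambda>\<rho> \<sigma>. nats \<sigma> a (f \<rho> \<sigma>))"
  using comp_fun_binop'[OF f f, of "\<lambda>k. NRead a (NRead ''t'' (NConst k))" "\<lambda>x y \<sigma>. nats \<sigma> a x" 3]
    assms(1,2) by (simp add: nats_glob)

lemma comp_fun_plus:
  assumes "comp_fun d f" and "comp_fun d g"
  shows "comp_fun d (\<lambda>\<rho> \<sigma>. f \<rho> \<sigma> + g \<rho> \<sigma>)"
  using comp_fun_binop'[OF assms,
      of "\<lambda>k. NAdd (NRead ''t'' (NConst k)) (NRead ''t'' (NConst (Suc k)))" "\<lambda>x y \<sigma>. x + y" 5]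
  by simp

lemma comp_pred_binop:
  assumes "comp_fun d f" and "comp_fun d g"
    and "\<And>k s. bval (b k) s \<longleftrightarrow> P (nats s ''t'' k) (nats s ''t'' (Suc k)) (glob s)"
    and "\<And>k. bcost (b k) \<le> K"
  shows "comp_pred d (\<lambda>\<rho> \<sigma>. P (f \<rho> \<sigma>) (g \<rho> \<sigma>) \<sigma>)"
proof -
  have "bcost (b k) \<le> K + 1" for k using assms(4)[of k] by simp
  then show ?thesis
    using comp_fun_binop[OF assms(1,2), of b P "K + 1" "\<lambda>_. NConst 1" "\<lambda>_ _ _. 1"
      "\<lambda>_. NConst 0" "\<lambda>_ _ _. 0"] assms(3) by (simp add: comp_pred_def of_bool_def)
qed

lemma comp_pred_less:
  assumes "comp_fun d f" and "comp_fun d g"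
  shows "comp_pred d (\<lambda>\<rho> \<sigma>. f \<rho> \<sigma> < g \<rho> \<sigma>)"
  using comp_pred_binop[OF assms,
      of "\<lambda>k. NLess (NRead ''t'' (NConst k)) (NRead ''t'' (NConst (Suc k)))" "\<lambda>x y \<sigma>. x < y" 5]
  by simp

lemma comp_pred_eq:
  assumes "comp_fun d f" and "comp_fun d g"
  shows "comp_pred d (\<lambda>\<rho> \<sigma>. f \<rho> \<sigma> = g \<rho> \<sigma>)"
  using comp_pred_binop[OF assms,
      of "\<lambda>k. NEq (NRead ''t'' (NConst k)) (NRead ''t'' (NConst (Suc k)))" "\<lambda>x y \<sigma>. x = y" 5]
  by simp

lemma comp_pred_real_eq:
  assumes "comp_fun d f" and "comp_fun d g"
  shows "comp_pred d (\<lambda>\<rho> \<sigma>. reals \<sigma> a (f \<rho> \<sigma>) = reals \<sigma> b (g \<rho> \<sigma>))"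
  using comp_pred_binop[OF assms,
      of "\<lambda>k. REq (RRead a (NRead ''t'' (NConst k))) (RRead b (NRead ''t'' (NConst (Suc k))))"
        "\<lambda>x y \<sigma>. reals \<sigma> a x = reals \<sigma> b y" 7]
  by simp

text \<open>\<open>comp_fun_binop\<close> combines two operands, but a case distinction has three.
  It is therefore written as a sum of two terms, of which the one with the wrong truth value of
  \<open>P\<close> is 0.\<close>

lemma comp_fun_if:
  assumes "comp_pred d P" and "comp_fun d f" and "comp_fun d g"
  shows "comp_fun d (\<lambda>\<rho> \<sigma>. if P \<rho> \<sigma> then f \<rho> \<sigma> else g \<rho> \<sigma>)"
proof -
  let ?t = "\<lambda>k. NRead ''t'' (NConst k)"
  have P: "comp_fun d (\<lambda>\<rho> \<sigma>. of_bool (P \<rho> \<sigma>))" using assms(1) by (simp add: comp_pred_def)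
  have *: "comp_fun d (\<lambda>\<rho> \<sigma>. if of_bool (P \<rho> \<sigma>) = (1 :: nat) then h \<rho> \<sigma> else 0)"
    if h: "comp_fun d h" for h
    using comp_fun_binop[OF P h, of "\<lambda>k. NEq (?t k) (NConst 1)" "\<lambda>x y \<sigma>. x = 1" 5
        "\<lambda>k. ?t (Suc k)" "\<lambda>x y \<sigma>. y" "\<lambda>_. NConst 0" "\<lambda>_ _ _. 0"] by simp
  have "comp_fun d (\<lambda>\<rho> \<sigma>. if of_bool (P \<rho> \<sigma>) = (0 :: nat) then h \<rho> \<sigma> else 0)"
    if h: "comp_fun d h" for h
    using comp_fun_binop[OF P h, of "\<lambda>k. NEq (?t k) (NConst 0)" "\<lambda>x y \<sigma>. x = 0" 5
        "\<lambda>k. ?t (Suc k)" "\<lambda>x y \<sigma>. y" "\<lambda>_. NConst 0" "\<lambda>_ _ _. 0"] by simp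
  from comp_fun_plus[OF *[OF assms(2)] this[OF assms(3)]] show ?thesis
    by (rule back_subst[of "comp_fun d"]) (auto simp: fun_eq_iff)
qed

lemma comp_pred_if:
  assumes "comp_pred d P" and "comp_pred d Q" and "comp_pred d R"
  shows "comp_pred d (\<lambda>\<rho> \<sigma>. if P \<rho> \<sigma> then Q \<rho> \<sigma> else R \<rho> \<sigma>)"
proof -
  have "comp_fun d (\<lambda>\<rho> \<sigma>. if P \<rho> \<sigma> then of_bool (Q \<rho> \<sigma>) else of_bool (R \<rho> \<sigma>))"
    using assms(2,3) by (intro comp_fun_if[OF assms(1)]) (simp_all add: comp_pred_def)
  then show ?thesis unfolding comp_pred_def
    by (rule back_subst[of "comp_fun d"]) (auto simp: fun_eq_iff)
qed

lemma comp_pred_const: "comp_pred d (\<lambda>\<rho> \<sigma>. b)"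
  by (simp add: comp_pred_def comp_fun_const)

lemma comp_pred_not:
  assumes "comp_pred d P"
  shows "comp_pred d (\<lambda>\<rho> \<sigma>. \<not> P \<rho> \<sigma>)"
  using comp_pred_if[OF assms comp_pred_const[of d False] comp_pred_const[of d True]]
  by (rule back_subst[of "comp_pred d"]) (auto simp: fun_eq_iff)

lemma comp_pred_conj:
  assumes "comp_pred d P" and "comp_pred d Q"
  shows "comp_pred d (\<lambda>\<rho> \<sigma>. P \<rho> \<sigma> \<and> Q \<rho> \<sigma>)"
  using comp_pred_if[OF assms comp_pred_const[of d False]]
  by (rule back_subst[of "comp_pred d"]) (auto simp: fun_eq_iff)

lemma comp_pred_disj:
  assumes "comp_pred d P" and "comp_pred d Q"
  shows "comp_pred d (\<lambda>\<rho> \<sigma>. P \<rho> \<sigma> \<or> Q \<rho> \<sigma>)"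
  using comp_pred_if[OF assms(1) comp_pred_const[of d True] assms(2)]
  by (rule back_subst[of "comp_pred d"]) (auto simp: fun_eq_iff)

lemma comp_pred_imp:
  assumes "comp_pred d P" and "comp_pred d Q"
  shows "comp_pred d (\<lambda>\<rho> \<sigma>. P \<rho> \<sigma> \<longrightarrow> Q \<rho> \<sigma>)"
  using comp_pred_if[OF assms comp_pred_const[of d True]]
  by (rule back_subst[of "comp_pred d"]) (auto simp: fun_eq_iff)

lemma comp_pred_iff:
  assumes "comp_pred d P" and "comp_pred d Q"
  shows "comp_pred d (\<lambda>\<rho> \<sigma>. P \<rho> \<sigma> = Q \<rho> \<sigma>)"
  using comp_pred_if[OF assms comp_pred_not[OF assms(2)]]
  by (rule back_subst[of "comp_pred d"]) (auto simp: fun_eq_iff)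

section \<open>Loops bounded by a dimension: sums, quantifiers and cardinalities\<close>

definition dim_name :: "string \<Rightarrow> bool" where
  "dim_name b \<longleftrightarrow> b = ''m'' \<or> b = ''n''"

text \<open>The reason for letting loops run only up to \<open>m\<close> or \<open>n\<close>: the
  number of rounds is then itself a polynomial bound.\<close>

lemma polybound_dim:
  assumes "dim_name b" obtains D where "polybound D" and "\<And>s. nats s b 0 = D (nrows s) (ncols s)"
  using assms that[OF polybound_fst] that[OF polybound_snd] unfolding dim_name_def by blast

abbreviation for_loop :: "nat \<Rightarrow> string \<Rightarrow> com \<Rightarrow> com" where
  "for_loop d b c \<equiv> Seq (NAssign ''v'' (NConst d) (NConst 0))
     (While (NLess (NRead ''v'' (NConst d)) (NRead b (NConst 0)))
       (Seq c (NAssign ''v'' (NConst d) (NAdd (NRead ''v'' (NConst d)) (NConst 1)))))"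

text \<open>A round costs 6 for the guard, \<open>B\<close> for the body and 6 for the increment; 9
  is the initialization plus the final failing guard. The invariant is required after the increment,
  so it may speak about the whole array of loop variables.\<close>

lemma runs_for_loop:
  assumes step: "\<And>k s. k < K \<Longrightarrow> I k s \<Longrightarrow> loc s d = k \<Longrightarrow> nats s b 0 = K \<Longrightarrow>
      runs c s B (\<lambda>s'. loc s' d = k \<and> nats s' b 0 = K \<and> I (Suc k) (nupdate ''v'' d (Suc k) s'))"
    and "I 0 (nupdate ''v'' d 0 s)" and "nats s b 0 = K" and "b \<noteq> ''v''"
  shows "runs (for_loop d b c) s (K * (B + 12) + 9) (\<lambda>s'. I K s')"
proof -
  let ?I = "\<lambda>k s. I k s \<and> loc s d = k \<and> nats s b 0 = K"
  let ?w = "While (NLess (NRead ''v'' (NConst d)) (NRead b (NConst 0)))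
       (Seq c (NAssign ''v'' (NConst d) (NAdd (NRead ''v'' (NConst d)) (NConst 1))))"
  let ?b = "NLess (NRead ''v'' (NConst d)) (NRead b (NConst 0))"
  let ?inc = "NAssign ''v'' (NConst d) (NAdd (NRead ''v'' (NConst d)) (NConst 1))"
  have inc: "runs ?inc s' 6 (?I (Suc k))"
    if "loc s' d = k \<and> nats s' b 0 = K \<and> I (Suc k) (nupdate ''v'' d (Suc k) s')" for s' k
    by (rule runs_conseq[OF runs_NAssign[where Q = "\<lambda>s. I (Suc k) s \<and> loc s d = Suc k \<and> nats s b 0 = K"]])
      (use that assms(4) in simp_all)
  have body: "runs (Seq c ?inc) s' (B + 6) (?I (Suc k))" if "k < K" "?I k s'" for k s'
    by (rule runs_Seq[OF step inc]) (use that in simp_all)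
  have w: "runs ?w s' ((K - 0) * (1 + bcost ?b + (B + 6)) + (1 + bcost ?b)) (?I K)" if "?I 0 s'" for s'
    by (rule runs_While_count[where I = ?I, OF body]) (use that in auto)
  have init: "runs (NAssign ''v'' (NConst d) (NConst 0)) s 3 (?I 0)"
    by (rule runs_conseq[OF runs_NAssign[where Q = "?I 0"]]) (use assms(2-4) in simp_all)
  show ?thesis
    by (rule runs_conseq[OF runs_Seq[OF init w]]) (auto simp: algebra_simps)
qed

text \<open>Stack cell \<open>k\<close> saves the old content of loop variable \<open>d\<close>,
  since \<open>pushes\<close> must leave all loop variables intact. Cell \<open>Suc k\<close>
  accumulates the sum and each summand is computed at \<open>Suc (Suc k)\<close>; at the end the
  variable is restored and the sum moved to \<open>k\<close>.\<close>

lemma comp_fun_sum: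
  assumes b: "dim_name b" and f: "comp_fun (Suc d) (\<lambda>\<rho> \<sigma>. f (\<rho> d) \<rho> \<sigma>)"
    and upd: "\<And>j y \<rho> \<sigma>. f j (\<rho>(d := y)) \<sigma> = f j \<rho> \<sigma>"
  shows "comp_fun d (\<lambda>\<rho> \<sigma>. \<Sum>j<nats \<sigma> b 0. f j \<rho> \<sigma>)"
proof -
  have dep: "f j \<rho> \<sigma> = f j \<rho>' \<sigma>" if "\<And>x. x < d \<Longrightarrow> \<rho> x = \<rho>' x" for j \<rho> \<rho>' \<sigma>
  proof -
    have "(\<rho>(d := j)) x = (\<rho>'(d := j)) x" if "x < Suc d" for x
      using that \<open>\<And>x. x < d \<Longrightarrow> \<rho> x = \<rho>' x\<close> by simp
    from comp_fun_dep[of "Suc d" _ "\<rho>(d := j)" "\<rho>'(d := j)", OF f this] show ?thesis by (simp add: upd)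
  qed
  show ?thesis
  proof (rule comp_funI)
  show "(\<Sum>j<nats \<sigma> b 0. f j \<rho> \<sigma>) = (\<Sum>j<nats \<sigma> b 0. f j \<rho>' \<sigma>)"
    if "\<And>x. x < d \<Longrightarrow> \<rho> x = \<rho>' x" for \<rho> \<rho>' \<sigma>
    using dep[of \<rho> \<rho>', OF that] by simp
next
  fix k
  let ?t = "\<lambda>i. NRead ''t'' (NConst i)"
  let ?f = "\<lambda>\<rho> \<sigma>. \<Sum>j<nats \<sigma> b 0. f j \<rho> \<sigma>"
  have bn: "b \<noteq> ''t''" "b \<noteq> ''v''" using b by (auto simp: dim_name_def)
  obtain c B where c: "pushes c B (Suc (Suc k)) (\<lambda>\<rho> \<sigma>. f (\<rho> d) \<rho> \<sigma>)"
    using f by (rule comp_fun_pushes)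
  obtain D where D: "polybound D" "\<And>s. nats s b 0 = D (nrows s) (ncols s)"
    using b by (rule polybound_dim) (rule that)
  let ?body = "Seq c (NAssign ''t'' (NConst (Suc k)) (NAdd (?t (Suc k)) (?t (Suc (Suc k)))))"
  let ?post = "Seq (NAssign ''v'' (NConst d) (?t k)) (NAssign ''t'' (NConst k) (?t (Suc k)))"
  let ?c = "Seq (NAssign ''t'' (NConst k) (NRead ''v'' (NConst d)))
    (Seq (NAssign ''t'' (NConst (Suc k)) (NConst 0)) (Seq (for_loop d b ?body) ?post))"
  have "runs ?c s (4 + (3 + (D (nrows s) (ncols s) * ((B (nrows s) (ncols s) + 7) + 12) + 9 + 8))) (\<lambda>s'.
        glob s' = glob s \<and> loc s' = loc s \<and> (\<forall>i<k. nats s' ''t'' i = nats s ''t'' i) \<and>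
        nats s' ''t'' k = ?f (loc s) (glob s))" for s
  proof -
    define I where "I j s' \<longleftrightarrow> glob s' = glob s \<and> loc s' = (loc s)(d := j) \<and>
        (\<forall>i<k. nats s' ''t'' i = nats s ''t'' i) \<and> nats s' ''t'' k = loc s d \<and>
        nats s' ''t'' (Suc k) = (\<Sum>j<j. f j (loc s) (glob s))" for j s'
    let ?K = "D (nrows s) (ncols s)"
    have K: "nats s b 0 = ?K" by (rule D(2))
    have loop: "runs (for_loop d b ?body) s1 (?K * ((B (nrows s) (ncols s) + 7) + 12) + 9) (I ?K)"
      if I0: "I 0 (nupdate ''v'' d 0 s1)" and K1: "nats s1 b 0 = ?K" for s1
    proof (rule runs_for_loop[where I = I, OF _ I0 K1 bn(2)])
      fix j s2 assume j: "j < ?K" and I: "I j s2"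
      have dims: "nrows s2 = nrows s" "ncols s2 = ncols s"
        using I glob_eq_dims[of s2 s] by (simp_all add: I_def)
      show "runs ?body s2 (B (nrows s) (ncols s) + 7)
        (\<lambda>s'. loc s' d = j \<and> nats s' b 0 = ?K \<and> I (Suc j) (nupdate ''v'' d (Suc j) s'))"
      proof (rule runs_Seq[OF runs_pushes[OF c dims]])
        fix s3
        assume s3: "glob s3 = glob s2 \<and> loc s3 = loc s2 \<and>
          (\<forall>i<Suc (Suc k). nats s3 ''t'' i = nats s2 ''t'' i) \<and>
          nats s3 ''t'' (Suc (Suc k)) = f (loc s2 d) (loc s2) (glob s2)"
        have "f (loc s2 d) (loc s2) (glob s2) = f j (loc s) (glob s)"
          using I upd unfolding I_def by simp
        then have val: "nats s3 ''t'' (Suc (Suc k)) = f j (loc s) (glob s)" using s3 by simp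
        have g: "glob s3 = glob s" and nb: "nats s3 b 0 = ?K"
          using s3 I bn K glob_eq_nats[of s3 s b] unfolding I_def by auto
        show "runs (NAssign ''t'' (NConst (Suc k)) (NAdd (?t (Suc k)) (?t (Suc (Suc k))))) s3 7
          (\<lambda>s'. loc s' d = j \<and> nats s' b 0 = ?K \<and> I (Suc j) (nupdate ''v'' d (Suc j) s'))"
          by (rule runs_conseq[OF runs_NAssign[where Q = "\<lambda>s'. loc s' d = j \<and> nats s' b 0 = ?K \<and> I (Suc j) (nupdate ''v'' d (Suc j) s')"]])
            (use s3 val g nb bn I in \<open>auto simp: I_def\<close>)
      qed
    qed
    have post: "runs ?post s1 8 (\<lambda>s'.
        glob s' = glob s \<and> loc s' = loc s \<and> (\<forall>i<k. nats s' ''t'' i = nats s ''t'' i) \<and>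
        nats s' ''t'' k = ?f (loc s) (glob s))" if I: "I ?K s1" for s1
    proof -
      let ?s2 = "nupdate ''v'' d (nats s1 ''t'' k) s1"
      have "runs ?post s1 (4 + 4) (\<lambda>s'. s' = nupdate ''t'' k (nats s1 ''t'' (Suc k)) ?s2)"
      proof (rule runs_Seq)
        show "runs (NAssign ''v'' (NConst d) (?t k)) s1 4 (\<lambda>s'. s' = ?s2)"
          by (rule runs_conseq[OF runs_NAssign[where Q = "\<lambda>s'. s' = ?s2"]]) auto
        show "runs (NAssign ''t'' (NConst k) (?t (Suc k))) s' 4
          (\<lambda>s'. s' = nupdate ''t'' k (nats s1 ''t'' (Suc k)) ?s2)" if "s' = ?s2" for s'
          by (rule runs_conseq[OF runs_NAssign[where Q = "\<lambda>s'. s' = nupdate ''t'' k (nats s1 ''t'' (Suc k)) ?s2"]])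
            (auto simp: that)
      qed
      then show ?thesis
        by (rule runs_conseq) (use I K bn in \<open>auto simp: I_def nats_glob\<close>)
    qed
    show ?thesis
    proof (rule runs_Seq)
      show "runs (NAssign ''t'' (NConst k) (NRead ''v'' (NConst d))) s 4
        (\<lambda>s'. s' = nupdate ''t'' k (loc s d) s)"
        by (rule runs_conseq[OF runs_NAssign[where Q = "\<lambda>s'. s' = nupdate ''t'' k (loc s d) s"]]) auto
      fix s1 assume s1: "s1 = nupdate ''t'' k (loc s d) s"
      show "runs (Seq (NAssign ''t'' (NConst (Suc k)) (NConst 0)) (Seq (for_loop d b ?body) ?post)) s1
        (3 + (?K * ((B (nrows s) (ncols s) + 7) + 12) + 9 + 8)) (\<lambda>s'.
        glob s' = glob s \<and> loc s' = loc s \<and> (\<forall>i<k. nats s' ''t'' i = nats s ''t'' i) \<and>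
        nats s' ''t'' k = ?f (loc s) (glob s))"
      proof (rule runs_Seq)
        show "runs (NAssign ''t'' (NConst (Suc k)) (NConst 0)) s1 3 (\<lambda>s'. s' = nupdate ''t'' (Suc k) 0 s1)"
          by (rule runs_conseq[OF runs_NAssign[where Q = "\<lambda>s'. s' = nupdate ''t'' (Suc k) 0 s1"]]) auto
        fix s2 assume s2: "s2 = nupdate ''t'' (Suc k) 0 s1"
        show "runs (Seq (for_loop d b ?body) ?post) s2
          (?K * ((B (nrows s) (ncols s) + 7) + 12) + 9 + 8) (\<lambda>s'.
          glob s' = glob s \<and> loc s' = loc s \<and> (\<forall>i<k. nats s' ''t'' i = nats s ''t'' i) \<and>
          nats s' ''t'' k = ?f (loc s) (glob s))"
        proof (rule runs_Seq[OF loop post])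
          show "I 0 (nupdate ''v'' d 0 s2)" by (auto simp: s1 s2 I_def)
          show "nats s2 b 0 = ?K" using K bn by (simp add: s1 s2)
        qed
      qed
    qed
  qed
  then have "pushes ?c (\<lambda>x y. 4 + (3 + (D x y * ((B x y + 7) + 12) + 9 + 8))) k ?f"
    unfolding pushes_def
    using pushes_polybound[OF c] D(1) by (intro conjI polybound_intros) auto
  then show "\<exists>c B. pushes c B k ?f" by blast
qed
qed

lemma comp_fun_upd:
  assumes "comp_fun d f" and "d \<le> x" shows "f (\<rho>(x := y)) \<sigma> = f \<rho> \<sigma>"
  by (rule comp_fun_dep[OF assms(1)]) (use assms(2) in auto)

text \<open>The quantifier is decided by counting counterexamples and comparing with 0.\<close>

lemma comp_pred_all:
  assumes b: "dim_name b" and f: "comp_pred (Suc d) (\<lambda>\<rho> \<sigma>. P (\<rho> d) \<rho> \<sigma>)"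
    and "\<And>j y \<rho> \<sigma>. P j (\<rho>(d := y)) \<sigma> = P j \<rho> \<sigma>"
  shows "comp_pred d (\<lambda>\<rho> \<sigma>. \<forall>j<nats \<sigma> b 0. P j \<rho> \<sigma>)"
proof -
  have "comp_fun d (\<lambda>\<rho> \<sigma>. \<Sum>j<nats \<sigma> b 0. of_bool (\<not> P j \<rho> \<sigma>))"
    using comp_pred_not[OF f] assms(3) by (intro comp_fun_sum[OF b]) (simp_all add: comp_pred_def)
  from comp_pred_eq[OF this comp_fun_const[of d 0]] show ?thesis
    by (rule back_subst[of "comp_pred d"]) (auto simp: fun_eq_iff)
qed

lemma comp_pred_ex:
  assumes b: "dim_name b" and f: "comp_pred (Suc d) (\<lambda>\<rho> \<sigma>. P (\<rho> d) \<rho> \<sigma>)"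
    and "\<And>j y \<rho> \<sigma>. P j (\<rho>(d := y)) \<sigma> = P j \<rho> \<sigma>"
  shows "comp_pred d (\<lambda>\<rho> \<sigma>. \<exists>j<nats \<sigma> b 0. P j \<rho> \<sigma>)"
  using comp_pred_not[OF comp_pred_all[of b d "\<lambda>j \<rho> \<sigma>. \<not> P j \<rho> \<sigma>", OF b comp_pred_not[OF f]]] assms(3)
  by simp

lemma comp_fun_card:
  assumes b: "dim_name b" and f: "comp_pred (Suc d) (\<lambda>\<rho> \<sigma>. P (\<rho> d) \<rho> \<sigma>)"
    and "\<And>j y \<rho> \<sigma>. P j (\<rho>(d := y)) \<sigma> = P j \<rho> \<sigma>"
  shows "comp_fun d (\<lambda>\<rho> \<sigma>. card {j. j < nats \<sigma> b 0 \<and> P j \<rho> \<sigma>})"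
proof -
  have "comp_fun d (\<lambda>\<rho> \<sigma>. \<Sum>j<nats \<sigma> b 0. of_bool (P j \<rho> \<sigma>))"
    using f assms(3) by (intro comp_fun_sum[OF b]) (simp_all add: comp_pred_def)
  then show ?thesis
    by (rule back_subst[of "comp_fun d"]) (auto simp: fun_eq_iff Int_def lessThan_def)
qed

subsection \<open>Computable state transformers\<close>

lemma comp_cmdI:
  assumes "\<And>\<rho> \<rho>' \<sigma>. (\<And>x. x < d \<Longrightarrow> \<rho> x = \<rho>' x) \<Longrightarrow> F \<rho> \<sigma> = F \<rho>' \<sigma>"
    and "\<And>\<rho> \<sigma>. nrows (F \<rho> \<sigma>) = nrows \<sigma>" and "\<And>\<rho> \<sigma>. ncols (F \<rho> \<sigma>) = ncols \<sigma>"
    and "polybound B"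
    and "\<And>s. runs c s (B (nrows s) (ncols s)) (\<lambda>s'. glob s' = F (loc s) (glob s) \<and> (\<forall>x<d. loc s' x = loc s x))"
  shows "comp_cmd d F"
  unfolding comp_cmd_def transforms_def using assms by blast

lemma comp_cmd_dims:
  "comp_cmd d F \<Longrightarrow> nrows (F \<rho> \<sigma>) = nrows \<sigma>" "comp_cmd d F \<Longrightarrow> ncols (F \<rho> \<sigma>) = ncols \<sigma>"
  by (simp_all add: comp_cmd_def)

lemma nats_glob_dims: "nrows (glob s) = nrows s" "ncols (glob s) = ncols s"
  by (simp_all add: nats_glob)

lemma runs_eval2:
  assumes f: "comp_fun d f" and g: "comp_fun d g"
  obtains c B where "polybound B" and "\<And>s. runs c s (B (nrows s) (ncols s)) (\<lambda>s'. glob s' = glob s \<and>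
    loc s' = loc s \<and> nats s' ''t'' 0 = f (loc s) (glob s) \<and> nats s' ''t'' 1 = g (loc s) (glob s))"
proof -
  obtain c1 B1 where c1: "pushes c1 B1 0 f" using f by (rule comp_fun_pushes)
  obtain c2 B2 where c2: "pushes c2 B2 1 g" using g by (rule comp_fun_pushes)
  have "runs (Seq c1 c2) s (B1 (nrows s) (ncols s) + B2 (nrows s) (ncols s)) (\<lambda>s'. glob s' = glob s \<and>
    loc s' = loc s \<and> nats s' ''t'' 0 = f (loc s) (glob s) \<and> nats s' ''t'' 1 = g (loc s) (glob s))" for s
  proof (rule runs_Seq[OF runs_pushes[OF c1 refl refl]])
    fix s1 assume s1: "glob s1 = glob s \<and> loc s1 = loc s \<and>
        (\<forall>i<0. nats s1 ''t'' i = nats s ''t'' i) \<and> nats s1 ''t'' 0 = f (loc s) (glob s)"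
    then have dims: "nrows s1 = nrows s" "ncols s1 = ncols s"
      using glob_eq_dims[of s1 s] by simp_all
    show "runs c2 s1 (B2 (nrows s) (ncols s)) (\<lambda>s'. glob s' = glob s \<and>
      loc s' = loc s \<and> nats s' ''t'' 0 = f (loc s) (glob s) \<and> nats s' ''t'' 1 = g (loc s) (glob s))"
      by (rule runs_conseq[OF runs_pushes[OF c2 dims]]) (use s1 in simp_all)
  qed
  with that[of "\<lambda>x y. B1 x y + B2 x y" "Seq c1 c2"]
    polybound_add[OF pushes_polybound[OF c1] pushes_polybound[OF c2]] show thesis by blast
qed

lemma comp_cmd_assign:
  assumes a: "a \<noteq> ''t''" "a \<noteq> ''v''" "a \<noteq> ''m''" "a \<noteq> ''n''"
    and f: "comp_fun d f" and g: "comp_fun d g"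
  shows "comp_cmd d (\<lambda>\<rho> \<sigma>. nupdate a (f \<rho> \<sigma>) (g \<rho> \<sigma>) \<sigma>)"
proof -
  obtain c B where B: "polybound B" and c: "\<And>s. runs c s (B (nrows s) (ncols s)) (\<lambda>s'. glob s' = glob s \<and>
    loc s' = loc s \<and> nats s' ''t'' 0 = f (loc s) (glob s) \<and> nats s' ''t'' 1 = g (loc s) (glob s))"
    by (rule runs_eval2[OF f g]) (rule that)
  let ?F = "\<lambda>\<rho> \<sigma>. nupdate a (f \<rho> \<sigma>) (g \<rho> \<sigma>) \<sigma>"
  let ?a = "NAssign a (NRead ''t'' (NConst 0)) (NRead ''t'' (NConst 1))"
  have "runs (Seq c ?a) s (B (nrows s) (ncols s) + 5) (\<lambda>s'. glob s' = ?F (loc s) (glob s) \<and> (\<forall>x<d. loc s' x = loc s x))" for s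
  proof (rule runs_Seq[OF c])
    fix s1 assume s1: "glob s1 = glob s \<and>
      loc s1 = loc s \<and> nats s1 ''t'' 0 = f (loc s) (glob s) \<and> nats s1 ''t'' 1 = g (loc s) (glob s)"
    show "runs ?a s1 5 (\<lambda>s'. glob s' = ?F (loc s) (glob s) \<and> (\<forall>x<d. loc s' x = loc s x))"
      by (rule runs_conseq[OF runs_NAssign[where Q = "\<lambda>s'. glob s' = ?F (loc s) (glob s) \<and> (\<forall>x<d. loc s' x = loc s x)"]])
        (use s1 a in \<open>simp_all add: glob_nupdate\<close>)
  qed
  then have exec: "runs (Seq c ?a) s ((\<lambda>x y. B x y + 5) (nrows s) (ncols s))
    (\<lambda>s'. glob s' = ?F (loc s) (glob s) \<and> (\<forall>x<d. loc s' x = loc s x))" for s by simp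
  show ?thesis
  proof (rule comp_cmdI[where B = "\<lambda>x y. B x y + 5" and F = "?F", OF _ _ _ _ exec])
    fix \<rho> \<rho>' :: "nat \<Rightarrow> nat" and \<sigma> :: state
    assume that: "\<And>x. x < d \<Longrightarrow> \<rho> x = \<rho>' x"
    show "?F \<rho> \<sigma> = ?F \<rho>' \<sigma>"
      using comp_fun_dep[of d f \<rho> \<rho>', OF f that] comp_fun_dep[of d g \<rho> \<rho>', OF g that] by simp
  qed (use a polybound_add[OF B polybound_const] in simp_all)
qed

lemma comp_cmd_copy:
  assumes f: "comp_fun d f" and g: "comp_fun d g"
  shows "comp_cmd d (\<lambda>\<rho> \<sigma>. rupdate a (f \<rho> \<sigma>) (reals \<sigma> b (g \<rho> \<sigma>)) \<sigma>)"
proof -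
  obtain c B where B: "polybound B" and c: "\<And>s. runs c s (B (nrows s) (ncols s)) (\<lambda>s'. glob s' = glob s \<and>
    loc s' = loc s \<and> nats s' ''t'' 0 = f (loc s) (glob s) \<and> nats s' ''t'' 1 = g (loc s) (glob s))"
    by (rule runs_eval2[OF f g]) (rule that)
  let ?F = "\<lambda>\<rho> \<sigma>. rupdate a (f \<rho> \<sigma>) (reals \<sigma> b (g \<rho> \<sigma>)) \<sigma>"
  let ?a = "RAssign a (NRead ''t'' (NConst 0)) (RRead b (NRead ''t'' (NConst 1)))"
  have "runs (Seq c ?a) s (B (nrows s) (ncols s) + 6) (\<lambda>s'. glob s' = ?F (loc s) (glob s) \<and> (\<forall>x<d. loc s' x = loc s x))" for s
  proof (rule runs_Seq[OF c])
    fix s1 assume s1: "glob s1 = glob s \<and>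
      loc s1 = loc s \<and> nats s1 ''t'' 0 = f (loc s) (glob s) \<and> nats s1 ''t'' 1 = g (loc s) (glob s)"
    have r: "reals s1 = reals s" using s1 glob_eq_reals by blast
    show "runs ?a s1 6 (\<lambda>s'. glob s' = ?F (loc s) (glob s) \<and> (\<forall>x<d. loc s' x = loc s x))"
      by (rule runs_conseq[OF runs_RAssign[where Q = "\<lambda>s'. glob s' = ?F (loc s) (glob s) \<and> (\<forall>x<d. loc s' x = loc s x)"]])
        (use s1 r in \<open>simp_all add: glob_rupdate\<close>)
  qed
  then have exec: "runs (Seq c ?a) s ((\<lambda>x y. B x y + 6) (nrows s) (ncols s))
    (\<lambda>s'. glob s' = ?F (loc s) (glob s) \<and> (\<forall>x<d. loc s' x = loc s x))" for s by simp
  show ?thesis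
  proof (rule comp_cmdI[where B = "\<lambda>x y. B x y + 6" and F = "?F", OF _ _ _ _ exec])
    fix \<rho> \<rho>' :: "nat \<Rightarrow> nat" and \<sigma> :: state
    assume that: "\<And>x. x < d \<Longrightarrow> \<rho> x = \<rho>' x"
    show "?F \<rho> \<sigma> = ?F \<rho>' \<sigma>"
      using comp_fun_dep[of d f \<rho> \<rho>', OF f that] comp_fun_dep[of d g \<rho> \<rho>', OF g that] by simp
  qed (use polybound_add[OF B polybound_const] in simp_all)
qed

lemma comp_cmd_seq:
  assumes F: "comp_cmd d F" and G: "comp_cmd d G"
  shows "comp_cmd d (\<lambda>\<rho> \<sigma>. G \<rho> (F \<rho> \<sigma>))"
proof -
  obtain c1 B1 where c1: "transforms c1 B1 d F" using F by (rule comp_cmd_transforms)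
  obtain c2 B2 where c2: "transforms c2 B2 d G" using G by (rule comp_cmd_transforms)
  let ?F = "\<lambda>\<rho> \<sigma>. G \<rho> (F \<rho> \<sigma>)"
  have "runs (Seq c1 c2) s (B1 (nrows s) (ncols s) + B2 (nrows s) (ncols s))
    (\<lambda>s'. glob s' = G (loc s) (F (loc s) (glob s)) \<and> (\<forall>x<d. loc s' x = loc s x))" for s
  proof (rule runs_Seq[OF runs_transforms[OF c1 refl refl]])
    fix s1 assume s1: "glob s1 = F (loc s) (glob s) \<and> (\<forall>x<d. loc s1 x = loc s x)"
    have dims: "nrows s1 = nrows s" "ncols s1 = ncols s"
      using s1 comp_cmd_dims[OF F, of "loc s" "glob s"] nats_glob_dims[of s] nats_glob_dims[of s1] by simp_all
    have "G (loc s1) (glob s1) = G (loc s) (glob s1)"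
      by (rule comp_cmd_dep[OF G]) (use s1 in simp)
    then show "runs c2 s1 (B2 (nrows s) (ncols s))
      (\<lambda>s'. glob s' = G (loc s) (F (loc s) (glob s)) \<and> (\<forall>x<d. loc s' x = loc s x))"
      by (intro runs_conseq[OF runs_transforms[OF c2 dims]]) (use s1 in simp_all)
  qed
  then have exec: "runs (Seq c1 c2) s ((\<lambda>x y. B1 x y + B2 x y) (nrows s) (ncols s))
    (\<lambda>s'. glob s' = ?F (loc s) (glob s) \<and> (\<forall>x<d. loc s' x = loc s x))" for s by simp
  show ?thesis
  proof (rule comp_cmdI[where B = "\<lambda>x y. B1 x y + B2 x y" and F = "?F", OF _ _ _ _ exec])
    fix \<rho> \<rho>' :: "nat \<Rightarrow> nat" and \<sigma> :: state
    assume that: "\<And>x. x < d \<Longrightarrow> \<rho> x = \<rho>' x"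
    show "?F \<rho> \<sigma> = ?F \<rho>' \<sigma>"
      using comp_cmd_dep[of d F \<rho> \<rho>' \<sigma>, OF F that] comp_cmd_dep[of d G \<rho> \<rho>', OF G that] by simp
  qed (simp_all add: comp_cmd_dims[OF F] comp_cmd_dims[OF G] polybound_add[OF transforms_polybound[OF c1] transforms_polybound[OF c2]])
qed

lemma comp_cmd_when:
  assumes P: "comp_pred d P" and F: "comp_cmd d F"
  shows "comp_cmd d (\<lambda>\<rho> \<sigma>. if P \<rho> \<sigma> then F \<rho> \<sigma> else \<sigma>)"
proof -
  have P': "comp_fun d (\<lambda>\<rho> \<sigma>. of_bool (P \<rho> \<sigma>))" using P by (simp add: comp_pred_def)
  obtain c1 B1 where c1: "pushes c1 B1 0 (\<lambda>\<rho> \<sigma>. of_bool (P \<rho> \<sigma>))" using P' by (rule comp_fun_pushes)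
  obtain c2 B2 where c2: "transforms c2 B2 d F" using F by (rule comp_cmd_transforms)
  let ?F = "\<lambda>\<rho> \<sigma>. if P \<rho> \<sigma> then F \<rho> \<sigma> else \<sigma>"
  let ?b = "NEq (NRead ''t'' (NConst 0)) (NConst 1)"
  let ?Q = "\<lambda>s s'. glob s' = ?F (loc s) (glob s) \<and> (\<forall>x<d. loc s' x = loc s x)"
  have "runs (Seq c1 (Cond ?b c2 Skip)) s (B1 (nrows s) (ncols s) + (1 + bcost ?b + (B2 (nrows s) (ncols s) + 1)))
    (?Q s)" for s
  proof (rule runs_Seq[OF runs_pushes[OF c1 refl refl]])
    fix s1 assume s1: "glob s1 = glob s \<and> loc s1 = loc s \<and>
        (\<forall>i<0. nats s1 ''t'' i = nats s ''t'' i) \<and> nats s1 ''t'' 0 = of_bool (P (loc s) (glob s))"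
    then have dims: "nrows s1 = nrows s" "ncols s1 = ncols s"
      using glob_eq_dims[of s1 s] by simp_all
    show "runs (Cond ?b c2 Skip) s1 (1 + bcost ?b + (B2 (nrows s) (ncols s) + 1)) (?Q s)"
    proof (rule runs_Cond)
      assume "bval ?b s1"
      then show "runs c2 s1 (B2 (nrows s) (ncols s)) (?Q s)"
        by (intro runs_conseq[OF runs_transforms[OF c2 dims]]) (use s1 in \<open>auto split: if_splits\<close>)
    next
      assume "\<not> bval ?b s1"
      then show "runs Skip s1 1 (?Q s)"
        by (intro runs_Skip) (use s1 in auto)
    qed
  qed
  then have exec: "runs (Seq c1 (Cond ?b c2 Skip)) s ((\<lambda>x y. B1 x y + (1 + bcost ?b + (B2 x y + 1))) (nrows s) (ncols s))
    (?Q s)" for s by simp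
  show ?thesis
  proof (rule comp_cmdI[where B = "\<lambda>x y. B1 x y + (1 + bcost ?b + (B2 x y + 1))" and F = ?F, OF _ _ _ _ exec])
    fix \<rho> \<rho>' :: "nat \<Rightarrow> nat" and \<sigma> :: state
    assume *: "\<And>x. x < d \<Longrightarrow> \<rho> x = \<rho>' x"
    have "P \<rho> \<sigma> = P \<rho>' \<sigma>"
      using comp_fun_dep[of d "\<lambda>\<rho> \<sigma>. of_bool (P \<rho> \<sigma>)" \<rho> \<rho>' \<sigma>, OF P' *] by (simp add: of_bool_eq_iff)
    then show "?F \<rho> \<sigma> = ?F \<rho>' \<sigma>" using comp_cmd_dep[of d F \<rho> \<rho>' \<sigma>, OF F *] by simp
  next
    fix \<rho> \<sigma>
    show "nrows (?F \<rho> \<sigma>) = nrows \<sigma>" "ncols (?F \<rho> \<sigma>) = ncols \<sigma>"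
      by (simp_all add: comp_cmd_dims[OF F])
  next
    show "polybound (\<lambda>x y. B1 x y + (1 + bcost ?b + (B2 x y + 1)))"
      by (intro polybound_add pushes_polybound[OF c1] transforms_polybound[OF c2] polybound_const)
  qed
qed

text \<open>The machine rereads the loop bound before each round, whereas \<open>fold\<close> fixes
  it at the start; the two agree because the body preserves the dimensions.\<close>

lemma comp_cmd_for:
  assumes b: "dim_name b" and F: "comp_cmd (Suc d) (\<lambda>\<rho> \<sigma>. F (\<rho> d) \<rho> \<sigma>)"
    and upd: "\<And>j y \<rho> \<sigma>. F j (\<rho>(d := y)) \<sigma> = F j \<rho> \<sigma>"
  shows "comp_cmd d (\<lambda>\<rho> \<sigma>. fold (\<lambda>j. F j \<rho>) [0..<nats \<sigma> b 0] \<sigma>)"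
proof -
  let ?F = "\<lambda>\<rho> \<sigma>. fold (\<lambda>j. F j \<rho>) [0..<nats \<sigma> b 0] \<sigma>"
  have dep: "F j \<rho> \<sigma> = F j \<rho>' \<sigma>" if "\<And>x. x < d \<Longrightarrow> \<rho> x = \<rho>' x" for j \<rho> \<rho>' \<sigma>
  proof -
    have "(\<rho>(d := j)) x = (\<rho>'(d := j)) x" if "x < Suc d" for x
      using that \<open>\<And>x. x < d \<Longrightarrow> \<rho> x = \<rho>' x\<close> by simp
    from comp_cmd_dep[of "Suc d" _ "\<rho>(d := j)" "\<rho>'(d := j)", OF F this] show ?thesis by (simp add: upd)
  qed
  have fdims: "nrows (F j \<rho> \<sigma>) = nrows \<sigma>" "ncols (F j \<rho> \<sigma>) = ncols \<sigma>" for j \<rho> \<sigma>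
    using comp_cmd_dims[OF F, of "\<rho>(d := j)" \<sigma>] by (simp_all add: upd)
  have folddims: "nrows (fold (\<lambda>j. F j \<rho>) js \<sigma>) = nrows \<sigma> \<and> ncols (fold (\<lambda>j. F j \<rho>) js \<sigma>) = ncols \<sigma>"
    for js \<rho> \<sigma> by (induction js arbitrary: \<sigma>) (simp_all add: fdims)
  obtain c B where c: "transforms c B (Suc d) (\<lambda>\<rho> \<sigma>. F (\<rho> d) \<rho> \<sigma>)" using F by (rule comp_cmd_transforms)
  obtain D where D: "polybound D" "\<And>s. nats s b 0 = D (nrows s) (ncols s)"
    using b by (rule polybound_dim) (rule that)
  have bn: "b \<noteq> ''t''" "b \<noteq> ''v''" using b by (auto simp: dim_name_def)
  have "runs (for_loop d b c) s (D (nrows s) (ncols s) * (B (nrows s) (ncols s) + 12) + 9)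
    (\<lambda>s'. glob s' = ?F (loc s) (glob s) \<and> (\<forall>x<d. loc s' x = loc s x))" for s
  proof -
    let ?K = "D (nrows s) (ncols s)"
    define I where "I j s' \<longleftrightarrow> glob s' = fold (\<lambda>j. F j (loc s)) [0..<j] (glob s) \<and>
      (\<forall>x<d. loc s' x = loc s x)" for j s'
    have "runs (for_loop d b c) s (?K * (B (nrows s) (ncols s) + 12) + 9) (\<lambda>s'. I ?K s')"
    proof (rule runs_for_loop[where I = I])
      show "I 0 (nupdate ''v'' d 0 s)" by (simp add: I_def)
      show "nats s b 0 = ?K" by (rule D(2))
      fix j s1 assume j: "j < ?K" and I: "I j s1" and l: "loc s1 d = j" and nb: "nats s1 b 0 = ?K"
      have dims: "nrows s1 = nrows s" "ncols s1 = ncols s"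
        using I folddims[of "loc s" "[0..<j]" "glob s"] nats_glob_dims[of s] nats_glob_dims[of s1]
        by (simp_all add: I_def)
      show "runs c s1 (B (nrows s) (ncols s))
        (\<lambda>s'. loc s' d = j \<and> nats s' b 0 = ?K \<and> I (Suc j) (nupdate ''v'' d (Suc j) s'))"
      proof (rule runs_conseq[OF runs_transforms[OF c dims]])
        fix s2 assume s2: "glob s2 = F (loc s1 d) (loc s1) (glob s1) \<and> (\<forall>x<Suc d. loc s2 x = loc s1 x)"
        have "F j (loc s1) (glob s1) = F j (loc s) (glob s1)"
          by (rule dep) (use I in \<open>simp add: I_def\<close>)
        then have g: "glob s2 = F j (loc s) (glob s1)" using s2 l by simp
        have "nrows s2 = nrows s" "ncols s2 = ncols s"
          using g fdims[of j "loc s" "glob s1"] nats_glob_dims[of s1] nats_glob_dims[of s2] dims by simp_all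
        then have "nats s2 b 0 = ?K" using D(2)[of s2] by simp
        then show "loc s2 d = j \<and> nats s2 b 0 = ?K \<and> I (Suc j) (nupdate ''v'' d (Suc j) s2)"
          using s2 l g I by (simp add: I_def)
      qed simp
    qed (rule bn(2))
    then show ?thesis
      by (rule runs_conseq) (use D(2)[of s] bn in \<open>auto simp: I_def nats_glob\<close>)
  qed
  then have exec: "runs (for_loop d b c) s ((\<lambda>x y. D x y * (B x y + 12) + 9) (nrows s) (ncols s))
    (\<lambda>s'. glob s' = ?F (loc s) (glob s) \<and> (\<forall>x<d. loc s' x = loc s x))" for s by simp
  show ?thesis
  proof (rule comp_cmdI[where B = "\<lambda>x y. D x y * (B x y + 12) + 9" and F = ?F, OF _ _ _ _ exec])
    fix \<rho> \<rho>' :: "nat \<Rightarrow> nat" and \<sigma> :: state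
    assume "\<And>x. x < d \<Longrightarrow> \<rho> x = \<rho>' x"
    then have "(\<lambda>j. F j \<rho>) = (\<lambda>j. F j \<rho>')" using dep[of \<rho> \<rho>'] by (simp add: fun_eq_iff)
    then show "?F \<rho> \<sigma> = ?F \<rho>' \<sigma>" by simp
  next
    fix \<rho> \<sigma>
    show "nrows (?F \<rho> \<sigma>) = nrows \<sigma>" "ncols (?F \<rho> \<sigma>) = ncols \<sigma>"
      by (simp_all add: folddims)
  next
    show "polybound (\<lambda>x y. D x y * (B x y + 12) + 9)"
      by (intro polybound_intros D(1) transforms_polybound[OF c])
  qed
qed

section \<open>Separable row sets\<close>

definition mix :: "nat set \<Rightarrow> (nat \<Rightarrow> 'a) \<Rightarrow> (nat \<Rightarrow> 'a) \<Rightarrow> nat \<Rightarrow> 'a" where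
  "mix X u v = (\<lambda>i. if i \<in> X then u i else v i)"

text \<open>The corner opposite to \<open>z\<close> in the box spanned by \<open>u\<close> and
  \<open>v\<close>. It is meant for \<open>z\<close> with entries from \<open>u\<close> and
  \<open>v\<close> only, so a single test tells which of them was used.\<close>

definition swap_along :: "(nat \<Rightarrow> 'a) \<Rightarrow> (nat \<Rightarrow> 'a) \<Rightarrow> (nat \<Rightarrow> 'a) \<Rightarrow> nat \<Rightarrow> 'a" where
  "swap_along z u v = (\<lambda>i. if z i = u i then v i else u i)"

definition strictly_between :: "nat \<Rightarrow> (nat \<Rightarrow> 'a) \<Rightarrow> (nat \<Rightarrow> 'a) \<Rightarrow> (nat \<Rightarrow> 'a) \<Rightarrow> bool" where
  "strictly_between m z u v \<longleftrightarrow>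
     (\<forall>i<m. z i = u i \<or> z i = v i) \<and> (\<exists>i<m. z i \<noteq> u i) \<and> (\<exists>i<m. z i \<noteq> v i)"

text \<open>Induction on the number of coordinates in which \<open>u\<close> and \<open>v\<close> differ. A vector \<open>z\<close> strictly
  between them cuts these coordinates into four blocks: inside or outside \<open>X\<close>, and agreeing with
  \<open>u\<close> or with \<open>v\<close>. The vectors \<open>w p q r s\<close> below are constant on these blocks, and four
  applications of the induction hypothesis give the claim after cancelling \<open>f z\<close> twice.\<close>

lemma separable_of_between:
  fixes f :: "(nat \<Rightarrow> 'a) \<Rightarrow> nat"
  assumes cong: "\<And>u v. (\<And>i. i < m \<Longrightarrow> u i = v i) \<Longrightarrow> f u = f v"
    and split: "\<And>u v. 0 < f u \<Longrightarrow> 0 < f v \<Longrightarrow> \<exists>i<m. i \<in> X \<and> u i \<noteq> v i \<Longrightarrow>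
      \<exists>i<m. i \<notin> X \<and> u i \<noteq> v i \<Longrightarrow>
      \<exists>z. strictly_between m z u v \<and> f z * f (swap_along z u v) = f u * f v"
    and "0 < f u" and "0 < f v"
  shows "f u * f v = f (mix X u v) * f (mix X v u)"
  using assms(3,4)
proof (induction "card {i. i < m \<and> u i \<noteq> v i}" arbitrary: u v rule: less_induct)
  case less
  note IH = less.hyps and pos = less.prems
  show ?case
  proof (cases "(\<exists>i<m. i \<in> X \<and> u i \<noteq> v i) \<and> (\<exists>i<m. i \<notin> X \<and> u i \<noteq> v i)")
    case False
    then consider "\<And>i. i < m \<Longrightarrow> i \<in> X \<Longrightarrow> u i = v i" | "\<And>i. i < m \<Longrightarrow> i \<notin> X \<Longrightarrow> u i = v i"
      by blast
    then show ?thesis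
    proof cases
      case 1
      then have "f (mix X u v) = f v" "f (mix X v u) = f u"
        by (auto intro!: cong simp: mix_def)
      then show ?thesis by simp
    next
      case 2
      then have "f (mix X u v) = f u" "f (mix X v u) = f v"
        by (auto intro!: cong simp: mix_def)
      then show ?thesis by simp
    qed
  next
    case True
    then obtain z where z: "strictly_between m z u v" and fz: "f z * f (swap_along z u v) = f u * f v"
      using split[OF pos] by blast
    have zuv: "z i = u i \<or> z i = v i" if "i < m" for i
      using z that by (simp add: strictly_between_def)
    \<comment> \<open>\<open>True\<close> puts \<open>v\<close> on a block and \<open>False\<close>
      puts \<open>u\<close>. The parameters belong, in this order, to the blocks inside
      \<open>X\<close> with \<open>z = u\<close>, inside with \<open>z = v\<close>, outside with
      \<open>z = u\<close>, outside with \<open>z = v\<close>.\<close>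
    define w where "w p q r s = (\<lambda>i. if (if i \<in> X then (if z i = u i then p else q)
        else (if z i = u i then r else s)) then v i else u i)" for p q r s
    \<comment> \<open>These say that a block contains a coordinate where \<open>u\<close> and
      \<open>v\<close> differ. For \<open>?x2\<close> and \<open>?y2\<close> this is automatic, as
      \<open>z i \<noteq> u i\<close> forces \<open>z i = v i\<close>.\<close>
    let ?x1 = "\<exists>i<m. i \<in> X \<and> z i = u i \<and> u i \<noteq> v i"
    let ?x2 = "\<exists>i<m. i \<in> X \<and> z i \<noteq> u i"
    let ?y1 = "\<exists>i<m. i \<notin> X \<and> z i = u i \<and> u i \<noteq> v i"
    let ?y2 = "\<exists>i<m. i \<notin> X \<and> z i \<noteq> u i"
    have x1y1: "?x1 \<or> ?y1" using z zuv unfolding strictly_between_def by metis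
    have x2y2: "?x2 \<or> ?y2" using z zuv unfolding strictly_between_def by metis
    have fu: "f u = f (w False False False False)" by (rule cong) (simp add: w_def)
    have fv: "f v = f (w True True True True)" by (rule cong) (simp add: w_def)
    have fz': "f z = f (w False True False True)" by (rule cong) (use zuv in \<open>auto simp: w_def\<close>)
    have fo: "f (swap_along z u v) = f (w True False True False)"
      by (rule cong) (auto simp: w_def swap_along_def)
    have fm: "f (mix X u v) = f (w False False True True)" "f (mix X v u) = f (w True True False False)"
      by (rule cong, auto simp: w_def mix_def)+
    \<comment> \<open>If the two vectors agree on a nonempty block, they differ in strictly fewer
      coordinates than \<open>u\<close> and \<open>v\<close>, so the induction hypothesis applies;
      mixing along \<open>X\<close> exchanges the last two parameters.\<close>
    have step: "f (w p q r s) * f (w p' q' r' s') = f (w p q r' s') * f (w p' q' r s)"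
      if w: "0 < f (w p q r s)" "0 < f (w p' q' r' s')"
        and e: "(?x1 \<and> p = p') \<or> (?x2 \<and> q = q') \<or> (?y1 \<and> r = r') \<or> (?y2 \<and> s = s')"
      for p q r s p' q' r' s'
    proof -
      have "w p q r s i = u i" if "u i = v i" for p q r s i
        using that by (simp add: w_def)
      then have sub: "{i. i < m \<and> w p q r s i \<noteq> w p' q' r' s' i} \<subseteq> {i. i < m \<and> u i \<noteq> v i}"
        by auto
      obtain i where "i < m" "u i \<noteq> v i" "w p q r s i = w p' q' r' s' i"
      proof -
        from e consider i where "i < m" "i \<in> X" "z i = u i" "u i \<noteq> v i" "p = p'"
          | i where "i < m" "i \<in> X" "z i \<noteq> u i" "q = q'"
          | i where "i < m" "i \<notin> X" "z i = u i" "u i \<noteq> v i" "r = r'"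
          | i where "i < m" "i \<notin> X" "z i \<noteq> u i" "s = s'" by blast
        then show thesis
        proof cases
          case (1 i) then show thesis using that[of i] by (simp add: w_def)
        next
          case (2 i) then show thesis using that[of i] zuv[of i] by (auto simp: w_def)
        next
          case (3 i) then show thesis using that[of i] by (simp add: w_def)
        next
          case (4 i) then show thesis using that[of i] zuv[of i] by (auto simp: w_def)
        qed
      qed
      then have "{i. i < m \<and> w p q r s i \<noteq> w p' q' r' s' i} \<subset> {i. i < m \<and> u i \<noteq> v i}"
        using sub by blast
      then have "card {i. i < m \<and> w p q r s i \<noteq> w p' q' r' s' i} < card {i. i < m \<and> u i \<noteq> v i}"
        by (intro psubset_card_mono) simp_all
      from IH[OF this w] have "f (w p q r s) * f (w p' q' r' s') =
        f (mix X (w p q r s) (w p' q' r' s')) * f (mix X (w p' q' r' s') (w p q r s))" .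
      also have "f (mix X (w p q r s) (w p' q' r' s')) = f (w p q r' s')"
        by (rule cong) (simp add: mix_def w_def)
      also have "f (mix X (w p' q' r' s') (w p q r s)) = f (w p' q' r s)"
        by (rule cong) (simp add: mix_def w_def)
      finally show ?thesis .
    qed
    have prod: "f (w False True False True) * f (w True False True False) =
        f (w False False False False) * f (w True True True True)"
      using fz by (simp only: fz' fo fu fv)
    have pos0: "0 < f (w False False False False)" and pos1: "0 < f (w True True True True)"
      using pos by (simp_all add: fu fv)
    then have posz: "0 < f (w False True False True)"
      using prod by (metis mult_is_0 neq0_conv)
    \<comment> \<open>In the first case \<open>z\<close> coincides with \<open>mix X v u\<close>, in
      the second with \<open>mix X u v\<close>, and the equation for \<open>z\<close> is already the
      claim. The third case is what gives the equations \<open>3\<close> and \<open>4\<close> a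
      common nonempty block.\<close>
    consider "\<not> ?x1 \<and> \<not> ?y2" | "\<not> ?x2 \<and> \<not> ?y1" | "(?x1 \<or> ?y2) \<and> (?x2 \<or> ?y1)" by blast
    then have "f (w False False True True) * f (w True True False False) =
        f (w False False False False) * f (w True True True True)"
    proof cases
      case 1
      then have "f (w False False True True) = f (w True False True False)"
        "f (w True True False False) = f (w False True False True)"
        by (auto intro!: cong simp: w_def)
      then show ?thesis using prod by (simp add: mult.commute)
    next
      case 2
      then have "f (w False False True True) = f (w False True False True)"
        "f (w True True False False) = f (w True False True False)"
        by (auto intro!: cong simp: w_def)
      then show ?thesis using prod by simp
    next
      case 3
      have 1: "f (w False False False False) * f (w False True False True) =
          f (w False False False True) * f (w False True False False)"
        by (rule step[OF pos0 posz]) (use x1y1 in blast)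
      have 2: "f (w True True True True) * f (w False True False True) =
          f (w True True False True) * f (w False True True True)"
        by (rule step[OF pos1 posz]) (use x2y2 in blast)
      have p: "0 < f (w False False False True)" "0 < f (w False True False False)"
        "0 < f (w True True False True)" "0 < f (w False True True True)"
        using 1 2 pos0 pos1 posz by (metis mult_is_0 neq0_conv)+
      have 3: "f (w False False False True) * f (w False True True True) =
          f (w False False True True) * f (w False True False True)"
        by (rule step[OF p(1,4)]) (use \<open>(?x1 \<or> ?y2) \<and> (?x2 \<or> ?y1)\<close> in blast)
      have 4: "f (w False True False False) * f (w True True False True) =
          f (w False True False True) * f (w True True False False)"
        by (rule step[OF p(2,3)]) (use \<open>(?x1 \<or> ?y2) \<and> (?x2 \<or> ?y1)\<close> in blast)
      have "(f (w False False True True) * f (w True True False False)) *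
          (f (w False True False True) * f (w False True False True)) =
          (f (w False False False True) * f (w False True True True)) *
          (f (w False True False False) * f (w True True False True))"
        unfolding 3 4 by simp
      also have "\<dots> = (f (w False False False True) * f (w False True False False)) *
          (f (w True True False True) * f (w False True True True))"
        by simp
      also have "\<dots> = (f (w False False False False) * f (w True True True True)) *
          (f (w False True False True) * f (w False True False True))"
        unfolding 1[symmetric] 2[symmetric] by simp
      finally show ?thesis using posz by simp
    qed
    then show ?thesis by (simp only: fm fu fv)
  qed
qed

text \<open>In the following, \<open>A\<close> is a matrix with rows below \<open>m\<close> and columns below \<open>n\<close>.\<close>

definition col_count :: "nat \<Rightarrow> nat \<Rightarrow> (nat \<Rightarrow> nat \<Rightarrow> 'a) \<Rightarrow> (nat \<Rightarrow> 'a) \<Rightarrow> nat" where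
  "col_count m n A w = card {k. k < n \<and> (\<forall>i<m. A i k = w i)}"

text \<open>Only pairs of columns are tested. Their counts are positive, so the equation forces both
  mixtures to be columns as well.\<close>

definition separable :: "nat \<Rightarrow> nat \<Rightarrow> (nat \<Rightarrow> nat \<Rightarrow> 'a) \<Rightarrow> nat set \<Rightarrow> bool" where
  "separable m n A X \<longleftrightarrow> (\<forall>j<n. \<forall>k<n.
     col_count m n A (\<lambda>i. A i j) * col_count m n A (\<lambda>i. A i k) =
     col_count m n A (mix X (\<lambda>i. A i j) (\<lambda>i. A i k)) * col_count m n A (mix X (\<lambda>i. A i k) (\<lambda>i. A i j)))"

text \<open>Searching \<open>l\<close> among the columns loses nothing: for columns \<open>j\<close>
  and \<open>k\<close> the right-hand side is positive, so a vector satisfying the equation must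
  occur as a column.\<close>

definition exchangeable :: "nat \<Rightarrow> nat \<Rightarrow> (nat \<Rightarrow> nat \<Rightarrow> 'a) \<Rightarrow> nat \<Rightarrow> nat \<Rightarrow> bool" where
  "exchangeable m n A j k \<longleftrightarrow> (\<exists>l<n. strictly_between m (\<lambda>i. A i l) (\<lambda>i. A i j) (\<lambda>i. A i k) \<and>
     col_count m n A (\<lambda>i. A i l) * col_count m n A (swap_along (\<lambda>i. A i l) (\<lambda>i. A i j) (\<lambda>i. A i k)) =
     col_count m n A (\<lambda>i. A i j) * col_count m n A (\<lambda>i. A i k))"

text \<open>In a factorization with \<open>u\<close> and \<open>v\<close> differing on both sides, the two mixtures of \<open>u\<close> and \<open>v\<close>
  witness that \<open>u\<close> and \<open>v\<close> are exchangeable. Linked rows are the pairs of rows this forces onto the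
  same side.\<close>

definition linked :: "nat \<Rightarrow> nat \<Rightarrow> (nat \<Rightarrow> nat \<Rightarrow> 'a) \<Rightarrow> nat \<Rightarrow> nat \<Rightarrow> bool" where
  "linked m n A i i' \<longleftrightarrow>
     (\<exists>j<n. \<exists>k<n. A i j \<noteq> A i k \<and> A i' j \<noteq> A i' k \<and> \<not> exchangeable m n A j k)"

lemma col_count_cong: "(\<And>i. i < m \<Longrightarrow> u i = v i) \<Longrightarrow> col_count m n A u = col_count m n A v"
  unfolding col_count_def by (metis (mono_tags, opaque_lifting))

lemma col_count_pos_iff: "0 < col_count m n A w \<longleftrightarrow> (\<exists>k<n. \<forall>i<m. A i k = w i)"
  by (auto simp: col_count_def card_gt_0_iff)

lemma separable_imp_linked_same_side:
  assumes sep: "separable m n A X" and i: "i < m" "i' < m" and "linked m n A i i'"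
  shows "i \<in> X \<longleftrightarrow> i' \<in> X"
proof (rule ccontr)
  assume side: "(i \<in> X) \<noteq> (i' \<in> X)"
  obtain j k where jk: "j < n" "k < n" "A i j \<noteq> A i k" "A i' j \<noteq> A i' k" "\<not> exchangeable m n A j k"
    using assms(4) unfolding linked_def by blast
  let ?u = "\<lambda>i. A i j" and ?v = "\<lambda>i. A i k"
  have eq: "col_count m n A ?u * col_count m n A ?v =
     col_count m n A (mix X ?u ?v) * col_count m n A (mix X ?v ?u)"
    using sep jk unfolding separable_def by blast
  moreover have "0 < col_count m n A ?u" "0 < col_count m n A ?v"
    using jk by (auto simp: col_count_pos_iff)
  ultimately have "0 < col_count m n A (mix X ?u ?v)" by (metis mult_is_0 neq0_conv)
  then obtain l where l: "l < n" "\<And>i. i < m \<Longrightarrow> A i l = mix X ?u ?v i"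
    unfolding col_count_pos_iff by blast
  \<comment> \<open>Rows \<open>i\<close> and \<open>i'\<close> lie on opposite sides and the two
    columns differ in both, so the mixture equals neither column.\<close>
  have "strictly_between m (\<lambda>i. A i l) ?u ?v"
    unfolding strictly_between_def using l(2) i jk(3,4) side by (auto simp: mix_def)
  moreover have "col_count m n A (\<lambda>i. A i l) = col_count m n A (mix X ?u ?v)"
    by (rule col_count_cong) (rule l(2))
  moreover have "col_count m n A (swap_along (\<lambda>i. A i l) ?u ?v) = col_count m n A (mix X ?v ?u)"
    by (rule col_count_cong) (simp add: l(2) swap_along_def mix_def)
  ultimately have "exchangeable m n A j k"
    unfolding exchangeable_def using l(1) eq by auto
  with jk(5) show False by simp
qed

text \<open>Vectors that differ inside and outside \<open>X\<close> differ in two rows that are not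
  linked. The columns representing them are then exchangeable, which supplies the intermediate
  vector demanded by \<open>separable_of_between\<close>.\<close>

lemma linked_same_side_imp_separable:
  assumes closed: "\<And>i i'. i < m \<Longrightarrow> i' < m \<Longrightarrow> linked m n A i i' \<Longrightarrow> i \<in> X \<longleftrightarrow> i' \<in> X"
  shows "separable m n A X"
  unfolding separable_def
proof (intro allI impI)
  fix j k assume jk: "j < n" "k < n"
  show "col_count m n A (\<lambda>i. A i j) * col_count m n A (\<lambda>i. A i k) =
     col_count m n A (mix X (\<lambda>i. A i j) (\<lambda>i. A i k)) * col_count m n A (mix X (\<lambda>i. A i k) (\<lambda>i. A i j))"
  proof (rule separable_of_between[where m = m])
    fix u v assume uv: "0 < col_count m n A u" "0 < col_count m n A v"
      and "\<exists>i<m. i \<in> X \<and> u i \<noteq> v i" "\<exists>i<m. i \<notin> X \<and> u i \<noteq> v i"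
    then obtain i i' where i: "i < m" "i \<in> X" "u i \<noteq> v i" "i' < m" "i' \<notin> X" "u i' \<noteq> v i'"
      by blast
    obtain p q where p: "p < n" "\<And>i. i < m \<Longrightarrow> A i p = u i" and q: "q < n" "\<And>i. i < m \<Longrightarrow> A i q = v i"
      using uv unfolding col_count_pos_iff by blast
    have "\<not> linked m n A i i'" using closed i by blast
    then have "exchangeable m n A p q"
      unfolding linked_def using i p q by metis
    then obtain l where l: "l < n" "strictly_between m (\<lambda>i. A i l) (\<lambda>i. A i p) (\<lambda>i. A i q)"
      "col_count m n A (\<lambda>i. A i l) * col_count m n A (swap_along (\<lambda>i. A i l) (\<lambda>i. A i p) (\<lambda>i. A i q)) =
        col_count m n A (\<lambda>i. A i p) * col_count m n A (\<lambda>i. A i q)"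
      unfolding exchangeable_def by blast
    have "strictly_between m (\<lambda>i. A i l) u v"
      using l(2) p(2) q(2) unfolding strictly_between_def by metis
    moreover have "col_count m n A (swap_along (\<lambda>i. A i l) (\<lambda>i. A i p) (\<lambda>i. A i q)) =
        col_count m n A (swap_along (\<lambda>i. A i l) u v)"
      by (rule col_count_cong) (simp add: swap_along_def p(2) q(2))
    moreover have "col_count m n A (\<lambda>i. A i p) = col_count m n A u" "col_count m n A (\<lambda>i. A i q) = col_count m n A v"
      by (simp_all add: p(2) q(2) cong: col_count_cong)
    ultimately show "\<exists>z. strictly_between m z u v \<and>
        col_count m n A z * col_count m n A (swap_along z u v) = col_count m n A u * col_count m n A v"
      using l(3) by metis
  qed (use jk in \<open>auto simp: col_count_pos_iff intro: col_count_cong\<close>)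
qed

text \<open>Passing to the mixtures merely regroups the four factors \<open>a u\<close>,
  \<open>b u\<close>, \<open>a v\<close>, \<open>b v\<close>.\<close>

lemma separable_of_factorization:
  assumes fac: "\<And>w. col_count m n A w = a w * b w"
    and a: "\<And>u v. (\<And>i. i < m \<Longrightarrow> i \<in> X \<Longrightarrow> u i = v i) \<Longrightarrow> a u = a v"
    and b: "\<And>u v. (\<And>i. i < m \<Longrightarrow> i \<notin> X \<Longrightarrow> u i = v i) \<Longrightarrow> b u = b v"
  shows "separable m n A X"
proof -
  have "a (mix X u v) = a u" "b (mix X u v) = b v" for u v
    by (auto intro!: a b simp: mix_def)
  then show ?thesis unfolding separable_def fac by (simp add: ac_simps)
qed

section \<open>Splitting a separable matrix\<close>

definition agree :: "nat \<Rightarrow> (nat \<Rightarrow> nat \<Rightarrow> 'a) \<Rightarrow> nat set \<Rightarrow> nat \<Rightarrow> nat \<Rightarrow> bool" where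
  "agree m A X j k \<longleftrightarrow> (\<forall>i<m. i \<in> X \<longrightarrow> A i j = A i k)"

definition class_size :: "nat \<Rightarrow> nat \<Rightarrow> (nat \<Rightarrow> nat \<Rightarrow> 'a) \<Rightarrow> nat set \<Rightarrow> nat \<Rightarrow> nat" where
  "class_size m n A X j = card {k. k < n \<and> agree m A X j k}"

lemma agree_refl [simp]: "agree m A X j j"
  by (simp add: agree_def)

lemma agree_sym: "agree m A X j k \<longleftrightarrow> agree m A X k j"
  by (auto simp: agree_def)

lemma agree_trans: "agree m A X j k \<Longrightarrow> agree m A X k l \<Longrightarrow> agree m A X j l"
  by (simp add: agree_def)

lemma agree_left_cong: "agree m A X j k \<Longrightarrow> agree m A X j l \<longleftrightarrow> agree m A X k l"
  using agree_sym agree_trans by metis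

lemma class_size_cong: "agree m A X j k \<Longrightarrow> class_size m n A X j = class_size m n A X k"
  unfolding class_size_def using agree_left_cong by metis

lemma class_size_pos: "j < n \<Longrightarrow> 0 < class_size m n A X j"
  unfolding class_size_def by (auto simp: card_gt_0_iff intro!: exI[of _ j])

lemma class_size_le: "class_size m n A X j \<le> n"
  unfolding class_size_def using card_mono[of "{..<n}" "{k. k < n \<and> agree m A X j k}"] by auto

lemma sum_if_const:
  "finite S \<Longrightarrow> (\<Sum>x\<in>S. if P x then c else 0) = real (card {x \<in> S. P x}) * c"
  by (simp add: sum.If_cases Int_def)

text \<open>The pairs of columns that agree with \<open>l\<close> on \<open>X\<close>, respectively off \<open>X\<close>, are counted by
  summing over the columns \<open>r\<close> obtained from the other halves of such a pair.\<close>

lemma class_size_mult: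
  assumes sep: "separable m n A X" and l: "l < n"
  shows "class_size m n A X l * class_size m n A (- X) l = n * col_count m n A (\<lambda>i. A i l)"
proof -
  let ?f = "col_count m n A"
  let ?c = "\<lambda>j i. A i j"
  let ?P = "{p. p < n \<and> agree m A X l p}" and ?Q = "{q. q < n \<and> agree m A (- X) l q}"
  have mixpos: "0 < ?f (mix X (?c q) (?c p))" if "p < n" "q < n" for p q
  proof -
    have "0 < ?f (?c p) * ?f (?c q)" using that by (auto simp: col_count_pos_iff)
    also have "\<dots> = ?f (mix X (?c p) (?c q)) * ?f (mix X (?c q) (?c p))"
      using sep that unfolding separable_def by blast
    finally show ?thesis by simp
  qed
  have mixeq: "(\<forall>i<m. A i r = mix X (?c q) (?c p) i) \<longleftrightarrow> agree m A (- X) r p \<and> agree m A X r q" for p q r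
    by (auto simp: agree_def mix_def)
  \<comment> \<open>Each pair \<open>(p, q)\<close> has total weight 1, spread evenly over the
    copies \<open>r\<close> of the mixture that takes \<open>q\<close> on \<open>X\<close> and
    \<open>p\<close> off \<open>X\<close>.\<close>
  have one: "(\<Sum>r<n. if \<forall>i<m. A i r = mix X (?c q) (?c p) i then 1 / real (?f (?c r)) else 0) = 1"
    if pq: "p < n" "q < n" for p q
  proof -
    have "(\<Sum>r<n. if \<forall>i<m. A i r = mix X (?c q) (?c p) i then 1 / real (?f (?c r)) else 0) =
      (\<Sum>r<n. if \<forall>i<m. A i r = mix X (?c q) (?c p) i then 1 / real (?f (mix X (?c q) (?c p))) else 0)"
    proof (intro sum.cong refl)
      fix r
      show "(if \<forall>i<m. A i r = mix X (?c q) (?c p) i then 1 / real (?f (?c r)) else 0) =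
        (if \<forall>i<m. A i r = mix X (?c q) (?c p) i then 1 / real (?f (mix X (?c q) (?c p))) else 0)"
        by (rule if_cong) (auto cong: col_count_cong)
    qed
    also have "\<dots> = real (?f (mix X (?c q) (?c p))) * (1 / real (?f (mix X (?c q) (?c p))))"
      by (subst sum_if_const) (simp_all add: col_count_def)
    also have "\<dots> = 1" using mixpos[OF pq] by simp
    finally show ?thesis .
  qed
  \<comment> \<open>For fixed \<open>r\<close>, the column \<open>p\<close> must equal
    \<open>l\<close> on \<open>X\<close> and \<open>r\<close> off \<open>X\<close>, and
    \<open>q\<close> the other way round. By separability there are \<open>f(l) f(r)\<close> such
    pairs, each of weight \<open>1 / f(r)\<close>.\<close>
  have cnt: "(\<Sum>p\<in>?P. \<Sum>q\<in>?Q. if \<forall>i<m. A i r = mix X (?c q) (?c p) i then 1 / real (?f (?c r)) else 0) =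
    real (?f (?c l))" if r: "r < n" for r
  proof -
    have *: "(\<Sum>p\<in>?P. \<Sum>q\<in>?Q. if \<forall>i<m. A i r = mix X (?c q) (?c p) i then 1 / real (?f (?c r)) else 0) =
      (\<Sum>p\<in>?P. \<Sum>q\<in>?Q. (if agree m A (- X) r p then 1 else 0) * ((if agree m A X r q then 1 else 0) / real (?f (?c r))))"
      by (intro sum.cong refl) (simp add: mixeq)
    also have "\<dots> = (\<Sum>p\<in>?P. if agree m A (- X) r p then 1 else 0) *
        (\<Sum>q\<in>?Q. (if agree m A X r q then 1 else 0) / real (?f (?c r)))"
      by (simp add: sum_product)
    also have "(\<Sum>p\<in>?P. if agree m A (- X) r p then 1 else 0 :: real) = real (?f (mix X (?c l) (?c r)))"
      unfolding col_count_def
      by (simp add: sum_if_const, rule arg_cong[of _ _ card]) (auto simp: agree_def mix_def)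
    also have "(\<Sum>q\<in>?Q. (if agree m A X r q then 1 else 0) / real (?f (?c r))) =
        real (?f (mix X (?c r) (?c l))) / real (?f (?c r))"
    proof -
      have "card {q \<in> ?Q. agree m A X r q} = ?f (mix X (?c r) (?c l))"
        unfolding col_count_def by (rule arg_cong[of _ _ card]) (auto simp: agree_def mix_def)
      then show ?thesis by (simp add: sum_if_const sum_divide_distrib[symmetric])
    qed
    also have "real (?f (mix X (?c l) (?c r))) * (real (?f (mix X (?c r) (?c l))) / real (?f (?c r))) =
        real (?f (mix X (?c l) (?c r)) * ?f (mix X (?c r) (?c l))) / real (?f (?c r))" by simp
    also have "?f (mix X (?c l) (?c r)) * ?f (mix X (?c r) (?c l)) = ?f (?c l) * ?f (?c r)"
      using sep l r unfolding separable_def by metis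
    also have "real (?f (?c l) * ?f (?c r)) / real (?f (?c r)) = real (?f (?c l))"
    proof -
      have "0 < ?f (?c r)" using r by (auto simp: col_count_pos_iff)
      then show ?thesis by simp
    qed
    finally show ?thesis .
  qed
  have "real (class_size m n A X l * class_size m n A (- X) l) = (\<Sum>p\<in>?P. \<Sum>q\<in>?Q. 1)"
    by (simp add: class_size_def)
  also have "\<dots> = (\<Sum>p\<in>?P. \<Sum>q\<in>?Q. \<Sum>r<n.
      if \<forall>i<m. A i r = mix X (?c q) (?c p) i then 1 / real (?f (?c r)) else 0)"
    by (intro sum.cong refl) (simp add: one del: One_nat_def)
  also have "\<dots> = (\<Sum>p\<in>?P. \<Sum>r<n. \<Sum>q\<in>?Q.
      if \<forall>i<m. A i r = mix X (?c q) (?c p) i then 1 / real (?f (?c r)) else 0)"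
    by (rule sum.cong[OF refl]) (rule sum.swap)
  also have "\<dots> = (\<Sum>r<n. \<Sum>p\<in>?P. \<Sum>q\<in>?Q.
      if \<forall>i<m. A i r = mix X (?c q) (?c p) i then 1 / real (?f (?c r)) else 0)"
    by (rule sum.swap)
  also have "\<dots> = (\<Sum>r<n. real (?f (?c l)))"
    by (rule sum.cong[OF refl], rule cnt) simp
  also have "\<dots> = real (n * ?f (?c l))" by simp
  finally show ?thesis by (simp only: of_nat_eq_iff)
qed

subsection \<open>Selecting every \<open>d\<close>-th element of each class\<close>

text \<open>The position of \<open>j\<close> within its class, counted from 0: the ranks divisible
  by \<open>d\<close> belong to the first member and every \<open>d\<close>-th one after it.\<close>

definition class_rank :: "nat \<Rightarrow> (nat \<Rightarrow> nat \<Rightarrow> 'a) \<Rightarrow> nat set \<Rightarrow> nat \<Rightarrow> nat" where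
  "class_rank m A X j = card {k. k < j \<and> agree m A X j k}"

lemma bij_betw_rank:
  fixes K :: "nat set"
  assumes "finite K"
  shows "bij_betw (\<lambda>j. card {k \<in> K. k < j}) K {..<card K}"
proof -
  have less: "card {k \<in> K. k < i} < card {k \<in> K. k < j}" if "i \<in> K" "i < j" for i j
    by (rule psubset_card_mono) (use that assms in auto)
  then have "inj_on (\<lambda>j. card {k \<in> K. k < j}) K"
    by (intro linorder_inj_onI') (simp add: less_imp_neq)
  moreover have "(\<lambda>j. card {k \<in> K. k < j}) ` K \<subseteq> {..<card K}"
  proof clarify
    fix j assume "j \<in> K"
    then show "card {k \<in> K. k < j} < card K"
      by (intro psubset_card_mono assms) auto
  qed
  ultimately show ?thesis
    by (simp add: bij_betw_def card_image card_subset_eq)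
qed

lemma card_multiples_less: "0 < d \<Longrightarrow> card {r. r < d * q \<and> d dvd r} = (q :: nat)"
proof -
  assume d: "0 < d"
  have "{r. r < d * q \<and> d dvd r} = (\<lambda>i. d * i) ` {..<q}"
    using d by (auto simp: dvd_def)
  then show ?thesis using d by (simp add: card_image inj_on_def)
qed

text \<open>Within a class the ranks take each value below the class size exactly once, and
  \<open>d\<close> divides that size.\<close>

lemma card_selected:
  assumes d: "0 < d" "d dvd class_size m n A X l"
  shows "d * card {j. j < n \<and> agree m A X l j \<and> d dvd class_rank m A X j} = class_size m n A X l"
proof -
  let ?K = "{k. k < n \<and> agree m A X l k}"
  let ?r = "\<lambda>j. card {k \<in> ?K. k < j}"
  have r: "class_rank m A X j = ?r j" if "j \<in> ?K" for j
    unfolding class_rank_def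
    by (rule arg_cong[of _ _ card]) (use that agree_left_cong[of m A X l j] in auto)
  have bij: "bij_betw ?r ?K {..<class_size m n A X l}"
    using bij_betw_rank[of ?K] by (simp add: class_size_def)
  obtain q where q: "class_size m n A X l = d * q" using d(2) by (elim dvdE)
  have "{j. j < n \<and> agree m A X l j \<and> d dvd class_rank m A X j} = {j \<in> ?K. d dvd ?r j}"
    using r by auto
  moreover have "bij_betw ?r {j \<in> ?K. d dvd ?r j} {i. i < d * q \<and> d dvd i}"
    using bij unfolding q bij_betw_def by (auto simp: inj_on_def)
  ultimately show ?thesis
    using card_multiples_less[OF d(1), of q] q by (simp add: bij_betw_same_card)
qed

text \<open>Double counting: each selected column has weight \<open>d\<close>, shared equally by the
  members of its class. By \<open>card_selected\<close> every column receives total share 1.\<close>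

lemma card_selected_total:
  assumes d: "0 < d" and dvd: "\<And>l. l < n \<Longrightarrow> d dvd class_size m n A X l"
  shows "d * card {j. j < n \<and> d dvd class_rank m A X j} = n"
proof -
  let ?R = "class_size m n A X" and ?sel = "\<lambda>j. d dvd class_rank m A X j"
  have "real (d * card {j. j < n \<and> ?sel j}) = (\<Sum>j<n. if ?sel j then real d else 0)"
    by (simp add: sum_if_const conj_assoc)
  also have "\<dots> = (\<Sum>j<n. \<Sum>k<n. if agree m A X k j \<and> ?sel j then real d / real (?R k) else 0)"
  proof (intro sum.cong refl)
    fix j assume "j \<in> {..<n}"
    then have pos: "0 < ?R j" using class_size_pos by simp
    have "(\<Sum>k<n. if agree m A X k j \<and> ?sel j then real d / real (?R k) else 0) =
      (\<Sum>k<n. if agree m A X j k then (if ?sel j then real d / real (?R j) else 0) else 0)"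
    proof (intro sum.cong refl)
      fix k
      show "(if agree m A X k j \<and> ?sel j then real d / real (?R k) else 0) =
        (if agree m A X j k then (if ?sel j then real d / real (?R j) else 0) else 0)"
        using agree_sym[of m A X j k] class_size_cong[of m A X j k n] by simp
    qed
    also have "\<dots> = real (?R j) * (if ?sel j then real d / real (?R j) else 0)"
      by (simp add: sum_if_const class_size_def)
    finally show "(if ?sel j then real d else 0) =
      (\<Sum>k<n. if agree m A X k j \<and> ?sel j then real d / real (?R k) else 0)"
      using pos by simp
  qed
  also have "\<dots> = (\<Sum>k<n. \<Sum>j<n. if agree m A X k j \<and> ?sel j then real d / real (?R k) else 0)"
    by (rule sum.swap)
  also have "\<dots> = (\<Sum>k<n. 1)"
  proof (intro sum.cong refl)
    fix k assume k: "k \<in> {..<n}"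
    have "(\<Sum>j<n. if agree m A X k j \<and> ?sel j then real d / real (?R k) else 0) =
      real (d * card {j. j < n \<and> agree m A X k j \<and> ?sel j}) / real (?R k)"
      by (simp add: sum_if_const conj_assoc)
    also have "\<dots> = 1"
      using card_selected[OF d dvd, of k] class_size_pos[of k n m A X] k by simp
    finally show "(\<Sum>j<n. if agree m A X k j \<and> ?sel j then real d / real (?R k) else 0) = 1" .
  qed
  finally have "real (d * card {j. j < n \<and> ?sel j}) = real n" by simp
  then show ?thesis by (simp only: of_nat_eq_iff)
qed

text \<open>The common divisor \<open>d\<close> of the class sizes and \<open>n\<close> must be the greatest one for the second
  factor to have integral multiplicities.\<close>

lemma split_col_count:
  assumes sep: "separable m n A X" and l: "l < n"
    and d: "0 < d" "d dvd n" "\<And>j. j < n \<Longrightarrow> d dvd class_size m n A X j"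
    and max: "\<And>e. 0 < e \<Longrightarrow> e dvd n \<Longrightarrow> (\<And>j. j < n \<Longrightarrow> e dvd class_size m n A X j) \<Longrightarrow> e \<le> d"
    and n1: "n1 = card {j. j < n \<and> d dvd class_rank m A X j}"
  shows "card {j. j < n \<and> agree m A X l j \<and> d dvd class_rank m A X j} *
      card {j. j < n \<and> agree m A (- X) l j \<and> n1 dvd class_rank m A (- X) j} =
      col_count m n A (\<lambda>i. A i l)"
    and "n1 * card {j. j < n \<and> n1 dvd class_rank m A (- X) j} = n"
proof -
  have dn1: "d * n1 = n" using card_selected_total[OF d(1,3)] n1 by simp
  have n1pos: "0 < n1" using dn1 l by (cases n1) auto
  \<comment> \<open>The hypotheses describe the largest common divisor. It is identified with the
    gcd because the divisibility argument below multiplies all class sizes by \<open>?C\<close> and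
    pulls the factor out of the gcd.\<close>
  let ?G = "Gcd (insert n (class_size m n A X ` {..<n}))"
  have "?G \<noteq> 0" using l by auto
  moreover have "?G dvd n" "\<And>j. j < n \<Longrightarrow> ?G dvd class_size m n A X j" by (rule Gcd_dvd, simp)+
  ultimately have "?G \<le> d" using max[of ?G] by simp
  moreover have "d dvd ?G" using d by (auto intro!: Gcd_greatest)
  ultimately have G: "?G = d" using \<open>?G \<noteq> 0\<close> dvd_imp_le[of d ?G] by simp
  \<comment> \<open>Any \<open>j\<close> and \<open>k\<close> combine to a column \<open>p\<close>
    that agrees with \<open>j\<close> on \<open>X\<close> and with \<open>k\<close> off
    \<open>X\<close>, so the product of their class sizes is \<open>n\<close> times a count. Thus
    \<open>n = d * n1\<close> divides \<open>d * ?C\<close>, and \<open>d\<close> cancels.\<close>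
  have n1dvd: "n1 dvd class_size m n A (- X) k" if k: "k < n" for k
  proof -
    let ?C = "class_size m n A (- X) k"
    have "n dvd Gcd ((*) ?C ` insert n (class_size m n A X ` {..<n}))"
    proof (rule Gcd_greatest)
      fix x assume "x \<in> (*) ?C ` insert n (class_size m n A X ` {..<n})"
      then consider "x = ?C * n" | j where "j < n" "x = ?C * class_size m n A X j" by auto
      then show "n dvd x"
      proof cases
        case (2 j)
        have "0 < col_count m n A (\<lambda>i. A i j) * col_count m n A (\<lambda>i. A i k)"
          using 2 k by (auto simp: col_count_pos_iff)
        also have "\<dots> = col_count m n A (mix X (\<lambda>i. A i j) (\<lambda>i. A i k)) *
            col_count m n A (mix X (\<lambda>i. A i k) (\<lambda>i. A i j))"
          using sep 2 k unfolding separable_def by blast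
        finally obtain p where p: "p < n" "\<forall>i<m. A i p = mix X (\<lambda>i. A i j) (\<lambda>i. A i k) i"
          by (auto simp: col_count_pos_iff)
        then have "agree m A X p j" "agree m A (- X) p k" by (auto simp: agree_def mix_def)
        then have "class_size m n A X j = class_size m n A X p" "?C = class_size m n A (- X) p"
          using class_size_cong by metis+
        then have "x = n * col_count m n A (\<lambda>i. A i p)"
          using class_size_mult[OF sep p(1)] 2 by (simp add: mult.commute)
        then show ?thesis by simp
      qed simp
    qed
    also have "Gcd ((*) ?C ` insert n (class_size m n A X ` {..<n})) = ?C * ?G"
      by (simp add: Gcd_mult del: Gcd_insert image_insert)
    also have "?C * ?G = d * ?C" by (simp only: G mult.commute)
    finally have "d * n1 dvd d * ?C" by (simp only: dn1)
    then show ?thesis using d(1) by simp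
  qed
  show "n1 * card {j. j < n \<and> n1 dvd class_rank m A (- X) j} = n"
    by (rule card_selected_total[OF n1pos n1dvd])
  let ?a = "card {j. j < n \<and> agree m A X l j \<and> d dvd class_rank m A X j}"
  let ?b = "card {j. j < n \<and> agree m A (- X) l j \<and> n1 dvd class_rank m A (- X) j}"
  have "n * (?a * ?b) = (d * ?a) * (n1 * ?b)" by (simp add: dn1[symmetric])
  also have "\<dots> = n * col_count m n A (\<lambda>i. A i l)"
    by (simp only: card_selected[OF d(1) d(3)[OF l]] card_selected[OF n1pos n1dvd[OF l]] class_size_mult[OF sep l])
  finally show "?a * ?b = col_count m n A (\<lambda>i. A i l)" using l by simp
qed

subsection \<open>Isomorphism with a 1-product\<close>

text \<open>The column numbering of \<open>one_prod\<close> identifies columns with pairs, and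
  independent conditions on the two components multiply.\<close>

lemma card_div_mod:
  "card {c. c < n1 * n2 \<and> P (c div n2) \<and> Q (c mod n2)} =
    card {a. a < n1 \<and> P a} * card {b. b < n2 \<and> Q (b :: nat)}"
proof -
  have "bij_betw (\<lambda>(a, b). a * n2 + b) ({a. a < n1 \<and> P a} \<times> {b. b < n2 \<and> Q b})
      {c. c < n1 * n2 \<and> P (c div n2) \<and> Q (c mod n2)}"
  proof (rule bij_betw_byWitness[where f' = "\<lambda>c. (c div n2, c mod n2)"])
    have *: "a * n2 + b < n1 * n2" if "a < n1" "b < n2" for a b
    proof -
      have "a * n2 + b < Suc a * n2" using that(2) by simp
      also have "\<dots> \<le> n1 * n2" using that(1) by (intro mult_le_mono1) simp
      finally show ?thesis .
    qed
    then show "(\<lambda>(a, b). a * n2 + b) ` ({a. a < n1 \<and> P a} \<times> {b. b < n2 \<and> Q b})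
      \<subseteq> {c. c < n1 * n2 \<and> P (c div n2) \<and> Q (c mod n2)}" by auto
    have "c div n2 < n1 \<and> c mod n2 < n2" if "c < n1 * n2" for c
      using that by (cases "n2 = 0") (auto simp: less_mult_imp_div_less)
    then show "(\<lambda>c. (c div n2, c mod n2)) ` {c. c < n1 * n2 \<and> P (c div n2) \<and> Q (c mod n2)}
      \<subseteq> {a. a < n1 \<and> P a} \<times> {b. b < n2 \<and> Q b}" by auto
  qed auto
  from bij_betw_same_card[OF this] show ?thesis by (simp add: card_cartesian_product)
qed

lemma isomorphic_mat_sym:
  assumes "isomorphic_mat S T" shows "isomorphic_mat T S"
proof -
  obtain \<pi> \<sigma> where dims: "dim_row S = dim_row T" "dim_col S = dim_col T"
    and \<pi>: "\<pi> permutes {..<dim_row T}" and \<sigma>: "\<sigma> permutes {..<dim_col T}"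
    and eq: "\<And>i j. i < dim_row T \<Longrightarrow> j < dim_col T \<Longrightarrow> S $$ (i, j) = T $$ (\<pi> i, \<sigma> j)"
    using assms unfolding isomorphic_mat_def by blast
  have "T $$ (i, j) = S $$ (inv_into UNIV \<pi> i, inv_into UNIV \<sigma> j)" if "i < dim_row S" "j < dim_col S" for i j
  proof -
    have "inv_into UNIV \<pi> i < dim_row T" "inv_into UNIV \<sigma> j < dim_col T"
      using permutes_in_image[OF permutes_inv[OF \<pi>], of i] permutes_in_image[OF permutes_inv[OF \<sigma>], of j]
        that dims by simp_all
    then show ?thesis using eq permutes_inverses[OF \<pi>] permutes_inverses[OF \<sigma>] by simp
  qed
  then show ?thesis
    unfolding isomorphic_mat_def
    using dims permutes_inv[OF \<pi>] permutes_inv[OF \<sigma>] by (intro conjI exI[of _ "inv_into UNIV \<pi>"] exI[of _ "inv_into UNIV \<sigma>"]) auto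
qed

text \<open>A column of a product is an arbitrary pair of columns of the factors. So the copies of
  \<open>w\<close> are counted by a factor seeing only \<open>X\<close> times a factor seeing only
  its complement.\<close>

lemma one_product_imp_separable:
  assumes S: "S \<in> carrier_mat m n" and A: "\<And>i j. i < m \<Longrightarrow> j < n \<Longrightarrow> A i j = S $$ (i, j)"
    and "is_one_product S"
  obtains X where "separable m n A X" and "\<exists>i<m. i \<in> X" and "\<exists>i<m. i \<notin> X" and "0 < n"
proof -
  obtain S1 S2 where ne: "nonempty_mat S1" "nonempty_mat S2" and iso: "isomorphic_mat S (one_prod S1 S2)"
    using assms(3) unfolding is_one_product_def by blast
  let ?m1 = "dim_row S1" and ?n1 = "dim_col S1" and ?m2 = "dim_row S2" and ?n2 = "dim_col S2"
  have m: "m = ?m1 + ?m2" and n: "n = ?n1 * ?n2"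
    using S iso by (auto simp: isomorphic_mat_def one_prod_def)
  obtain \<pi> \<sigma> where \<pi>: "\<pi> permutes {..<m}" and \<sigma>: "\<sigma> permutes {..<n}"
    and "\<And>i j. i < m \<Longrightarrow> j < n \<Longrightarrow> S $$ (i, j) = one_prod S1 S2 $$ (\<pi> i, \<sigma> j)"
    using iso unfolding isomorphic_mat_def m n by (auto simp: one_prod_def)
  then have eq: "A i j = one_prod S1 S2 $$ (\<pi> i, \<sigma> j)" if "i < m" "j < n" for i j
    using that A by simp
  have \<pi>m: "\<pi> i < m \<longleftrightarrow> i < m" for i using permutes_in_image[OF \<pi>, of i] by simp
  have \<sigma>n: "\<sigma> j < n \<longleftrightarrow> j < n" for j using permutes_in_image[OF \<sigma>, of j] by simp
  define X where "X = {i. \<pi> i < ?m1}"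
  define a where "a w = card {k. k < ?n1 \<and> (\<forall>i<m. i \<in> X \<longrightarrow> S1 $$ (\<pi> i, k) = w i)}" for w
  define b where "b w = card {k. k < ?n2 \<and> (\<forall>i<m. i \<notin> X \<longrightarrow> S2 $$ (\<pi> i - ?m1, k) = w i)}" for w
  have "col_count m n A w = a w * b w" for w
  proof -
    let ?T = "\<lambda>c. \<forall>i<m. one_prod S1 S2 $$ (\<pi> i, c) = w i"
    have "{k. k < n \<and> (\<forall>i<m. A i k = w i)} = {k. k < n \<and> ?T (\<sigma> k)}"
      using eq by auto
    moreover have "bij_betw \<sigma> {k. k < n \<and> ?T (\<sigma> k)} {c. c < n \<and> ?T c}"
    proof (rule bij_betw_byWitness[where f' = "inv_into UNIV \<sigma>"])
      have "inv_into UNIV \<sigma> c < n" if "c < n" for c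
        using permutes_in_image[OF permutes_inv[OF \<sigma>], of c] that by simp
      then show "inv_into UNIV \<sigma> ` {c. c < n \<and> ?T c} \<subseteq> {k. k < n \<and> ?T (\<sigma> k)}"
        using permutes_inverses[OF \<sigma>] by auto
    qed (use permutes_inverses[OF \<sigma>] \<sigma>n in auto)
    ultimately have "col_count m n A w = card {c. c < n \<and> ?T c}"
      unfolding col_count_def by (simp add: bij_betw_same_card)
    also have "{c. c < n \<and> ?T c} = {c. c < ?n1 * ?n2 \<and>
        (\<forall>i<m. i \<in> X \<longrightarrow> S1 $$ (\<pi> i, c div ?n2) = w i) \<and>
        (\<forall>i<m. i \<notin> X \<longrightarrow> S2 $$ (\<pi> i - ?m1, c mod ?n2) = w i)}"
    proof (intro Collect_cong conj_cong)
      fix c assume c: "c < ?n1 * ?n2"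
      have "one_prod S1 S2 $$ (\<pi> i, c) =
          (if i \<in> X then S1 $$ (\<pi> i, c div ?n2) else S2 $$ (\<pi> i - ?m1, c mod ?n2))" if "i < m" for i
        using that \<pi>m[of i] c by (simp add: one_prod_def m X_def)
      then show "?T c \<longleftrightarrow> (\<forall>i<m. i \<in> X \<longrightarrow> S1 $$ (\<pi> i, c div ?n2) = w i) \<and>
        (\<forall>i<m. i \<notin> X \<longrightarrow> S2 $$ (\<pi> i - ?m1, c mod ?n2) = w i)" by auto
    qed (simp add: n)
    also have "card \<dots> = a w * b w" unfolding a_def b_def by (rule card_div_mod)
    finally show ?thesis .
  qed
  moreover have "a u = a v" if "\<And>i. i < m \<Longrightarrow> i \<in> X \<Longrightarrow> u i = v i" for u v
    unfolding a_def using that by metis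
  moreover have "b u = b v" if "\<And>i. i < m \<Longrightarrow> i \<notin> X \<Longrightarrow> u i = v i" for u v
    unfolding b_def using that by metis
  ultimately have "separable m n A X" by (rule separable_of_factorization)
  \<comment> \<open>The preimages of the first row of each block: nonempty factors make
    \<open>X\<close> and its complement nonempty.\<close>
  moreover have "inv_into UNIV \<pi> 0 < m" "inv_into UNIV \<pi> ?m1 < m"
    using permutes_in_image[OF permutes_inv[OF \<pi>], of 0] permutes_in_image[OF permutes_inv[OF \<pi>], of ?m1]
      ne m by (simp_all add: nonempty_mat_def)
  moreover have "inv_into UNIV \<pi> 0 \<in> X" "inv_into UNIV \<pi> ?m1 \<notin> X"
    using ne permutes_inverses(1)[OF \<pi>] by (simp_all add: X_def nonempty_mat_def)
  moreover have "0 < n" using ne n by (simp add: nonempty_mat_def)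
  ultimately show thesis using that by blast
qed

lemma card_nth_filter:
  "card {a. a < length (filter Q [0..<n]) \<and> P (filter Q [0..<n] ! a)} = card {j. j < n \<and> P j \<and> Q j}"
proof -
  have "card {a. a < length (filter Q [0..<n]) \<and> P (filter Q [0..<n] ! a)} =
      length (filter P (filter Q [0..<n]))"
    by (simp only: length_filter_conv_card)
  also have "\<dots> = card (set (filter P (filter Q [0..<n])))"
    by (rule distinct_card[symmetric]) simp
  also have "set (filter P (filter Q [0..<n])) = {j. j < n \<and> P j \<and> Q j}" by auto
  finally show ?thesis .
qed

lemma count_mset_eq_length: "count (mset ys) x = length (filter (\<lambda>y. y = x) ys)"
  by (induction ys) auto

lemma length_filter_upt: "length (filter Q [0..<n]) = card {j. j < n \<and> Q j}"
  using card_nth_filter[of Q n "\<lambda>_. True"] by simp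

definition submat :: "(nat \<Rightarrow> nat \<Rightarrow> 'a) \<Rightarrow> nat list \<Rightarrow> nat list \<Rightarrow> 'a mat" where
  "submat A rs cs = mat (length rs) (length cs) (\<lambda>(a, b). A (rs ! a) (cs ! b))"

text \<open>After the rows of \<open>X\<close> have been moved to the top, it suffices that both
  matrices have the same multiset of columns, since this yields the column permutation. Equality of
  multiplicities is \<open>split_col_count\<close>.\<close>

lemma split_isomorphic:
  assumes S: "S \<in> carrier_mat m n" and A: "\<And>i j. i < m \<Longrightarrow> j < n \<Longrightarrow> A i j = S $$ (i, j)"
    and sep: "separable m n A X" and npos: "0 < n"
    and d: "0 < d" "d dvd n" "\<And>j. j < n \<Longrightarrow> d dvd class_size m n A X j"
    and max: "\<And>e. 0 < e \<Longrightarrow> e dvd n \<Longrightarrow> (\<And>j. j < n \<Longrightarrow> e dvd class_size m n A X j) \<Longrightarrow> e \<le> d"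
    and cs1: "cs1 = filter (\<lambda>j. d dvd class_rank m A X j) [0..<n]"
    and cs2: "cs2 = filter (\<lambda>j. length cs1 dvd class_rank m A (- X) j) [0..<n]"
    and rs1: "rs1 = filter (\<lambda>i. i \<in> X) [0..<m]" and rs2: "rs2 = filter (\<lambda>i. i \<notin> X) [0..<m]"
  shows "isomorphic_mat (one_prod (submat A rs1 cs1) (submat A rs2 cs2)) S"
    and "0 < length cs1" and "0 < length cs2"
proof -
  let ?n1 = "length cs1" and ?n2 = "length cs2"
  let ?T = "one_prod (submat A rs1 cs1) (submat A rs2 cs2)"
  have n1: "?n1 = card {j. j < n \<and> d dvd class_rank m A X j}"
    unfolding cs1 by (rule length_filter_upt)
  note split = split_col_count[OF sep _ d max n1]
  have "?n2 = card {j. j < n \<and> ?n1 dvd class_rank m A (- X) j}"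
    unfolding cs2 by (rule length_filter_upt)
  then have nn: "?n1 * ?n2 = n" using split(2)[OF npos] by (simp only:)
  then show "0 < length cs1" "0 < length cs2" using npos by (auto intro!: gr0I)
  have sub: "set cs1 \<subseteq> {..<n}" "set cs2 \<subseteq> {..<n}" by (auto simp: cs1 cs2)
  let ?rs = "rs1 @ rs2"
  have rs: "distinct ?rs" "set ?rs = {..<m}" by (auto simp: rs1 rs2)
  then have lrs: "length rs1 + length rs2 = m" using distinct_card[of ?rs] by simp
  have dims: "dim_row ?T = m" "dim_col ?T = n" by (simp_all add: one_prod_def submat_def lrs nn)
  define \<pi> where "\<pi> i = (if i < m then ?rs ! i else i)" for i
  have "bij_betw ((!) ?rs) {..<length ?rs} (set ?rs)" by (rule bij_betw_nth[OF rs(1) refl refl])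
  then have "bij_betw ((!) ?rs) {..<m} {..<m}" using rs lrs by simp
  then have "bij_betw \<pi> {..<m} {..<m}" by (rule bij_betw_cong[THEN iffD1, rotated]) (simp add: \<pi>_def)
  then have \<pi>: "\<pi> permutes {..<m}" by (rule bij_imp_permutes) (simp add: \<pi>_def)
  \<comment> \<open>Columns become lists of entries so that multisets of them can be compared;
    \<open>key' c\<close> is column \<open>c\<close> of the product with its rows put back into the
    order of \<open>S\<close>.\<close>
  define key where "key j = map (\<lambda>i. A i j) [0..<m]" for j
  define key' where "key' c = map (\<lambda>i. if i \<in> X then A i (cs1 ! (c div ?n2)) else A i (cs2 ! (c mod ?n2))) [0..<m]" for c
  have "mset (map key' [0..<n]) = mset (map key [0..<n])"
  proof (rule multiset_eqI)
    fix x
    have c: "count (mset (map h [0..<n])) x = card {c. c < n \<and> h c = x}" for h :: "nat \<Rightarrow> 'a list"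
    proof -
      have "count (mset (map h [0..<n])) x = length (filter (\<lambda>y. y = x) (map h [0..<n]))"
        by (rule count_mset_eq_length)
      also have "\<dots> = card {i. i < n \<and> map h [0..<n] ! i = x}"
        unfolding length_filter_conv_card by simp
      also have "{i. i < n \<and> map h [0..<n] ! i = x} = {c. c < n \<and> h c = x}" by auto
      finally show ?thesis .
    qed
    have "card {c. c < n \<and> key' c = x} = card {c. c < n \<and> key c = x}"
    proof (cases "\<exists>l<n. key l = x")
      case True
      then obtain l where l: "l < n" "x = key l" by blast
      have "key' c = x \<longleftrightarrow> agree m A X l (cs1 ! (c div ?n2)) \<and> agree m A (- X) l (cs2 ! (c mod ?n2))" for c
        unfolding l key_def key'_def agree_def by auto
      then have "card {c. c < n \<and> key' c = x} = card {a. a < ?n1 \<and> agree m A X l (cs1 ! a)} *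
          card {b. b < ?n2 \<and> agree m A (- X) l (cs2 ! b)}"
        using card_div_mod[of ?n1 ?n2 "\<lambda>a. agree m A X l (cs1 ! a)" "\<lambda>b. agree m A (- X) l (cs2 ! b)"]
        unfolding nn by simp
      also have "\<dots> = card {j. j < n \<and> agree m A X l j \<and> d dvd class_rank m A X j} *
          card {j. j < n \<and> agree m A (- X) l j \<and> ?n1 dvd class_rank m A (- X) j}"
      proof -
        have "card {a. a < ?n1 \<and> agree m A X l (cs1 ! a)} =
            card {j. j < n \<and> agree m A X l j \<and> d dvd class_rank m A X j}"
          unfolding cs1 by (rule card_nth_filter)
        moreover have "card {b. b < ?n2 \<and> agree m A (- X) l (cs2 ! b)} =
            card {j. j < n \<and> agree m A (- X) l j \<and> ?n1 dvd class_rank m A (- X) j}"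
          unfolding cs2 by (rule card_nth_filter)
        ultimately show ?thesis by simp
      qed
      also have "\<dots> = col_count m n A (\<lambda>i. A i l)" by (rule split(1)[OF l(1)])
      also have "\<dots> = card {c. c < n \<and> key c = x}"
        unfolding col_count_def l(2) key_def by (rule arg_cong[of _ _ card]) auto
      finally show ?thesis .
    next
      case False
      \<comment> \<open>A column of the product mixes two columns of \<open>S\<close>, so by
        separability it occurs in \<open>S\<close> and cannot be a vector missing there.\<close>
      have "key' c \<noteq> x" if c: "c < n" for c
      proof -
        have "c div ?n2 < ?n1" "c mod ?n2 < ?n2"
          using c npos nn by (auto simp: less_mult_imp_div_less intro!: mod_less_divisor gr0I)
        then have jk: "cs1 ! (c div ?n2) < n" "cs2 ! (c mod ?n2) < n"
          using sub nth_mem[of _ cs1] nth_mem[of _ cs2] by blast+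
        let ?u = "\<lambda>i. A i (cs1 ! (c div ?n2))" and ?v = "\<lambda>i. A i (cs2 ! (c mod ?n2))"
        have "0 < col_count m n A ?u * col_count m n A ?v" using jk by (auto simp: col_count_pos_iff)
        also have "\<dots> = col_count m n A (mix X ?u ?v) * col_count m n A (mix X ?v ?u)"
          using sep jk unfolding separable_def by blast
        finally obtain l where l: "l < n" "\<forall>i<m. A i l = mix X ?u ?v i"
          by (auto simp: col_count_pos_iff)
        then have "key l = key' c" by (auto simp: key_def key'_def mix_def)
        then show ?thesis using False l(1) by metis
      qed
      then have "{c. c < n \<and> key' c = x} = {}" by blast
      moreover have "{c. c < n \<and> key c = x} = {}" using False by blast
      ultimately show ?thesis by (simp only:)
    qed
    then show "count (mset (map key' [0..<n])) x = count (mset (map key [0..<n])) x" by (simp only: c)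
  qed
  then obtain \<sigma> where \<sigma>: "\<sigma> permutes {..<length (map key [0..<n])}"
    and perm: "permute_list \<sigma> (map key [0..<n]) = map key' [0..<n]"
    by (rule mset_eq_permutation)
  have \<sigma>: "\<sigma> permutes {..<n}" using \<sigma> by simp
  have key: "key' c = key (\<sigma> c)" if "c < n" for c
  proof -
    have "\<sigma> c < n" using permutes_in_image[OF \<sigma>, of c] that by simp
    then have "permute_list \<sigma> (map key [0..<n]) ! c = key (\<sigma> c)"
      using permute_list_nth[of \<sigma> "map key [0..<n]" c] \<sigma> that by simp
    then show ?thesis using perm that by simp
  qed
  have entry: "A i (\<sigma> c) = (if i \<in> X then A i (cs1 ! (c div ?n2)) else A i (cs2 ! (c mod ?n2)))"
    if "c < n" "i < m" for c i
  proof -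
    have "A i (\<sigma> c) = key (\<sigma> c) ! i" using that by (simp add: key_def)
    also have "\<dots> = key' c ! i" by (simp only: key[OF that(1)])
    also have "\<dots> = (if i \<in> X then A i (cs1 ! (c div ?n2)) else A i (cs2 ! (c mod ?n2)))"
      using that by (simp add: key'_def)
    finally show ?thesis .
  qed
  have "?T $$ (i, c) = S $$ (\<pi> i, \<sigma> c)" if i: "i < m" and c: "c < n" for i c
  proof -
    have \<pi>i: "\<pi> i < m" using permutes_in_image[OF \<pi>, of i] i by simp
    have "\<sigma> c < n" using permutes_in_image[OF \<sigma>, of c] c by simp
    then have e: "S $$ (\<pi> i, \<sigma> c) = (if \<pi> i \<in> X then A (\<pi> i) (cs1 ! (c div ?n2)) else A (\<pi> i) (cs2 ! (c mod ?n2)))"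
      using entry[OF c \<pi>i] A[OF \<pi>i] by simp
    have cc: "c div ?n2 < ?n1" "c mod ?n2 < ?n2"
      using c npos nn by (auto simp: less_mult_imp_div_less intro!: mod_less_divisor gr0I)
    show ?thesis
    proof (cases "i < length rs1")
      case True
      then have "\<pi> i = rs1 ! i" using i by (simp add: \<pi>_def nth_append)
      moreover have "rs1 ! i \<in> X" using nth_mem[OF True] by (simp add: rs1)
      ultimately show ?thesis
        using e True cc c i
        by (simp add: one_prod_def submat_def lrs nn)
    next
      case False
      then have less: "i - length rs1 < length rs2" using i lrs by linarith
      have "\<pi> i = rs2 ! (i - length rs1)" using i False by (simp add: \<pi>_def nth_append)
      moreover have "rs2 ! (i - length rs1) \<notin> X" using nth_mem[OF less] by (simp add: rs2)
      ultimately show ?thesis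
        using e False cc c i less
        by (simp add: one_prod_def submat_def lrs nn)
    qed
  qed
  then show "isomorphic_mat ?T S"
    unfolding isomorphic_mat_def using S dims \<pi> \<sigma> by (intro conjI exI[of _ \<pi>] exI[of _ \<sigma>]) auto
qed

section \<open>The algorithm\<close>

subsection \<open>Computability of its ingredients\<close>

lemma dim_name_simps [simp]: "dim_name ''m''" "dim_name ''n''"
  by (simp_all add: dim_name_def)

lemma comp_fun_bounded_mult:
  assumes b: "dim_name b" and f: "comp_fun d f" and g: "comp_fun d g"
  shows "comp_fun d (\<lambda>\<rho> \<sigma>. min (f \<rho> \<sigma>) (nats \<sigma> b 0) * g \<rho> \<sigma>)"
proof -
  have "comp_fun d (\<lambda>\<rho> \<sigma>. \<Sum>k<nats \<sigma> b 0. if k < f \<rho> \<sigma> then g \<rho> \<sigma> else 0)"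
    by (intro comp_fun_sum[OF b] comp_fun_if comp_pred_less comp_fun_var comp_fun_const
        comp_fun_mono[OF f] comp_fun_mono[OF g])
      (simp_all add: comp_fun_upd[OF f] comp_fun_upd[OF g])
  moreover have "(\<Sum>k<B. if k < x then y else 0) = min x B * y" for B x y :: nat
  proof -
    have "{k. k < B \<and> k < x} = {..<min x B}" by auto
    then show ?thesis by (simp add: sum.If_cases Int_def)
  qed
  ultimately show ?thesis by simp
qed

text \<open>The \<open>min\<close> reflects that the machine multiplies by repeated addition, with at most \<open>m\<close> or \<open>n\<close>
  summands; it is harmless for \<open>i < m\<close>.\<close>

definition entry :: "state \<Rightarrow> nat \<Rightarrow> nat \<Rightarrow> real" where
  "entry \<sigma> i j = reals \<sigma> ''S'' (min i (nrows \<sigma>) * ncols \<sigma> + j)"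

lemma comp_pred_entry_eq:
  assumes "comp_fun d f" and "comp_fun d g" and "comp_fun d f'" and "comp_fun d g'"
  shows "comp_pred d (\<lambda>\<rho> \<sigma>. entry \<sigma> (f \<rho> \<sigma>) (g \<rho> \<sigma>) = entry \<sigma> (f' \<rho> \<sigma>) (g' \<rho> \<sigma>))"
  unfolding entry_def
  by (intro comp_pred_real_eq comp_fun_plus comp_fun_bounded_mult comp_fun_read comp_fun_const assms) simp_all

abbreviation count_of :: "state \<Rightarrow> (nat \<Rightarrow> real) \<Rightarrow> nat" where
  "count_of \<sigma> \<equiv> col_count (nrows \<sigma>) (ncols \<sigma>) (entry \<sigma>)"

lemma comp_fun_count:
  assumes j: "comp_fun d j"
  shows "comp_fun d (\<lambda>\<rho> \<sigma>. count_of \<sigma> (\<lambda>i. entry \<sigma> i (j \<rho> \<sigma>)))"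
  unfolding col_count_def
  by (intro comp_fun_card comp_pred_all comp_pred_entry_eq comp_fun_var comp_fun_mono[OF j])
    (simp_all add: comp_fun_upd[OF j])

text \<open>Reals are only compared cell by cell, so an equation with a conditional value is turned
  into a conditional of equations between cells.\<close>

lemma if_eq_conv: "(if b then x else y) = z \<longleftrightarrow> (if b then x = z else y = z)"
  by simp

lemma comp_fun_count_swap:
  assumes l: "comp_fun d l" and j: "comp_fun d j" and k: "comp_fun d k"
  shows "comp_fun d (\<lambda>\<rho> \<sigma>. count_of \<sigma>
    (swap_along (\<lambda>i. entry \<sigma> i (l \<rho> \<sigma>)) (\<lambda>i. entry \<sigma> i (j \<rho> \<sigma>)) (\<lambda>i. entry \<sigma> i (k \<rho> \<sigma>))))"
  unfolding col_count_def swap_along_def eq_commute[of "entry _ _ _" "if _ then _ else _"] if_eq_conv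
  by (intro comp_fun_card comp_pred_all comp_pred_if comp_pred_entry_eq comp_fun_var
      comp_fun_mono[OF l] comp_fun_mono[OF j] comp_fun_mono[OF k])
    (simp_all add: comp_fun_upd[OF l] comp_fun_upd[OF j] comp_fun_upd[OF k])

lemma comp_pred_strictly_between:
  assumes l: "comp_fun d l" and j: "comp_fun d j" and k: "comp_fun d k"
  shows "comp_pred d (\<lambda>\<rho> \<sigma>. strictly_between (nrows \<sigma>) (\<lambda>i. entry \<sigma> i (l \<rho> \<sigma>))
    (\<lambda>i. entry \<sigma> i (j \<rho> \<sigma>)) (\<lambda>i. entry \<sigma> i (k \<rho> \<sigma>)))"
  unfolding strictly_between_def
  by (intro comp_pred_all comp_pred_ex comp_pred_conj comp_pred_disj comp_pred_not comp_pred_entry_eq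
      comp_fun_var comp_fun_mono[OF l] comp_fun_mono[OF j] comp_fun_mono[OF k])
    (simp_all add: comp_fun_upd[OF l] comp_fun_upd[OF j] comp_fun_upd[OF k])

lemma col_count_le: "col_count m n A w \<le> n"
  unfolding col_count_def using card_mono[of "{..<n}" "{k. k < n \<and> (\<forall>i<m. A i k = w i)}"] by auto

text \<open>The first factors are at most \<open>n\<close>, so multiplication by at most
  \<open>n\<close> repeated additions is exact.\<close>

lemma comp_pred_count_eq:
  assumes "comp_fun d f" and "comp_fun d g" and "comp_fun d f'" and "comp_fun d g'"
    and "\<And>\<rho> \<sigma>. f \<rho> \<sigma> \<le> ncols \<sigma>" and "\<And>\<rho> \<sigma>. f' \<rho> \<sigma> \<le> ncols \<sigma>"
  shows "comp_pred d (\<lambda>\<rho> \<sigma>. f \<rho> \<sigma> * g \<rho> \<sigma> = f' \<rho> \<sigma> * g' \<rho> \<sigma>)"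
proof -
  have "comp_pred d (\<lambda>\<rho> \<sigma>. min (f \<rho> \<sigma>) (ncols \<sigma>) * g \<rho> \<sigma> = min (f' \<rho> \<sigma>) (ncols \<sigma>) * g' \<rho> \<sigma>)"
    by (intro comp_pred_eq comp_fun_bounded_mult assms(1-4)) simp_all
  then show ?thesis using assms(5,6) by (simp add: min_absorb1)
qed

lemma comp_pred_exchangeable:
  assumes j: "comp_fun d j" and k: "comp_fun d k"
  shows "comp_pred d (\<lambda>\<rho> \<sigma>. exchangeable (nrows \<sigma>) (ncols \<sigma>) (entry \<sigma>) (j \<rho> \<sigma>) (k \<rho> \<sigma>))"
  unfolding exchangeable_def
  by (intro comp_pred_ex comp_pred_conj comp_pred_count_eq comp_pred_strictly_between comp_fun_count
      comp_fun_count_swap comp_fun_var comp_fun_mono[OF j] comp_fun_mono[OF k] col_count_le)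
    (simp_all add: comp_fun_upd[OF j] comp_fun_upd[OF k])

lemma comp_pred_linked:
  assumes i: "comp_fun d i" and i': "comp_fun d i'"
  shows "comp_pred d (\<lambda>\<rho> \<sigma>. linked (nrows \<sigma>) (ncols \<sigma>) (entry \<sigma>) (i \<rho> \<sigma>) (i' \<rho> \<sigma>))"
  unfolding linked_def
  by (intro comp_pred_ex comp_pred_conj comp_pred_not comp_pred_entry_eq comp_pred_exchangeable
      comp_fun_var comp_fun_mono[OF i] comp_fun_mono[OF i'])
    (simp_all add: comp_fun_upd[OF i] comp_fun_upd[OF i'])

text \<open>The machine has only bounded loops here, so witnesses and ranks are searched below \<open>n\<close>; by
  \<open>dvd_upto_iff\<close> and \<open>rank_upto_eq\<close> this loses nothing.\<close>

definition dvd_upto :: "nat \<Rightarrow> nat \<Rightarrow> nat \<Rightarrow> bool" where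
  "dvd_upto n e x \<longleftrightarrow> x = 0 \<or> (\<exists>q<n. min (q + 1) n * e = x)"

lemma dvd_upto_iff: "x \<le> n \<Longrightarrow> dvd_upto n e x \<longleftrightarrow> e dvd x"
proof
  assume x: "x \<le> n" and "e dvd x"
  then obtain q where q: "x = e * q" by blast
  show "dvd_upto n e x"
  proof (cases "x = 0")
    case False
    then have "0 < e" "0 < q" using q by auto
    then have "q \<le> x" using q by simp
    then have "q \<le> n" using x by simp
    \<comment> \<open>The cofactors \<open>1..n\<close> are represented as \<open>q + 1\<close> with
      \<open>q < n\<close>; cofactor 0 is the separate case \<open>x = 0\<close>.\<close>
    then have "q - 1 < n" "min (q - 1 + 1) n * e = x" using q \<open>0 < q\<close> by simp_all
    then show ?thesis unfolding dvd_upto_def by blast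
  qed (simp add: dvd_upto_def)
qed (auto simp: dvd_upto_def)

lemma comp_pred_dvd_upto:
  assumes e: "comp_fun d e" and x: "comp_fun d x"
  shows "comp_pred d (\<lambda>\<rho> \<sigma>. dvd_upto (ncols \<sigma>) (e \<rho> \<sigma>) (x \<rho> \<sigma>))"
  unfolding dvd_upto_def
  by (intro comp_pred_disj comp_pred_ex comp_pred_eq comp_fun_bounded_mult comp_fun_plus comp_fun_const
      comp_fun_var comp_fun_mono[OF e] comp_fun_mono[OF x])
    (simp_all add: comp_fun_upd[OF e] comp_fun_upd[OF x])

text \<open>Row 0 represents the chosen component, and the flag \<open>b\<close> lets the same
  programs serve both factors.\<close>

definition side :: "state \<Rightarrow> bool \<Rightarrow> nat set" where
  "side \<sigma> b = {i. (nats \<sigma> ''lab'' i = nats \<sigma> ''lab'' 0) = b}"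

lemma comp_pred_side: "comp_fun d i \<Longrightarrow> comp_pred d (\<lambda>\<rho> \<sigma>. i \<rho> \<sigma> \<in> side \<sigma> b)"
  unfolding side_def mem_Collect_eq
  by (intro comp_pred_iff comp_pred_eq comp_fun_read comp_fun_const comp_pred_const) simp_all

lemma comp_pred_agree:
  assumes j: "comp_fun d j" and k: "comp_fun d k"
  shows "comp_pred d (\<lambda>\<rho> \<sigma>. agree (nrows \<sigma>) (entry \<sigma>) (side \<sigma> b) (j \<rho> \<sigma>) (k \<rho> \<sigma>))"
  unfolding agree_def
  by (intro comp_pred_all comp_pred_imp comp_pred_side comp_pred_entry_eq
      comp_fun_var comp_fun_mono[OF j] comp_fun_mono[OF k])
    (simp_all add: comp_fun_upd[OF j] comp_fun_upd[OF k])

lemma comp_fun_class_size: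
  assumes j: "comp_fun d j"
  shows "comp_fun d (\<lambda>\<rho> \<sigma>. class_size (nrows \<sigma>) (ncols \<sigma>) (entry \<sigma>) (side \<sigma> b) (j \<rho> \<sigma>))"
  unfolding class_size_def
  by (intro comp_fun_card comp_pred_agree comp_fun_var comp_fun_mono[OF j])
    (simp_all add: comp_fun_upd[OF j])

definition rank_upto :: "nat \<Rightarrow> nat \<Rightarrow> (nat \<Rightarrow> nat \<Rightarrow> 'a) \<Rightarrow> nat set \<Rightarrow> nat \<Rightarrow> nat" where
  "rank_upto m n A X j = card {k. k < n \<and> k < j \<and> agree m A X j k}"

lemma rank_upto_eq: "j \<le> n \<Longrightarrow> rank_upto m n A X j = class_rank m A X j"
  unfolding rank_upto_def class_rank_def by (rule arg_cong[of _ _ card]) auto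

lemma class_rank_le: "class_rank m A X j \<le> j"
  unfolding class_rank_def using card_mono[of "{..<j}" "{k. k < j \<and> agree m A X j k}"] by auto

definition selected :: "state \<Rightarrow> bool \<Rightarrow> nat \<Rightarrow> nat \<Rightarrow> bool" where
  "selected \<sigma> b d j \<longleftrightarrow> dvd_upto (ncols \<sigma>) d (rank_upto (nrows \<sigma>) (ncols \<sigma>) (entry \<sigma>) (side \<sigma> b) j)"

lemma selected_iff:
  "j < ncols \<sigma> \<Longrightarrow> selected \<sigma> b d j \<longleftrightarrow> d dvd class_rank (nrows \<sigma>) (entry \<sigma>) (side \<sigma> b) j"
  unfolding selected_def
  by (subst dvd_upto_iff) (use class_rank_le[of "nrows \<sigma>" "entry \<sigma>" "side \<sigma> b" j] in \<open>simp_all add: rank_upto_eq\<close>)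

lemma comp_pred_selected:
  assumes e: "comp_fun d e" and j: "comp_fun d j"
  shows "comp_pred d (\<lambda>\<rho> \<sigma>. selected \<sigma> b (e \<rho> \<sigma>) (j \<rho> \<sigma>))"
  unfolding selected_def rank_upto_def
  by (intro comp_pred_dvd_upto e comp_fun_card comp_pred_conj comp_pred_less comp_pred_agree
      comp_fun_var comp_fun_mono[OF j])
    (simp_all add: comp_fun_upd[OF j])

definition common_divisor :: "state \<Rightarrow> nat \<Rightarrow> bool" where
  "common_divisor \<sigma> e \<longleftrightarrow> dvd_upto (ncols \<sigma>) e (ncols \<sigma>) \<and>
    (\<forall>j<ncols \<sigma>. dvd_upto (ncols \<sigma>) e (class_size (nrows \<sigma>) (ncols \<sigma>) (entry \<sigma>) (side \<sigma> True) j))"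

lemma common_divisor_iff:
  "common_divisor \<sigma> e \<longleftrightarrow> e dvd ncols \<sigma> \<and>
    (\<forall>j<ncols \<sigma>. e dvd class_size (nrows \<sigma>) (ncols \<sigma>) (entry \<sigma>) (side \<sigma> True) j)"
  unfolding common_divisor_def by (simp add: dvd_upto_iff class_size_le)

lemma comp_pred_common_divisor:
  assumes e: "comp_fun d e"
  shows "comp_pred d (\<lambda>\<rho> \<sigma>. common_divisor \<sigma> (e \<rho> \<sigma>))"
  unfolding common_divisor_def
  by (intro comp_pred_conj comp_pred_all comp_pred_dvd_upto comp_fun_class_size comp_fun_read
      comp_fun_const comp_fun_var comp_fun_mono[OF e])
    (simp_all add: comp_fun_upd[OF e])

text \<open>A maximum disguised as a bounded sum: for \<open>n > 0\<close> exactly one summand is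
  nonzero, the one belonging to the greatest common divisor.\<close>

definition max_divisor :: "state \<Rightarrow> nat" where
  "max_divisor \<sigma> = (\<Sum>x<ncols \<sigma>. if common_divisor \<sigma> (x + 1) \<and>
     (\<forall>y<ncols \<sigma>. common_divisor \<sigma> (y + 1) \<longrightarrow> \<not> x < y) then x + 1 else 0)"

lemma comp_fun_max_divisor: "comp_fun d (\<lambda>\<rho> \<sigma>. max_divisor \<sigma>)"
  unfolding max_divisor_def
  by (intro comp_fun_sum comp_fun_if comp_pred_conj comp_pred_all comp_pred_imp comp_pred_not
      comp_pred_less comp_pred_common_divisor comp_fun_plus comp_fun_var comp_fun_const) simp_all

lemma max_divisor:
  assumes "0 < ncols \<sigma>"
  shows "0 < max_divisor \<sigma>" and "common_divisor \<sigma> (max_divisor \<sigma>)"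
    and "\<And>e. 0 < e \<Longrightarrow> common_divisor \<sigma> e \<Longrightarrow> e \<le> max_divisor \<sigma>"
proof -
  let ?E = "{e. 0 < e \<and> common_divisor \<sigma> e}"
  have le: "e \<le> ncols \<sigma>" if "e \<in> ?E" for e
    using that assms by (auto simp: common_divisor_iff intro: dvd_imp_le)
  then have fin: "finite ?E" by (auto intro: finite_subset[of _ "{..ncols \<sigma>}"])
  have "1 \<in> ?E" by (simp add: common_divisor_iff)
  then have M: "Max ?E \<in> ?E" using fin by (intro Max_in) auto
  have max: "e \<le> Max ?E" if "e \<in> ?E" for e using fin that by simp
  have "common_divisor \<sigma> (x + 1) \<and> (\<forall>y<ncols \<sigma>. common_divisor \<sigma> (y + 1) \<longrightarrow> \<not> x < y) \<longleftrightarrow> x = Max ?E - 1"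
    if x: "x < ncols \<sigma>" for x
  proof
    assume *: "common_divisor \<sigma> (x + 1) \<and> (\<forall>y<ncols \<sigma>. common_divisor \<sigma> (y + 1) \<longrightarrow> \<not> x < y)"
    have "Max ?E - 1 < ncols \<sigma>" "common_divisor \<sigma> (Max ?E - 1 + 1)"
      using M le[OF M] assms by auto
    then have "\<not> x < Max ?E - 1" using * by blast
    moreover have "x + 1 \<le> Max ?E" using * by (intro max) simp
    ultimately show "x = Max ?E - 1" by linarith
  next
    assume x: "x = Max ?E - 1"
    have "\<not> x < y" if "common_divisor \<sigma> (y + 1)" for y
      using max[of "y + 1"] that x by simp
    then show "common_divisor \<sigma> (x + 1) \<and> (\<forall>y<ncols \<sigma>. common_divisor \<sigma> (y + 1) \<longrightarrow> \<not> x < y)"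
      using M x by simp
  qed
  then have "max_divisor \<sigma> = (\<Sum>x<ncols \<sigma>. if x = Max ?E - 1 then x + 1 else 0)"
    unfolding max_divisor_def by (intro sum.cong refl if_cong) simp_all
  also have "\<dots> = Max ?E"
  proof -
    have "Max ?E - 1 < ncols \<sigma>" using le[OF M] assms by linarith
    then show ?thesis using M by (simp add: sum.delta)
  qed
  finally have eq: "max_divisor \<sigma> = Max ?E" .
  show "0 < max_divisor \<sigma>" "common_divisor \<sigma> (max_divisor \<sigma>)" using M by (simp_all add: eq)
  show "e \<le> max_divisor \<sigma>" if "0 < e" "common_divisor \<sigma> e" for e using max[of e] that by (simp add: eq)
qed

subsection \<open>Merging linked rows\<close>

lemma fold_upt_invariant:
  assumes "I 0 \<sigma>" and "\<And>k \<tau>. k < r \<Longrightarrow> I k \<tau> \<Longrightarrow> I (Suc k) (F k \<tau>)"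
  shows "I r (fold F [0..<r] \<sigma>)"
  using assms by (induction r) simp_all

definition init_labels :: "state \<Rightarrow> state" where
  "init_labels \<sigma> = fold (\<lambda>i. nupdate ''lab'' i i) [0..<nrows \<sigma>] \<sigma>"

lemma comp_cmd_init_labels: "comp_cmd 0 (\<lambda>\<rho> \<sigma>. init_labels \<sigma>)"
  unfolding init_labels_def
  by (intro comp_cmd_for comp_cmd_assign comp_fun_var) simp_all

definition relabel :: "state \<Rightarrow> state" where
  "relabel \<sigma> = fold (\<lambda>k \<tau>. if nats \<tau> ''lab'' k = nats \<tau> ''y'' 0 then nupdate ''lab'' k (nats \<tau> ''x'' 0) \<tau> else \<tau>)
     [0..<nrows \<sigma>] \<sigma>"

text \<open>Both labels are saved before relabelling, which overwrites the label of row
  \<open>j\<close> while later rows still have to be compared with it.\<close>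

definition join :: "nat \<Rightarrow> nat \<Rightarrow> state \<Rightarrow> state" where
  "join i j \<sigma> = relabel ((\<lambda>\<tau>. nupdate ''y'' 0 (nats \<tau> ''lab'' j) \<tau>) (nupdate ''x'' 0 (nats \<sigma> ''lab'' i) \<sigma>))"

text \<open>A single pass over all pairs suffices: links depend on the matrix alone, and relabelling
  never separates rows that already share a label.\<close>

definition merge_linked :: "state \<Rightarrow> state" where
  "merge_linked \<sigma> = fold (\<lambda>i \<tau>. fold (\<lambda>j \<tau>.
     if linked (nrows \<tau>) (ncols \<tau>) (entry \<tau>) i j then join i j \<tau> else \<tau>) [0..<nrows \<tau>] \<tau>) [0..<nrows \<sigma>] \<sigma>"

lemma comp_cmd_relabel: "comp_cmd d (\<lambda>\<rho> \<sigma>. relabel \<sigma>)"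
  unfolding relabel_def
  by (intro comp_cmd_for comp_cmd_when comp_cmd_assign comp_pred_eq comp_fun_read comp_fun_var comp_fun_const)
    simp_all

lemma comp_cmd_join:
  assumes "i < d" and "j < d" shows "comp_cmd d (\<lambda>\<rho>. join (\<rho> i) (\<rho> j))"
proof -
  have x: "comp_cmd d (\<lambda>\<rho> \<sigma>. nupdate ''x'' 0 (nats \<sigma> ''lab'' (\<rho> i)) \<sigma>)"
    using assms by (intro comp_cmd_assign comp_fun_read comp_fun_var comp_fun_const) simp_all
  have y: "comp_cmd d (\<lambda>\<rho> \<sigma>. nupdate ''y'' 0 (nats \<sigma> ''lab'' (\<rho> j)) \<sigma>)"
    using assms by (intro comp_cmd_assign comp_fun_read comp_fun_var comp_fun_const) simp_all
  show ?thesis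
    unfolding join_def by (rule comp_cmd_seq[OF comp_cmd_seq[OF x y] comp_cmd_relabel])
qed

lemma comp_cmd_merge_linked: "comp_cmd 0 (\<lambda>\<rho> \<sigma>. merge_linked \<sigma>)"
  unfolding merge_linked_def
  by (intro comp_cmd_for comp_cmd_when comp_pred_linked comp_fun_var comp_cmd_join) simp_all

definition same_input :: "state \<Rightarrow> state \<Rightarrow> bool" where
  "same_input \<sigma> \<tau> \<longleftrightarrow> nrows \<tau> = nrows \<sigma> \<and> ncols \<tau> = ncols \<sigma> \<and> reals \<tau> = reals \<sigma>"

lemma entry_same_input: "same_input \<sigma> \<tau> \<Longrightarrow> entry \<tau> = entry \<sigma>"
  by (simp add: same_input_def entry_def fun_eq_iff)

lemma init_labels:
  "same_input \<sigma> (init_labels \<sigma>)" "k < nrows \<sigma> \<Longrightarrow> nats (init_labels \<sigma>) ''lab'' k = k"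
proof -
  let ?I = "\<lambda>i \<tau>. same_input \<sigma> \<tau> \<and> (\<forall>k<i. nats \<tau> ''lab'' k = k)"
  have "?I (nrows \<sigma>) (init_labels \<sigma>)"
    unfolding init_labels_def
    by (rule fold_upt_invariant[where I = ?I]) (auto simp: same_input_def less_Suc_eq)
  then show "same_input \<sigma> (init_labels \<sigma>)" "k < nrows \<sigma> \<Longrightarrow> nats (init_labels \<sigma>) ''lab'' k = k"
    by blast+
qed

lemma relabel:
  "same_input \<sigma> (relabel \<sigma>)"
  "k < nrows \<sigma> \<Longrightarrow> nats (relabel \<sigma>) ''lab'' k =
     (if nats \<sigma> ''lab'' k = nats \<sigma> ''y'' 0 then nats \<sigma> ''x'' 0 else nats \<sigma> ''lab'' k)"
proof -
  let ?I = "\<lambda>i \<tau>. same_input \<sigma> \<tau> \<and> nats \<tau> ''x'' = nats \<sigma> ''x'' \<and> nats \<tau> ''y'' = nats \<sigma> ''y'' \<and>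
    (\<forall>k. nats \<tau> ''lab'' k = (if k < i \<and> nats \<sigma> ''lab'' k = nats \<sigma> ''y'' 0 then nats \<sigma> ''x'' 0
      else nats \<sigma> ''lab'' k))"
  have "?I (nrows \<sigma>) (relabel \<sigma>)"
    unfolding relabel_def
    by (rule fold_upt_invariant[where I = ?I]) (auto simp: same_input_def less_Suc_eq)
  then show "same_input \<sigma> (relabel \<sigma>)"
    "k < nrows \<sigma> \<Longrightarrow> nats (relabel \<sigma>) ''lab'' k =
     (if nats \<sigma> ''lab'' k = nats \<sigma> ''y'' 0 then nats \<sigma> ''x'' 0 else nats \<sigma> ''lab'' k)"
    by auto
qed

lemma join:
  "same_input \<sigma> (join i j \<sigma>)"
  "k < nrows \<sigma> \<Longrightarrow> nats (join i j \<sigma>) ''lab'' k =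
     (if nats \<sigma> ''lab'' k = nats \<sigma> ''lab'' j then nats \<sigma> ''lab'' i else nats \<sigma> ''lab'' k)"
  using relabel[where \<sigma> = "nupdate ''y'' 0 (nats \<sigma> ''lab'' j) (nupdate ''x'' 0 (nats \<sigma> ''lab'' i) \<sigma>)"]
  by (simp_all add: join_def same_input_def)

text \<open>Labels are not merged too far: equally labelled rows lie in one component of the link
  graph. Phrasing this through link-closed sets avoids paths and fits the form in which it is
  used.\<close>

definition sound_labels :: "nat \<Rightarrow> nat \<Rightarrow> (nat \<Rightarrow> nat \<Rightarrow> real) \<Rightarrow> (nat \<Rightarrow> nat) \<Rightarrow> bool" where
  "sound_labels m n A l \<longleftrightarrow> (\<forall>X. (\<forall>i<m. \<forall>i'<m. linked m n A i i' \<longrightarrow> (i \<in> X \<longleftrightarrow> i' \<in> X)) \<longrightarrow>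
     (\<forall>i<m. \<forall>i'<m. l i = l i' \<longrightarrow> (i \<in> X \<longleftrightarrow> i' \<in> X)))"

lemma sound_labels_join:
  assumes "sound_labels m n A l" and ij: "i < m" "j < m" "linked m n A i j"
    and l': "\<And>k. k < m \<Longrightarrow> l' k = (if l k = l j then l i else l k)"
  shows "sound_labels m n A l'"
  unfolding sound_labels_def
proof (intro allI impI)
  fix X k k'
  assume X: "\<forall>i<m. \<forall>i'<m. linked m n A i i' \<longrightarrow> (i \<in> X \<longleftrightarrow> i' \<in> X)"
    and k: "k < m" "k' < m" "l' k = l' k'"
  have l: "p \<in> X \<longleftrightarrow> q \<in> X" if "p < m" "q < m" "l p = l q" for p q
    using assms(1) X that unfolding sound_labels_def by blast
  have ijX: "i \<in> X \<longleftrightarrow> j \<in> X" using X ij by blast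
  show "k \<in> X \<longleftrightarrow> k' \<in> X"
    using k(3) l[OF k(1,2)] l[OF k(1) ij(1)] l[OF k(1) ij(2)] l[OF k(2) ij(1)] l[OF k(2) ij(2)] ijX
    by (auto simp: l'[OF k(1)] l'[OF k(2)] split: if_splits)
qed

lemma merge_linked:
  defines "m \<equiv> \<lambda>\<sigma>. nrows \<sigma>"
  assumes sound: "sound_labels (m \<sigma>) (ncols \<sigma>) (entry \<sigma>) (nats \<sigma> ''lab'')"
  shows "same_input \<sigma> (merge_linked \<sigma>)"
    and "sound_labels (m \<sigma>) (ncols \<sigma>) (entry \<sigma>) (nats (merge_linked \<sigma>) ''lab'')"
    and "\<And>i j. i < m \<sigma> \<Longrightarrow> j < m \<sigma> \<Longrightarrow> linked (m \<sigma>) (ncols \<sigma>) (entry \<sigma>) i j \<Longrightarrow>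
      nats (merge_linked \<sigma>) ''lab'' i = nats (merge_linked \<sigma>) ''lab'' j"
proof -
  let ?l = "linked (m \<sigma>) (ncols \<sigma>) (entry \<sigma>)"
  \<comment> \<open>\<open>P\<close> describes the pairs processed so far: all earlier rows, and in
    the inner loop also the earlier part of row \<open>i\<close>.\<close>
  define J where "J P \<tau> \<longleftrightarrow> same_input \<sigma> \<tau> \<and> sound_labels (m \<sigma>) (ncols \<sigma>) (entry \<sigma>) (nats \<tau> ''lab'') \<and>
    (\<forall>i<m \<sigma>. \<forall>j<m \<sigma>. P i j \<and> ?l i j \<longrightarrow> nats \<tau> ''lab'' i = nats \<tau> ''lab'' j)" for P \<tau>
  let ?I = "\<lambda>i. J (\<lambda>i' j. i' < i)"
  let ?I' = "\<lambda>i j. J (\<lambda>i' j'. i' < i \<or> i' = i \<and> j' < j)"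
  let ?F = "\<lambda>i j \<tau>. if linked (nrows \<tau>) (ncols \<tau>) (entry \<tau>) i j then join i j \<tau> else \<tau>"
  have step: "?I' i (Suc j) (?F i j \<tau>)" if ij: "i < m \<sigma>" "j < m \<sigma>" and J: "?I' i j \<tau>" for i j \<tau>
  proof -
    have "same_input \<sigma> \<tau>" using J by (simp add: J_def)
    then have same: "nrows \<tau> = m \<sigma>" "ncols \<tau> = ncols \<sigma>" "entry \<tau> = entry \<sigma>"
      using entry_same_input[of \<sigma> \<tau>] by (simp_all add: same_input_def m_def)
    show ?thesis
    proof (cases "?l i j")
      case True
      have lab: "nats (join i j \<tau>) ''lab'' k =
          (if nats \<tau> ''lab'' k = nats \<tau> ''lab'' j then nats \<tau> ''lab'' i else nats \<tau> ''lab'' k)"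
        if "k < m \<sigma>" for k
        using join(2)[of k \<tau> i j] that same by simp
      have "same_input \<sigma> (join i j \<tau>)"
        using J join(1)[of \<tau> i j] by (simp add: J_def same_input_def)
      moreover have "sound_labels (m \<sigma>) (ncols \<sigma>) (entry \<sigma>) (nats (join i j \<tau>) ''lab'')"
        by (rule sound_labels_join[OF _ ij True lab]) (use J in \<open>simp add: J_def\<close>)
      moreover have "nats (join i j \<tau>) ''lab'' p = nats (join i j \<tau>) ''lab'' q"
        if "p < m \<sigma>" "q < m \<sigma>" "p < i \<or> p = i \<and> q < Suc j" "?l p q" for p q
      proof (cases "p = i \<and> q = j")
        case True
        then show ?thesis using lab ij by simp
      next
        case False
        then have "nats \<tau> ''lab'' p = nats \<tau> ''lab'' q"
          using that J unfolding J_def by (metis less_Suc_eq)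
        then show ?thesis using that lab by simp
      qed
      ultimately have "?I' i (Suc j) (join i j \<tau>)" unfolding J_def by blast
      then show ?thesis using True same by simp
    next
      case False
      then have "?I' i (Suc j) \<tau>" using J unfolding J_def by (metis less_Suc_eq)
      then show ?thesis using False same by simp
    qed
  qed
  have "?I (m \<sigma>) (merge_linked \<sigma>)"
    unfolding merge_linked_def m_def
  proof (rule fold_upt_invariant[where I = ?I])
    show "?I 0 \<sigma>" using sound by (simp add: J_def same_input_def)
    fix i \<tau> assume i: "i < nrows \<sigma>" and I: "?I i \<tau>"
    have r: "nrows \<tau> = m \<sigma>" using I by (simp add: J_def same_input_def m_def)
    have "?I' i (m \<sigma>) (fold (?F i) [0..<m \<sigma>] \<tau>)"
    proof (rule fold_upt_invariant[where I = "?I' i"])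
      show "?I' i 0 \<tau>" using I by (simp add: J_def)
    qed (rule step, use i in \<open>simp_all add: m_def\<close>)
    then show "?I (Suc i) (fold (?F i) [0..<nrows \<tau>] \<tau>)"
      unfolding r by (auto simp: J_def less_Suc_eq)
  qed
  then show "same_input \<sigma> (merge_linked \<sigma>)"
    "sound_labels (m \<sigma>) (ncols \<sigma>) (entry \<sigma>) (nats (merge_linked \<sigma>) ''lab'')"
    "\<And>i j. i < m \<sigma> \<Longrightarrow> j < m \<sigma> \<Longrightarrow> ?l i j \<Longrightarrow>
      nats (merge_linked \<sigma>) ''lab'' i = nats (merge_linked \<sigma>) ''lab'' j"
    by (simp_all add: J_def)
qed

subsection \<open>Writing the output\<close>

text \<open>The updates take effect from the innermost outwards. The number \<open>n / d\<close> is
  obtained by counting the columns selected with \<open>d\<close>; stored as \<open>n1\<close>, it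
  then serves as the selection step for the second factor.\<close>

definition store_sizes :: "state \<Rightarrow> state" where
  "store_sizes \<sigma> =
     (\<lambda>\<tau>. nupdate ''m2'' 0 (card {i. i < nrows \<tau> \<and> i \<in> side \<tau> False}) \<tau>)
     ((\<lambda>\<tau>. nupdate ''m1'' 0 (card {i. i < nrows \<tau> \<and> i \<in> side \<tau> True}) \<tau>)
     ((\<lambda>\<tau>. nupdate ''n2'' 0 (card {j. j < ncols \<tau> \<and> selected \<tau> False (nats \<tau> ''n1'' 0) j}) \<tau>)
     ((\<lambda>\<tau>. nupdate ''n1'' 0 (card {j. j < ncols \<tau> \<and> selected \<tau> True (nats \<tau> ''d'' 0) j}) \<tau>)
     ((\<lambda>\<tau>. nupdate ''d'' 0 (max_divisor \<tau>) \<tau>)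
     (nupdate ''answer'' 0 (if 0 < ncols \<sigma> \<and> (\<exists>i<nrows \<sigma>. i \<in> side \<sigma> False) then 1 else 0) \<sigma>)))))"

lemma comp_cmd_store_sizes: "comp_cmd 0 (\<lambda>\<rho> \<sigma>. store_sizes \<sigma>)"
proof -
  have 1: "comp_cmd 0 (\<lambda>\<rho> \<sigma>. nupdate ''answer'' 0
      (if 0 < ncols \<sigma> \<and> (\<exists>i<nrows \<sigma>. i \<in> side \<sigma> False) then 1 else 0) \<sigma>)"
    by (intro comp_cmd_assign comp_fun_if comp_pred_conj comp_pred_less comp_pred_ex comp_pred_side
        comp_fun_read comp_fun_var comp_fun_const) simp_all
  have 2: "comp_cmd 0 (\<lambda>\<rho> \<tau>. nupdate ''d'' 0 (max_divisor \<tau>) \<tau>)"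
    by (intro comp_cmd_assign comp_fun_max_divisor comp_fun_const) simp_all
  have 3: "comp_cmd 0 (\<lambda>\<rho> \<tau>. nupdate a 0 (card {j. j < ncols \<tau> \<and> selected \<tau> b (nats \<tau> e 0) j}) \<tau>)"
    if "a \<noteq> ''t''" "a \<noteq> ''v''" "a \<noteq> ''m''" "a \<noteq> ''n''" "e \<noteq> ''t''" "e \<noteq> ''v''" for a b e
    using that by (intro comp_cmd_assign comp_fun_card comp_pred_selected comp_fun_read comp_fun_var comp_fun_const)
      simp_all
  have 4: "comp_cmd 0 (\<lambda>\<rho> \<tau>. nupdate a 0 (card {i. i < nrows \<tau> \<and> i \<in> side \<tau> b}) \<tau>)"
    if "a \<noteq> ''t''" "a \<noteq> ''v''" "a \<noteq> ''m''" "a \<noteq> ''n''" for a b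
    using that by (intro comp_cmd_assign comp_fun_card comp_pred_side comp_fun_var comp_fun_const) simp_all
  show ?thesis
    unfolding store_sizes_def
    by (rule comp_cmd_seq[OF _ 4] comp_cmd_seq[OF _ 3] comp_cmd_seq[OF _ 2] 1 | simp)+
qed

definition row_rank :: "state \<Rightarrow> bool \<Rightarrow> nat \<Rightarrow> nat" where
  "row_rank \<sigma> b i = card {k. k < nrows \<sigma> \<and> k < i \<and> k \<in> side \<sigma> b}"

definition col_rank :: "state \<Rightarrow> bool \<Rightarrow> nat \<Rightarrow> nat \<Rightarrow> nat" where
  "col_rank \<sigma> b e j = card {k. k < ncols \<sigma> \<and> k < j \<and> selected \<sigma> b e k}"

text \<open>The target address is recomputed from the ranks of \<open>i\<close> and \<open>j\<close>
  instead of being kept in a pointer, so every write is independent of the preceding ones.\<close>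

definition copy_entry :: "bool \<Rightarrow> string \<Rightarrow> string \<Rightarrow> string \<Rightarrow> nat \<Rightarrow> nat \<Rightarrow> state \<Rightarrow> state" where
  "copy_entry b a e w i j \<sigma> = (if i \<in> side \<sigma> b \<and> selected \<sigma> b (nats \<sigma> e 0) j
     then rupdate a (min (row_rank \<sigma> b i) (nrows \<sigma>) * nats \<sigma> w 0 + col_rank \<sigma> b (nats \<sigma> e 0) j)
       (reals \<sigma> ''S'' (min i (nrows \<sigma>) * ncols \<sigma> + j)) \<sigma> else \<sigma>)"

definition copy_side :: "bool \<Rightarrow> string \<Rightarrow> string \<Rightarrow> string \<Rightarrow> state \<Rightarrow> state" where
  "copy_side b a e w \<sigma> = fold (\<lambda>i \<tau>. fold (copy_entry b a e w i) [0..<ncols \<tau>] \<tau>) [0..<nrows \<sigma>] \<sigma>"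

lemma comp_cmd_copy_side:
  assumes "e \<noteq> ''t''" "e \<noteq> ''v''" "w \<noteq> ''t''" "w \<noteq> ''v''"
  shows "comp_cmd 0 (\<lambda>\<rho> \<sigma>. copy_side b a e w \<sigma>)"
proof -
  have "comp_cmd d (\<lambda>\<rho>. copy_entry b a e w (\<rho> i) (\<rho> j))" if "i < d" "j < d" for i j d
    unfolding copy_entry_def row_rank_def col_rank_def
    using that assms
    by (intro comp_cmd_when comp_cmd_copy comp_pred_conj comp_pred_side comp_pred_selected comp_pred_less
        comp_fun_plus comp_fun_bounded_mult comp_fun_card comp_fun_read comp_fun_var comp_fun_const) simp_all
  then show ?thesis
    unfolding copy_side_def by (intro comp_cmd_for) simp_all
qed

text \<open>The filtered list is strictly increasing, so ranks recover list positions.\<close>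

lemma card_below_nth_filter:
  assumes "a < length (filter Q [0..<n])"
  shows "card {k. k < n \<and> k < filter Q [0..<n] ! a \<and> Q k} = a"
proof -
  let ?xs = "filter Q [0..<n]"
  have sorted: "sorted_wrt (<) ?xs" by (simp add: sorted_wrt_filter)
  have "?xs ! c < ?xs ! a \<longleftrightarrow> c < a" if "c < length ?xs" for c
    using sorted_wrt_nth_less[OF sorted, of c a] sorted_wrt_nth_less[OF sorted, of a c] assms that
    by (metis linorder_neq_iff order.asym)
  then have "{c. c < length ?xs \<and> ?xs ! c < ?xs ! a} = {..<a}" using assms by auto
  then show ?thesis using card_nth_filter[of Q n "\<lambda>k. k < ?xs ! a"] by (simp add: conj_commute)
qed

text \<open>The part of the state that determines sides, selections, ranks and the divisor; writing
  sizes and output arrays leaves it unchanged.\<close>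

definition same_data :: "state \<Rightarrow> state \<Rightarrow> bool" where
  "same_data \<sigma> \<tau> \<longleftrightarrow> nrows \<tau> = nrows \<sigma> \<and> ncols \<tau> = ncols \<sigma> \<and> reals \<tau> ''S'' = reals \<sigma> ''S'' \<and>
    nats \<tau> ''lab'' = nats \<sigma> ''lab''"

lemma same_data_cong:
  assumes "same_data \<sigma> \<tau>"
  shows "nrows \<tau> = nrows \<sigma>" "ncols \<tau> = ncols \<sigma>" "entry \<tau> = entry \<sigma>" "side \<tau> = side \<sigma>"
    "selected \<tau> = selected \<sigma>" "max_divisor \<tau> = max_divisor \<sigma>"
    "row_rank \<tau> = row_rank \<sigma>" "col_rank \<tau> = col_rank \<sigma>"
proof -
  show eq: "nrows \<tau> = nrows \<sigma>" "ncols \<tau> = ncols \<sigma>" "entry \<tau> = entry \<sigma>" "side \<tau> = side \<sigma>"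
    using assms by (simp_all add: same_data_def entry_def side_def fun_eq_iff)
  show sel: "selected \<tau> = selected \<sigma>" by (intro ext) (simp add: selected_def eq)
  show "max_divisor \<tau> = max_divisor \<sigma>" by (simp add: max_divisor_def common_divisor_def eq)
  show "row_rank \<tau> = row_rank \<sigma>" by (intro ext) (simp add: row_rank_def eq)
  show "col_rank \<tau> = col_rank \<sigma>" by (intro ext) (simp add: col_rank_def sel eq)
qed

lemma same_data_nupdate:
  "a \<noteq> ''m'' \<Longrightarrow> a \<noteq> ''n'' \<Longrightarrow> a \<noteq> ''lab'' \<Longrightarrow> same_data \<sigma> (nupdate a i x \<sigma>)"
  by (simp add: same_data_def)

lemmas nupdate_cong = same_data_cong(3-6)[OF same_data_nupdate]

lemma store_sizes:
  "same_data \<sigma> (store_sizes \<sigma>)"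
  "nats (store_sizes \<sigma>) ''answer'' 0 = (if 0 < ncols \<sigma> \<and> (\<exists>i<nrows \<sigma>. i \<in> side \<sigma> False) then 1 else 0)"
  "nats (store_sizes \<sigma>) ''d'' 0 = max_divisor \<sigma>"
  "nats (store_sizes \<sigma>) ''n1'' 0 = card {j. j < ncols \<sigma> \<and> selected \<sigma> True (max_divisor \<sigma>) j}"
  "nats (store_sizes \<sigma>) ''n2'' 0 = card {j. j < ncols \<sigma> \<and>
    selected \<sigma> False (card {j. j < ncols \<sigma> \<and> selected \<sigma> True (max_divisor \<sigma>) j}) j}"
  "nats (store_sizes \<sigma>) ''m1'' 0 = card {i. i < nrows \<sigma> \<and> i \<in> side \<sigma> True}"
  "nats (store_sizes \<sigma>) ''m2'' 0 = card {i. i < nrows \<sigma> \<and> i \<in> side \<sigma> False}"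
  by (simp_all add: store_sizes_def nupdate_cong same_data_def)

text \<open>\<open>F\<close> may read the current state, but as long as only array \<open>a\<close>
  has changed it acts as a fixed conditional write. Writes to the same address carry the same value,
  so later ones do not destroy earlier ones.\<close>

lemma nested_writes:
  fixes \<sigma> :: state
  assumes step: "\<And>i j \<tau>. i < m \<Longrightarrow> j < ncols \<sigma> \<Longrightarrow> nats \<tau> = nats \<sigma> \<Longrightarrow>
      \<forall>b. b \<noteq> a \<longrightarrow> reals \<tau> b = reals \<sigma> b \<Longrightarrow>
      F i j \<tau> = (if C i j then rupdate a (I i j) (V i j) \<tau> else \<tau>)"
    and inj: "\<And>i j i' j'. i < m \<Longrightarrow> j < ncols \<sigma> \<Longrightarrow> i' < m \<Longrightarrow> j' < ncols \<sigma> \<Longrightarrow> C i j \<Longrightarrow> C i' j' \<Longrightarrow>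
      I i j = I i' j' \<Longrightarrow> V i j = V i' j'"
  defines "\<tau> \<equiv> fold (\<lambda>i \<tau>. fold (F i) [0..<ncols \<tau>] \<tau>) [0..<m] \<sigma>"
  shows "nats \<tau> = nats \<sigma>" and "\<And>b. b \<noteq> a \<Longrightarrow> reals \<tau> b = reals \<sigma> b"
    and "\<And>i j. i < m \<Longrightarrow> j < ncols \<sigma> \<Longrightarrow> C i j \<Longrightarrow> reals \<tau> a (I i j) = V i j"
proof -
  define J where "J P \<tau> \<longleftrightarrow> nats \<tau> = nats \<sigma> \<and> (\<forall>b. b \<noteq> a \<longrightarrow> reals \<tau> b = reals \<sigma> b) \<and>
    (\<forall>i<m. \<forall>j<ncols \<sigma>. P i j \<and> C i j \<longrightarrow> reals \<tau> a (I i j) = V i j)" for P and \<tau> :: state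
  let ?I = "\<lambda>i. J (\<lambda>i' j. i' < i)"
  let ?I' = "\<lambda>i j. J (\<lambda>i' j'. i' < i \<or> i' = i \<and> j' < j)"
  have "?I m \<tau>"
    unfolding \<tau>_def
  proof (rule fold_upt_invariant[where I = ?I])
    show "?I 0 \<sigma>" by (simp add: J_def)
    fix i \<tau> assume i: "i < m" and I: "?I i \<tau>"
    have n: "ncols \<tau> = ncols \<sigma>" using I by (simp add: J_def)
    have "?I' i (ncols \<sigma>) (fold (F i) [0..<ncols \<sigma>] \<tau>)"
    proof (rule fold_upt_invariant[where I = "?I' i"])
      show "?I' i 0 \<tau>" using I by (simp add: J_def)
      fix j \<tau> assume j: "j < ncols \<sigma>" and I': "?I' i j \<tau>"
      have F: "F i j \<tau> = (if C i j then rupdate a (I i j) (V i j) \<tau> else \<tau>)"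
        by (rule step[OF i j]) (use I' in \<open>simp_all add: J_def\<close>)
      have "reals (F i j \<tau>) a (I p q) = V p q"
        if pq: "p < m" "q < ncols \<sigma>" "p < i \<or> p = i \<and> q < Suc j" "C p q" for p q
      proof (cases "C i j \<and> I p q = I i j")
        case True
        then show ?thesis using inj[OF pq(1,2) i j pq(4)] F by simp
      next
        case False
        then have "\<not> (p = i \<and> q = j)" using pq(4) by blast
        then have "reals \<tau> a (I p q) = V p q"
          using I' pq unfolding J_def by (metis less_Suc_eq)
        then show ?thesis using False F by auto
      qed
      moreover have "nats (F i j \<tau>) = nats \<sigma>" "\<forall>b. b \<noteq> a \<longrightarrow> reals (F i j \<tau>) b = reals \<sigma> b"
        using I' F by (simp_all add: J_def)
      ultimately show "?I' i (Suc j) (F i j \<tau>)" unfolding J_def by blast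
    qed
    then show "?I (Suc i) (fold (F i) [0..<ncols \<tau>] \<tau>)"
      unfolding n by (auto simp: J_def less_Suc_eq)
  qed
  then show "nats \<tau> = nats \<sigma>" "\<And>b. b \<noteq> a \<Longrightarrow> reals \<tau> b = reals \<sigma> b"
    "\<And>i j. i < m \<Longrightarrow> j < ncols \<sigma> \<Longrightarrow> C i j \<Longrightarrow> reals \<tau> a (I i j) = V i j"
    by (simp_all add: J_def)
qed

lemma copy_side:
  fixes \<sigma> :: state and e w a :: string and b :: bool
  defines "rs \<equiv> filter (\<lambda>i. i \<in> side \<sigma> b) [0..<nrows \<sigma>]"
    and "cs \<equiv> filter (selected \<sigma> b (nats \<sigma> e 0)) [0..<ncols \<sigma>]"
  assumes a: "a \<noteq> ''S''" and w: "nats \<sigma> w 0 = length cs"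
  shows "nats (copy_side b a e w \<sigma>) = nats \<sigma>"
    and "\<And>a'. a' \<noteq> a \<Longrightarrow> reals (copy_side b a e w \<sigma>) a' = reals \<sigma> a'"
    and "stored_mat (copy_side b a e w \<sigma>) a (length rs) (length cs) = submat (entry \<sigma>) rs cs"
proof -
  let ?d = "nats \<sigma> e 0"
  let ?C = "\<lambda>i j. i \<in> side \<sigma> b \<and> selected \<sigma> b ?d j"
  let ?I = "\<lambda>i j. row_rank \<sigma> b i * length cs + col_rank \<sigma> b ?d j"
  have rr: "row_rank \<sigma> b (rs ! p) = p" if "p < length rs" for p
    using card_below_nth_filter[of p "\<lambda>i. i \<in> side \<sigma> b" "nrows \<sigma>"] that unfolding rs_def row_rank_def by simp
  have cr: "col_rank \<sigma> b ?d (cs ! q) = q" if "q < length cs" for q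
    using card_below_nth_filter[of q "selected \<sigma> b ?d" "ncols \<sigma>"] that unfolding cs_def col_rank_def by simp
  have row: "\<exists>p<length rs. i = rs ! p" if "i < nrows \<sigma>" "i \<in> side \<sigma> b" for i
  proof -
    have "i \<in> set rs" using that by (simp add: rs_def)
    then show ?thesis by (metis in_set_conv_nth)
  qed
  have col: "\<exists>q<length cs. j = cs ! q" if "j < ncols \<sigma>" "selected \<sigma> b ?d j" for j
  proof -
    have "j \<in> set cs" using that by (simp add: cs_def)
    then show ?thesis by (metis in_set_conv_nth)
  qed
  have step: "copy_entry b a e w i j \<tau> = (if ?C i j then rupdate a (?I i j) (entry \<sigma> i j) \<tau> else \<tau>)"
    if "i < nrows \<sigma>" "j < ncols \<sigma>" and nats: "nats \<tau> = nats \<sigma>"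
      and reals: "\<forall>a'. a' \<noteq> a \<longrightarrow> reals \<tau> a' = reals \<sigma> a'" for i j \<tau>
  proof -
    have same: "same_data \<sigma> \<tau>" using nats reals a by (simp add: same_data_def)
    have S: "reals \<tau> ''S'' = reals \<sigma> ''S''" using reals a by simp
    have "min (row_rank \<sigma> b i) (nrows \<sigma>) = row_rank \<sigma> b i" if "i \<in> side \<sigma> b"
    proof -
      obtain p where p: "p < length rs" "i = rs ! p" using row \<open>i < nrows \<sigma>\<close> \<open>i \<in> side \<sigma> b\<close> by blast
      moreover have "length rs \<le> nrows \<sigma>" unfolding rs_def by (rule order_trans[OF length_filter_le]) simp
      ultimately show ?thesis using rr by simp
    qed
    then show ?thesis
      unfolding copy_entry_def same_data_cong[OF same] nats w entry_def S by simp
  qed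
  have inj: "entry \<sigma> i j = entry \<sigma> i' j'"
    if ij: "i < nrows \<sigma>" "j < ncols \<sigma>" "i' < nrows \<sigma>" "j' < ncols \<sigma>" "?C i j" "?C i' j'"
      and eq: "?I i j = ?I i' j'" for i j i' j'
  proof -
    obtain p p' q q' where p: "p < length rs" "i = rs ! p" and p': "p' < length rs" "i' = rs ! p'"
      and q: "q < length cs" "j = cs ! q" and q': "q' < length cs" "j' = cs ! q'"
      using ij row col by metis
    have "p * length cs + q = p' * length cs + q'" using eq p p' q q' by (simp add: rr cr)
    then have "(p * length cs + q) div length cs = (p' * length cs + q') div length cs"
      "(p * length cs + q) mod length cs = (p' * length cs + q') mod length cs" by simp_all
    moreover have "cs \<noteq> []" using q by auto
    ultimately have "p = p'" "q = q'" using q q' by simp_all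
    then show ?thesis using p p' q q' by simp
  qed
  show "nats (copy_side b a e w \<sigma>) = nats \<sigma>"
    unfolding copy_side_def
    by (rule nested_writes(1)[where C = ?C and I = ?I and V = "entry \<sigma>"]) (rule step inj; assumption)+
  show "\<And>a'. a' \<noteq> a \<Longrightarrow> reals (copy_side b a e w \<sigma>) a' = reals \<sigma> a'"
    unfolding copy_side_def
    by (rule nested_writes(2)[where C = ?C and I = ?I and V = "entry \<sigma>"]) (assumption | rule step inj; assumption)+
  have written: "reals (copy_side b a e w \<sigma>) a (?I i j) = entry \<sigma> i j"
    if "i < nrows \<sigma>" "j < ncols \<sigma>" "?C i j" for i j
    unfolding copy_side_def
    by (rule nested_writes(3)[where C = ?C and I = ?I and V = "entry \<sigma>"]) (rule that | rule step inj; assumption)+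
  show "stored_mat (copy_side b a e w \<sigma>) a (length rs) (length cs) = submat (entry \<sigma>) rs cs"
  proof (rule eq_matI)
    fix p q assume "p < dim_row (submat (entry \<sigma>) rs cs)" "q < dim_col (submat (entry \<sigma>) rs cs)"
    then have p: "p < length rs" and q: "q < length cs" by (simp_all add: submat_def)
    have "rs ! p \<in> set rs" "cs ! q \<in> set cs" using p q by simp_all
    then have "rs ! p < nrows \<sigma>" "cs ! q < ncols \<sigma>" "?C (rs ! p) (cs ! q)" by (simp_all add: rs_def cs_def)
    from written[OF this] show "stored_mat (copy_side b a e w \<sigma>) a (length rs) (length cs) $$ (p, q) =
        submat (entry \<sigma>) rs cs $$ (p, q)"
      using p q by (simp add: stored_mat_def submat_def rr cr)
  qed (simp_all add: stored_mat_def submat_def)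
qed

text \<open>The output arrays are filled even when the answer is 0; the specification constrains
  them only for 1-products.\<close>

definition split_program :: "state \<Rightarrow> state" where
  "split_program \<sigma> = copy_side False ''S2'' ''n1'' ''n2'' (copy_side True ''S1'' ''d'' ''n1''
     (store_sizes (merge_linked (init_labels \<sigma>))))"

lemma comp_cmd_split_program: "comp_cmd 0 (\<lambda>\<rho> \<sigma>. split_program \<sigma>)"
  unfolding split_program_def
  by (intro comp_cmd_seq[OF _ comp_cmd_copy_side] comp_cmd_seq[OF _ comp_cmd_store_sizes]
      comp_cmd_seq[OF _ comp_cmd_merge_linked] comp_cmd_init_labels) simp_all

lemma split_program:
  assumes S: "S \<in> carrier_mat m n"
  defines "\<tau> \<equiv> split_program (input_state S)"
  shows "output_answer \<tau> = (if is_one_product S then 1 else 0)"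
    and "is_one_product S \<Longrightarrow> nonempty_mat (output_fst \<tau>) \<and> nonempty_mat (output_snd \<tau>) \<and>
      isomorphic_mat (one_prod (output_fst \<tau>) (output_snd \<tau>)) S"
proof -
  define \<sigma>0 where "\<sigma>0 = input_state S"
  define \<sigma>1 where "\<sigma>1 = init_labels \<sigma>0"
  define \<sigma>2 where "\<sigma>2 = merge_linked \<sigma>1"
  define \<sigma>3 where "\<sigma>3 = store_sizes \<sigma>2"
  define \<sigma>4 where "\<sigma>4 = copy_side True ''S1'' ''d'' ''n1'' \<sigma>3"
  have \<tau>: "\<tau> = copy_side False ''S2'' ''n1'' ''n2'' \<sigma>4"
    by (simp add: \<tau>_def split_program_def \<sigma>0_def \<sigma>1_def \<sigma>2_def \<sigma>3_def \<sigma>4_def)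
  define A where "A = entry \<sigma>0"
  define X where "X = side \<sigma>2 True"
  define l where "l = nats \<sigma>2 ''lab''"
  have dims0: "nrows \<sigma>0 = m" "ncols \<sigma>0 = n" using S by (simp_all add: \<sigma>0_def input_state_def)
  have A: "A i j = S $$ (i, j)" if "i < m" "j < n" for i j
  proof -
    have "i * n + j < Suc i * n" using that(2) by simp
    also have "\<dots> \<le> m * n" using that(1) by (intro mult_le_mono1) simp
    finally show ?thesis
      using S that unfolding A_def entry_def dims0 by (simp add: \<sigma>0_def input_state_def)
  qed
  have in1: "same_input \<sigma>0 \<sigma>1" unfolding \<sigma>1_def by (rule init_labels(1))
  have e1: "nrows \<sigma>1 = m" "ncols \<sigma>1 = n" "entry \<sigma>1 = A"
    using in1 entry_same_input[OF in1] dims0 by (simp_all add: same_input_def A_def)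
  have "nats \<sigma>1 ''lab'' k = k" if "k < m" for k
    unfolding \<sigma>1_def using init_labels(2)[of k \<sigma>0] that dims0 by simp
  then have "sound_labels (nrows \<sigma>1) (ncols \<sigma>1) (entry \<sigma>1) (nats \<sigma>1 ''lab'')"
    unfolding e1 sound_labels_def by simp
  note merge = merge_linked[OF this, folded \<sigma>2_def, unfolded e1, folded l_def]
  have e2: "nrows \<sigma>2 = m" "ncols \<sigma>2 = n" "entry \<sigma>2 = A"
    using merge(1) entry_same_input[OF merge(1)] e1 by (simp_all add: same_input_def)
  have X: "i \<in> X \<longleftrightarrow> l i = l 0" for i by (simp add: X_def side_def l_def)
  have X': "side \<sigma>2 False = - X" by (auto simp: X_def side_def)
  have sep: "separable m n A X"
    by (rule linked_same_side_imp_separable) (use merge(3) in \<open>simp add: X\<close>)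
  \<comment> \<open>The row set \<open>X0\<close> of a factorization is closed under links, hence a
    union of label classes. Rows inside and outside \<open>X0\<close> carry different labels, so not
    every row has the label of row 0.\<close>
  have proper: "0 < n \<and> (\<exists>i<m. i \<notin> X)" if product: "is_one_product S"
  proof -
    obtain X0 where X0: "separable m n A X0" "\<exists>i<m. i \<in> X0" "\<exists>i<m. i \<notin> X0" "0 < n"
      using one_product_imp_separable[OF S A product] by blast
    have "\<forall>i<m. \<forall>i'<m. linked m n A i i' \<longrightarrow> (i \<in> X0 \<longleftrightarrow> i' \<in> X0)"
      using separable_imp_linked_same_side[OF X0(1)] by blast
    then have "\<forall>i<m. \<forall>i'<m. l i = l i' \<longrightarrow> (i \<in> X0 \<longleftrightarrow> i' \<in> X0)"
      using merge(2) unfolding sound_labels_def by blast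
    then show ?thesis using X0 X by metis
  qed
  have dat: "same_data \<sigma>2 \<sigma>3" unfolding \<sigma>3_def by (rule store_sizes(1))
  note e3 = same_data_cong[OF dat, unfolded e2]
  let ?d = "max_divisor \<sigma>2"
  have d3: "nats \<sigma>3 ''d'' 0 = ?d" unfolding \<sigma>3_def by (rule store_sizes(3))
  define rs1 where "rs1 = filter (\<lambda>i. i \<in> X) [0..<m]"
  define rs2 where "rs2 = filter (\<lambda>i. i \<notin> X) [0..<m]"
  define cs1 where "cs1 = filter (\<lambda>j. ?d dvd class_rank m A X j) [0..<n]"
  define cs2 where "cs2 = filter (\<lambda>j. length cs1 dvd class_rank m A (- X) j) [0..<n]"
  have sel: "selected \<sigma>2 True e j \<longleftrightarrow> e dvd class_rank m A X j"
    "selected \<sigma>2 False e j \<longleftrightarrow> e dvd class_rank m A (- X) j" if "j < n" for e j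
    using selected_iff[of j \<sigma>2] that e2 by (simp_all add: X_def[symmetric] X')
  have cs1': "filter (selected \<sigma>2 True ?d) [0..<n] = cs1"
    unfolding cs1_def by (rule filter_cong) (simp_all add: sel)
  have cs2': "filter (selected \<sigma>2 False (length cs1)) [0..<n] = cs2"
    unfolding cs2_def by (rule filter_cong) (simp_all add: sel)
  have n1: "nats \<sigma>3 ''n1'' 0 = length cs1"
    unfolding \<sigma>3_def store_sizes(4) e2 cs1'[symmetric] length_filter_upt ..
  have n2: "nats \<sigma>3 ''n2'' 0 = length cs2"
    unfolding \<sigma>3_def store_sizes(5) e2 cs2'[symmetric] length_filter_upt cs1'[symmetric] ..
  have m1: "nats \<sigma>3 ''m1'' 0 = length rs1"
    unfolding \<sigma>3_def store_sizes(6) e2 rs1_def length_filter_upt X_def ..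
  have m2: "nats \<sigma>3 ''m2'' 0 = length rs2"
    unfolding \<sigma>3_def store_sizes(7) e2 rs2_def length_filter_upt X' by simp
  have c1: "nats \<sigma>4 = nats \<sigma>3" "\<And>a. a \<noteq> ''S1'' \<Longrightarrow> reals \<sigma>4 a = reals \<sigma>3 a"
    "stored_mat \<sigma>4 ''S1'' (length rs1) (length cs1) = submat A rs1 cs1"
    using copy_side[of "''S1''" \<sigma>3 "''n1''" True "''d''"] unfolding \<sigma>4_def[symmetric] e3 d3 n1
    by (simp_all add: cs1' rs1_def X_def)
  have dat4: "same_data \<sigma>3 \<sigma>4" using c1 by (simp add: same_data_def)
  note e4 = same_data_cong[OF dat4, unfolded e3]
  have c2: "nats \<tau> = nats \<sigma>3" "\<And>a. a \<noteq> ''S2'' \<Longrightarrow> reals \<tau> a = reals \<sigma>4 a"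
    "stored_mat \<tau> ''S2'' (length rs2) (length cs2) = submat A rs2 cs2"
    using copy_side[of "''S2''" \<sigma>4 "''n2''" False "''n1''"] unfolding \<tau>[symmetric] e4 c1(1) n1 n2
    by (simp_all add: cs2' rs2_def X' e3)
  have out1: "output_fst \<tau> = submat A rs1 cs1"
    unfolding output_fst_def c2(1) m1 n1 c1(3)[symmetric] by (simp add: stored_mat_def c2(2))
  have out2: "output_snd \<tau> = submat A rs2 cs2"
    unfolding output_snd_def c2(1) m2 n2 c2(3) ..
  have ans: "output_answer \<tau> = (if 0 < n \<and> (\<exists>i<m. i \<notin> X) then 1 else 0)"
    unfolding output_answer_def c2(1) \<sigma>3_def store_sizes(2) e2 X' by simp
  have found: "nonempty_mat (output_fst \<tau>) \<and> nonempty_mat (output_snd \<tau>) \<and>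
      isomorphic_mat (one_prod (output_fst \<tau>) (output_snd \<tau>)) S" if npos: "0 < n" and out: "\<exists>i<m. i \<notin> X"
  proof -
    have n: "0 < ncols \<sigma>2" using npos e2 by simp
    note div = max_divisor[OF n, unfolded common_divisor_iff e2, folded X_def]
    have "isomorphic_mat (one_prod (submat A rs1 cs1) (submat A rs2 cs2)) S"
      "0 < length cs1" "0 < length cs2"
      using split_isomorphic[OF S A sep npos div(1) _ _ _ cs1_def cs2_def rs1_def rs2_def] div(2,3)
      by blast+
    moreover obtain i where "i < m" "i \<notin> X" using out by blast
    then have "0 \<in> set rs1" "i \<in> set rs2" using X[of 0] by (simp_all add: rs1_def rs2_def)
    then have "0 < length rs1" "0 < length rs2" by (auto dest: length_pos_if_in_set)
    ultimately show ?thesis by (simp add: out1 out2 nonempty_mat_def submat_def)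
  qed
  \<comment> \<open>The converse direction is the construction itself: a set closed under links with
    rows on both sides yields factors, up to reversing the isomorphism.\<close>
  have "is_one_product S \<longleftrightarrow> 0 < n \<and> (\<exists>i<m. i \<notin> X)"
    using proper found isomorphic_mat_sym unfolding is_one_product_def by blast
  then show "output_answer \<tau> = (if is_one_product S then 1 else 0)"
    and "is_one_product S \<Longrightarrow> nonempty_mat (output_fst \<tau>) \<and> nonempty_mat (output_snd \<tau>) \<and>
      isomorphic_mat (one_prod (output_fst \<tau>) (output_snd \<tau>)) S"
    using ans found by simp_all
qed

theorem theorem1:
  "\<exists>(alg :: com) (p :: nat poly poly).
     \<forall>(m :: nat) (n :: nat) (S :: real mat). S \<in> carrier_mat m n \<longrightarrow>
       (\<exists>t s. exec alg (input_state S) t s \<and> t \<le> poly2 p m n \<and>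
          output_answer s = (if is_one_product S then 1 else 0) \<and>
          (is_one_product S \<longrightarrow>
             nonempty_mat (output_fst s) \<and> nonempty_mat (output_snd s) \<and>
             isomorphic_mat (one_prod (output_fst s) (output_snd s)) S))"
proof -
  obtain alg B where c: "transforms alg B 0 (\<lambda>\<rho> \<sigma>. split_program \<sigma>)"
    using comp_cmd_split_program by (rule comp_cmd_transforms)
  obtain p where p: "\<And>x y. B x y = poly2 p x y"
    using transforms_polybound[OF c] unfolding polybound_def by blast
  have "\<exists>t s. exec alg (input_state S) t s \<and> t \<le> poly2 p m n \<and>
          output_answer s = (if is_one_product S then 1 else 0) \<and>
          (is_one_product S \<longrightarrow>
             nonempty_mat (output_fst s) \<and> nonempty_mat (output_snd s) \<and>
             isomorphic_mat (one_prod (output_fst s) (output_snd s)) S)"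
    if S: "S \<in> carrier_mat m n" for m n S
  proof -
    have dims: "nrows (input_state S) = m" "ncols (input_state S) = n"
      using S by (simp_all add: input_state_def)
    \<comment> \<open>The scratch arrays are zero in the input and are not read by the output
      functions, so blanking them changes nothing at either end.\<close>
    have glob: "glob (input_state S) = input_state S"
      by (auto simp: glob_def input_state_def fun_eq_iff)
    obtain t s where ts: "exec alg (input_state S) t s" "t \<le> B m n" "glob s = split_program (input_state S)"
      using runs_transforms[OF c dims] unfolding runs_def glob by blast
    have "output_answer s = output_answer (glob s)" "output_fst s = output_fst (glob s)"
      "output_snd s = output_snd (glob s)"
      by (simp_all add: output_answer_def output_fst_def output_snd_def stored_mat_def nats_glob)
    then show ?thesis
      using ts split_program[OF S] p by metis
  qed
  then show ?thesis by blast
qed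

end
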